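(* Fix $0<\alpha_0<\alpha_c=\frac{3\sqrt3}{2}$ and let $(\lambda_m)$ be a sequence of positive numbers such that $$0<\alpha_m:=\frac{\lambda_m}{m}\le\alpha_0,\qquad \Lambda_m:=(\lambda_m m^2)^{1/3}\longrightarrow\infty .$$ Let $R_m(\lambda_m)=F_{\lambda_m}-\Pi_mF_{\lambda_m}$ be the Chebyshev projection remainder. Then there exist constants $c,C>0$, depending only on $\alpha_0$, such that for all sufficiently large $m$ $$c\,m^{-1/2}H_e(\alpha_m)^m\le\|R_m(\lambda_m)\|_{2,C}\le C\,m^{-1/2}H_e(\alpha_m)^m$$ and $$c\,m^{-1/2}H_e(\alpha_m)^m\le E_m(\lambda_m)\le\|R_m(\lambda_m)\|_\infty\le C\lambda_m^{-1/6}m^{-1/3}H_e(\alpha_m)^m .$$ If, in addition, $\Lambda_m/\log m\to\infty$, then $$\log\|R_m(\lambda_m)\|_{2,C}\sim\log\|R_m(\lambda_m)\|_\infty\sim\log E_m(\lambda_m)\sim m\log H_e(\alpha_m)\qquad(m\to\infty).$$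
   Context: For $\lambda>0$, $F_\lambda(x)=\exp\!\left(-\lambda\frac{1-x}{1+x}\right)$ for $-1<x\le 1$ and $F_\lambda(-1)=0$. Its Chebyshev coefficients are $a_k(\lambda)=\frac2\pi\int_{-1}^1\frac{F_\lambda(x)T_k(x)}{\sqrt{1-x^2}}\,dx$ for $k\ge0$ ($T_k$ the Chebyshev polynomials of the first kind), and $\Pi_mF_\lambda=\frac{a_0(\lambda)}2+\sum_{k=1}^ma_k(\lambda)T_k$. Norms: $\|g\|_\infty=\sup_{[-1,1]}|g|$ and $\|g\|_{2,C}^2=\int_{-1}^1\frac{|g(x)|^2}{\sqrt{1-x^2}}\,dx$. With $\mathbb P_m$ the polynomials of degree at most $m$, $E_m(\lambda)=\inf_{p\in\mathbb P_m}\|F_\lambda-p\|_\infty$. For $0<\alpha<\alpha_c$, $\zeta_\alpha$ is the unique root of $\alpha(\zeta^3-\zeta)+1=0$ in the open first quadrant, and $$H_e(\alpha)=\left|\frac{\zeta_\alpha-1}{\zeta_\alpha+1}\right|\exp\bigl(\alpha\operatorname{Re}(\zeta_\alpha^2)\bigr).$$ The notation $f_m\sim g_m$ means $f_m/g_m\to1$. *)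

theory Defs
  imports "HOL-Analysis.Analysis" "HOL-Computational_Algebra.Polynomial"
begin

definition F :: "real \<Rightarrow> real \<Rightarrow> real" where
  "F lam x = (if x = -1 then 0 else exp (- lam * ((1 - x) / (1 + x))))"

fun cheb_T :: "nat \<Rightarrow> real poly" where
  "cheb_T 0 = 1"
| "cheb_T (Suc 0) = [:0, 1:]"
| "cheb_T (Suc (Suc k)) = [:0, 2:] * cheb_T (Suc k) - cheb_T k"

(* The integrals are Lebesgue integrals. At the endpoints the weight evaluates to
   1 / 0 = 0, which does not matter since they form a null set. *)

definition cheb_coeff :: "(real \<Rightarrow> real) \<Rightarrow> nat \<Rightarrow> real" where
  "cheb_coeff f k =
     2 / pi * (LINT x:{-1..1}|lborel. f x * poly (cheb_T k) x / sqrt (1 - x\<^sup>2))"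

definition cheb_proj :: "nat \<Rightarrow> (real \<Rightarrow> real) \<Rightarrow> real \<Rightarrow> real" where
  "cheb_proj m f x =
     cheb_coeff f 0 / 2 + (\<Sum>k=1..m. cheb_coeff f k * poly (cheb_T k) x)"

definition cheb_rem :: "nat \<Rightarrow> real \<Rightarrow> real \<Rightarrow> real" where
  "cheb_rem m lam x = F lam x - cheb_proj m (F lam) x"

definition sup_norm :: "(real \<Rightarrow> real) \<Rightarrow> real" where
  "sup_norm g = (SUP x\<in>{-1..1}. \<bar>g x\<bar>)"

definition cheb_L2_norm :: "(real \<Rightarrow> real) \<Rightarrow> real" where
  "cheb_L2_norm g = sqrt (LINT x:{-1..1}|lborel. \<bar>g x\<bar>\<^sup>2 / sqrt (1 - x\<^sup>2))"

definition best_approx :: "nat \<Rightarrow> real \<Rightarrow> real" where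
  "best_approx m lam =
     (INF p\<in>{p :: real poly. degree p \<le> m}. sup_norm (\<lambda>x. F lam x - poly p x))"

definition alpha_c :: real where
  "alpha_c = 3 * sqrt 3 / 2"

(* Meaningful for 0 < \<alpha> < alpha_c only: the other real values of \<alpha> give no
   root in the open first quadrant. *)
definition zeta :: "real \<Rightarrow> complex" where
  "zeta \<alpha> = (THE z. 0 < Re z \<and> 0 < Im z \<and> complex_of_real \<alpha> * (z ^ 3 - z) + 1 = 0)"

definition H_e :: "real \<Rightarrow> real" where
  "H_e \<alpha> = cmod ((zeta \<alpha> - 1) / (zeta \<alpha> + 1)) * exp (\<alpha> * Re ((zeta \<alpha>)\<^sup>2))"

end

theory Submission
  imports Defs "HOL-Probability.Distributions" "HOL-Complex_Analysis.Complex_Analysis"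
    "HOL-Real_Asymp.Real_Asymp"
begin

text \<open>
  Write \<open>x = cos \<theta>\<close> and \<open>t = tan (\<theta> / 2)\<close>. Then \<open>F lam x = exp (- lam t\<^sup>2)\<close>, and the
  Chebyshev coefficient of index \<open>k\<close> is, up to the factor \<open>4 / \<pi>\<close>, the real part of the integral of
  \<open>exp (lam z\<^sup>2) ((1 - z) / (1 + z)) ^ k / (1 - z\<^sup>2)\<close> over the upper half of the imaginary axis.
  This is a Laplace type integral whose exponent has the saddle \<open>z0 = zeta \<alpha>\<close> (and its conjugate),
  where \<open>\<alpha> = lam / k\<close>, and \<open>H_e \<alpha> ^ k\<close> is the modulus of its exponential factor at the saddle.

  The integral may be moved to any vertical line in the right half plane
  (\<open>cheb_coeff_line_integral\<close>). The key observation is that the line through the saddle is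
  already a line of descent, with a global and uniform Gaussian majorant
  (\<open>saddle.phase_bound\<close>). Everything is expressed by the real part \<open>x\<close> of the saddle:
  \<open>\<alpha> = 1 / (2 x (4 x\<^sup>2 - 1))\<close> and \<open>(Im z0)\<^sup>2 = 3 x\<^sup>2 - 1\<close>. Small \<open>\<alpha>\<close> means large \<open>x\<close>, of order
  \<open>\<alpha> powr (-1/3)\<close>, and a bound \<open>\<alpha> \<le> \<alpha>\<^sub>0 < alpha_c\<close> keeps \<open>3 x\<^sup>2 - 1\<close> away from zero. This is how the
  constants become uniform down to \<open>\<alpha> = 0\<close>.

  Upper bounds: one line, chosen for the degree \<open>m\<close>, serves for all coefficients beyond \<open>m\<close>. The
  kernels form a geometric series there, so the Gaussian majorant bounds both the largest
  coefficient (\<open>saddle.abs_coef_le\<close>) and the sum of all of them (\<open>saddle.sum_abs_coef_le\<close>). The sum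
  bounds the uniform norm of the remainder, because the Chebyshev series converges to the function
  (\<open>cheb_series_sums\<close>); the product of both bounds the sum of squares, hence the weighted norm.

  Lower bounds: the coefficients oscillate, so no single one is bounded below. Instead the tail is
  tested against a geometric sequence whose ratio is read off from the saddle. The correlation is
  again one integral over the same line, whose leading term at the saddle does not vanish: it
  consists of two terms of unequal modulus, one for each of the conjugate saddles
  (\<open>saddle.correlation_lower_bound\<close>). The inequality of Cauchy and Schwarz yields the
  lower bound for the sum of squares. Since a polynomial of degree \<open>m\<close> does not change the coefficients beyond \<open>m\<close>, the
  same bound holds for the error of every such polynomial, in the weighted norm by the inequality
  of Bessel and hence, up to \<open>sqrt \<pi>\<close>, in the uniform norm.

  Finally \<open>m ln (H_e \<alpha>)\<close> is at most a negative multiple of \<open>(lam m\<^sup>2) powr (1/3)\<close>. If this dominates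
  \<open>ln m\<close>, the algebraic prefactors are invisible in the logarithms.
\<close>

section \<open>Chebyshev polynomials under the substitution by the cosine\<close>

lemma poly_cheb_T_cos: "poly (cheb_T k) (cos t) = cos (real k * t)"
proof (induction k rule: cheb_T.induct)
  case (3 k)
  have "cos (real (Suc (Suc k)) * t) + cos (real k * t) = 2 * cos t * cos (real (Suc k) * t)"
    using cos_plus_cos[of "real (Suc (Suc k)) * t" "real k * t"]
    by (simp add: algebra_simps add_divide_distrib)
  with 3 show ?case by (simp add: algebra_simps)
qed auto

lemma degree_cheb_T_le: "degree (cheb_T k) \<le> k"
proof (induction k rule: cheb_T.induct)
  case (3 k)
  have "degree ([:0, 2:] * cheb_T (Suc k)) \<le> Suc (Suc k)"
    using degree_mult_le[of "[:0, 2:]" "cheb_T (Suc k)"] 3 by (simp del: mult_pCons_left)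
  with 3 show ?case by (auto intro!: degree_diff_le simp del: mult_pCons_left)
qed auto

lemma abs_poly_cheb_T_le_1: "x \<in> {-1..1} \<Longrightarrow> \<bar>poly (cheb_T k) x\<bar> \<le> 1"
  using poly_cheb_T_cos[of k "arccos x"] by simp

text \<open>The weight has the antiderivative \<open>arcsin\<close>, which stays bounded at the
endpoints where the weight blows up.\<close>

lemma chebyshev_weight_integrable: "set_integrable lborel {-1..1} (\<lambda>x::real. 1 / sqrt (1 - x\<^sup>2))"
proof -
  have "set_integrable lborel (einterval (ereal (-1)) (ereal 1)) (\<lambda>x::real. 1 / sqrt (1 - x\<^sup>2))"
  proof (rule interval_integral_FTC_nonneg(1)[where F=arcsin])
    fix x :: real assume x: "ereal (-1) < ereal x" "ereal x < ereal 1"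
    then have "x\<^sup>2 < 1" by (simp add: abs_square_less_1)
    with x show "DERIV arcsin x :> 1 / sqrt (1 - x\<^sup>2)"
      "isCont (\<lambda>x. 1 / sqrt (1 - x\<^sup>2)) x"
      by (auto intro!: derivative_eq_intros continuous_intros simp: inverse_eq_divide)
  next
    show "AE x in lborel. ereal (- 1) < ereal x \<longrightarrow> ereal x < ereal 1 \<longrightarrow> 0 \<le> 1 / sqrt (1 - x\<^sup>2)"
      by (auto intro!: AE_I2 simp: abs_square_le_1)
  next
    have c: "continuous_on {-1..1} arcsin" by (rule continuous_on_arcsin') 
    have "((arcsin) \<longlongrightarrow> arcsin (-1)) (at (-1) within {-1..1})"
      by (rule c[unfolded continuous_on_def, rule_format]) simp
    then show "((arcsin \<circ> real_of_ereal) \<longlongrightarrow> arcsin (-1)) (at_right (ereal (-1)))"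
      by (simp add: ereal_tendsto_simps at_within_Icc_at_right del: arcsin_minus_1)
    have "((arcsin) \<longlongrightarrow> arcsin 1) (at 1 within {-1..1})"
      by (rule c[unfolded continuous_on_def, rule_format]) simp
    then show "((arcsin \<circ> real_of_ereal) \<longlongrightarrow> arcsin 1) (at_left (ereal 1))"
      by (simp add: ereal_tendsto_simps at_within_Icc_at_left)
  qed auto
  then have *: "integrable lborel (\<lambda>x. indicator {-1<..<1} x *\<^sub>R (1 / sqrt (1 - x\<^sup>2)))"
    by (simp add: set_integrable_def)
  show ?thesis unfolding set_integrable_def
    by (rule Bochner_Integration.integrable_cong_AE_imp[OF * _ AE_I2])
       (auto simp: indicator_def less_le)
qed

text \<open>On \<open>[-\<pi>, 0]\<close> the cosine is increasing and the factor \<open>- sin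
t\<close> of the substitution cancels the weight; evenness of the cosine then moves the interval to
\<open>[0, \<pi>]\<close>.\<close>

lemma chebyshev_weight_integral:
  fixes g :: "real \<Rightarrow> real"
  assumes g: "continuous_on {-1..1} g"
  shows "(LINT x:{-1..1}|lborel. g x / sqrt (1 - x\<^sup>2)) = integral {0..pi} (\<lambda>t. g (cos t))"
proof -
  obtain B where B: "\<And>x. x \<in> {-1..1} \<Longrightarrow> \<bar>g x\<bar> \<le> B"
    using compact_imp_bounded[OF compact_continuous_image[OF g compact_Icc]]
    unfolding bounded_iff by fastforce
  have meas: "set_borel_measurable borel {-1..1} g"
    unfolding set_borel_measurable_def by (rule borel_measurable_continuous_on_indicator) (use g in auto)
  let ?f = "\<lambda>x. g x / sqrt (1 - x\<^sup>2)"
  have int: "set_integrable lborel {-1..1} ?f"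
    unfolding set_integrable_def
  proof (rule Bochner_Integration.integrable_bound)
    show "integrable lborel (\<lambda>x. B * (indicator {-1..1} x *\<^sub>R (1 / sqrt (1 - x\<^sup>2))))"
      using chebyshev_weight_integrable unfolding set_integrable_def by (rule integrable_mult_right)
    have "(\<lambda>x. (indicator {-1..1} x *\<^sub>R g x) * (1 / sqrt (1 - x\<^sup>2))) \<in> borel_measurable borel"
      using meas[unfolded set_borel_measurable_def] by measurable
    then show "(\<lambda>x. indicator {-1..1} x *\<^sub>R (g x / sqrt (1 - x\<^sup>2))) \<in> borel_measurable lborel"
      by simp
  next
    have nn: "0 \<le> sqrt (1 - x\<^sup>2)" if "x \<in> {-1..1}" for x :: real
      using that by (auto simp: abs_square_le_1)
    show "AE x in lborel. norm (indicator {-1..1} x *\<^sub>R (g x / sqrt (1 - x\<^sup>2)))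
       \<le> norm (B * (indicator {-1..1} x *\<^sub>R (1 / sqrt (1 - x\<^sup>2))))"
    proof (rule AE_I2)
      fix x :: real
      show "norm (indicator {-1..1} x *\<^sub>R (g x / sqrt (1 - x\<^sup>2)))
       \<le> norm (B * (indicator {-1..1} x *\<^sub>R (1 / sqrt (1 - x\<^sup>2))))"
        using B[of x] nn[of x]
        by (auto simp: indicator_def abs_mult intro!: divide_right_mono)
    qed
  qed
  have d: "((\<lambda>t. cos t) has_real_derivative - sin t) (at t)" for t
    by (auto intro!: derivative_eq_intros)
  have s: "0 \<le> - sin t" if "t \<in> {-pi..0}" for t
    using sin_ge_zero[of "-t"] that by simp
  have 1: "set_integrable lborel {cos (-pi)..cos 0} ?f" using int by simp
  have "(LINT x:{-1..1}|lborel. ?f x) = (LBINT x. ?f x * indicator {cos (-pi)..cos 0} x)"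
    by (simp add: set_lebesgue_integral_def mult.commute)
  also have "\<dots> = (LBINT t. ?f (cos t) * - sin t * indicator {-pi..0} t)"
    by (rule integral_substitution(2)[OF 1 d _ s]) (auto intro!: continuous_intros)
  also have "\<dots> = (LBINT t. indicator {-pi..0} t *\<^sub>R g (cos t))"
  proof (rule integral_cong_AE)
    have "set_integrable lborel {-pi..0} (\<lambda>t. ?f (cos t) * - sin t)"
      by (rule integral_substitution(1)[OF 1 d _ s]) (auto intro!: continuous_intros)
    then show "(\<lambda>t. ?f (cos t) * - sin t * indicator {-pi..0} t) \<in> borel_measurable lborel"
      unfolding set_integrable_def by (drule_tac borel_measurable_integrable) (simp add: mult.commute)
    have "set_borel_measurable borel {-pi..0} (\<lambda>t. g (cos t))"
      unfolding set_borel_measurable_def by (rule borel_measurable_continuous_on_indicator)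
         (auto intro!: continuous_on_compose2[OF g] continuous_intros)
    then show "(\<lambda>t. indicator {-pi..0} t *\<^sub>R g (cos t)) \<in> borel_measurable lborel"
      by (simp add: set_borel_measurable_def)
    have "AE t in lborel. t \<noteq> 0 \<and> t \<noteq> -pi"
      by (auto intro!: AE_conjI AE_lborel_singleton)
    then show "AE t in lborel. ?f (cos t) * - sin t * indicator {-pi..0} t = indicator {-pi..0} t *\<^sub>R g (cos t)"
    proof eventually_elim
      case (elim t)
      have "sin t < 0" if "t \<in> {-pi..0}" using sin_gt_zero[of "-t"] that elim by auto
      moreover have "1 - (cos t)\<^sup>2 = (sin t)\<^sup>2" by (simp add: sin_squared_eq)
      ultimately show ?case by (auto simp: indicator_def)
    qed
  qed
  also have "\<dots> = (LINT t:{-pi..0}|lborel. g (cos t))" by (simp add: set_lebesgue_integral_def)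
  also have "\<dots> = integral {-pi..-0} (\<lambda>t. g (cos (- t)))"
    by (subst set_borel_integral_eq_integral(2))
       (auto intro!: borel_integrable_atLeastAtMost' continuous_intros
          continuous_on_compose2[OF g])
  also have "\<dots> = integral {0..pi} (\<lambda>t. g (cos t))"
    by (rule Henstock_Kurzweil_Integration.integral_reflect_real)
  finally show ?thesis .
qed

section \<open>Cosine integrals and orthogonality\<close>

lemma cheb_coeff_eq_cosine_integral:
  assumes "continuous_on {-1..1} f"
  shows "cheb_coeff f k = 2 / pi * integral {0..pi} (\<lambda>t. f (cos t) * cos (real k * t))"
  unfolding cheb_coeff_def
  by (subst chebyshev_weight_integral)
     (auto intro!: continuous_intros assms simp: poly_cheb_T_cos)

text \<open>Only the point \<open>-1\<close> needs an argument: with \<open>u = lam (1 - x) / (1 +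
x)\<close>, the bound \<open>exp (- u) \<le> 1 / u\<close> squeezes the function to \<open>0\<close>
there.\<close>

lemma continuous_on_F:
  assumes "lam > 0"
  shows "continuous_on {-1..1} (F lam)"
proof -
  have "continuous (at x within {-1..1}) (F lam)" if x: "x \<in> {-1..1}" for x
  proof (cases "x = -1")
    case False
    have "continuous (at x within {-1..1}) (\<lambda>x. exp (- lam * ((1 - x) / (1 + x))))"
      using False by (intro continuous_intros) auto
    moreover have "\<forall>\<^sub>F y in at x within {-1..1}. y \<noteq> -1"
      by (rule eventually_neq_at_within)
    ultimately have "(F lam \<longlongrightarrow> exp (- lam * ((1 - x) / (1 + x)))) (at x within {-1..1})"
      unfolding continuous_within
      by (rule Lim_transform_eventually[OF _ eventually_mono]) (simp add: F_def)
    then show ?thesis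
      using False by (simp add: continuous_within F_def)
  next
    case True
    have bound: "0 \<le> F lam y \<and> F lam y \<le> (1 + y) / lam" if "y \<in> {-1..0}" for y
    proof (cases "y = -1")
      case False
      with that have y: "0 < 1 + y" "1 \<le> 1 - y" by auto
      define u where "u = lam * ((1 - y) / (1 + y))"
      have "lam * (1 / (1 + y)) \<le> u"
        unfolding u_def by (intro mult_left_mono divide_right_mono) (use assms y in auto)
      then have u: "u \<ge> lam / (1 + y)" by simp
      have "0 < lam / (1 + y)" using assms y by simp
      with u have u0: "u > 0" by linarith
      have "u \<le> exp u" using exp_ge_add_one_self[of u] by linarith
      then have "exp (- u) \<le> inverse u"
        using u0 by (simp add: exp_minus le_imp_inverse_le)
      also have "\<dots> \<le> inverse (lam / (1 + y))"
        using u \<open>0 < lam / (1 + y)\<close> by (rule le_imp_inverse_le)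
      finally show ?thesis using False by (simp add: F_def u_def)
    qed (simp add: F_def)
    have "(F lam \<longlongrightarrow> 0) (at (-1) within {-1..1})"
    proof (rule tendsto_sandwich[of "\<lambda>_. 0" _ _ "\<lambda>y. (1 + y) / lam"])
      have "\<forall>\<^sub>F y in at (-1) within {-1..1::real}. y \<in> {-1..0}"
        unfolding eventually_at by (rule exI[of _ 1]) (auto simp: dist_real_def)
      then show "\<forall>\<^sub>F y in at (-1) within {-1..1}. 0 \<le> F lam y"
        "\<forall>\<^sub>F y in at (-1) within {-1..1}. F lam y \<le> (1 + y) / lam"
        by (auto elim!: eventually_mono simp: bound)
      show "((\<lambda>y. (1 + y) / lam) \<longlongrightarrow> 0) (at (- 1) within {- 1..1})"
        using assms by (auto intro!: tendsto_eq_intros)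
    qed auto
    then show ?thesis using True by (simp add: continuous_within F_def)
  qed
  then show ?thesis by (simp add: continuous_on_eq_continuous_within)
qed

lemma integral_cos_int:
  fixes j :: int
  assumes "j \<noteq> 0"
  shows "integral {0..pi} (\<lambda>t. cos (real_of_int j * t)) = 0"
proof -
  have "((\<lambda>t. cos (real_of_int j * t)) has_integral
      sin (real_of_int j * pi) / real_of_int j - sin (real_of_int j * 0) / real_of_int j) {0..pi}"
    using assms
    by (intro fundamental_theorem_of_calculus)
       (auto intro!: derivative_eq_intros simp: has_real_derivative_iff_has_vector_derivative[symmetric])
  then show ?thesis by (simp add: integral_unique sin_times_pi_eq_0)
qed

lemma integral_cos_cos:
  fixes j k :: nat
  assumes "k \<noteq> 0"
  shows "integral {0..pi} (\<lambda>t. cos (real j * t) * cos (real k * t)) = (if j = k then pi / 2 else 0)"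
proof -
  have "(\<lambda>t. cos (real j * t) * cos (real k * t)) =
    (\<lambda>t. (cos (real_of_int (int j - int k) * t) + cos (real_of_int (int j + int k) * t)) / 2)"
    by (auto simp: cos_times_cos algebra_simps)
  then have "integral {0..pi} (\<lambda>t. cos (real j * t) * cos (real k * t)) =
    (integral {0..pi} (\<lambda>t. cos (real_of_int (int j - int k) * t))
     + integral {0..pi} (\<lambda>t. cos (real_of_int (int j + int k) * t))) / 2"
    by (simp only:) (subst integral_divide, subst Henstock_Kurzweil_Integration.integral_add,
       auto intro!: integrable_continuous_real continuous_intros)
  also have "integral {0..pi} (\<lambda>t. cos (real_of_int (int j + int k) * t)) = 0"
    using assms by (intro integral_cos_int) auto
  also have "integral {0..pi} (\<lambda>t. cos (real_of_int (int j - int k) * t)) = (if j = k then pi else 0)"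
    using integral_cos_int[of "int j - int k"] by (cases "j = k") auto
  finally show ?thesis by (cases "j = k") simp_all
qed

text \<open>Multiplication by \<open>cos t\<close> moves every frequency by one, so each factor
\<open>cos t\<close> costs one unit of the gap between the frequency \<open>j\<close> and the
threshold \<open>K\<close>. A negative \<open>K\<close> is allowed; it expresses that all
coefficients of \<open>D\<close> vanish, and then polynomials of any degree are orthogonal to
\<open>D\<close>.\<close>

lemma integral_cos_power_eq_0:
  fixes D :: "real \<Rightarrow> real" and K :: int
  assumes D: "continuous_on {0..pi} D"
    and zero: "\<And>j. \<bar>j\<bar> \<ge> K \<Longrightarrow> integral {0..pi} (\<lambda>t. D t * cos (real_of_int j * t)) = 0"
    and "\<bar>j\<bar> \<ge> K + int n"
  shows "integral {0..pi} (\<lambda>t. D t * cos t ^ n * cos (real_of_int j * t)) = 0"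
  using assms(3)
proof (induction n arbitrary: j)
  case (Suc n)
  have "D t * cos t ^ Suc n * cos (real_of_int j * t) =
    (D t * cos t ^ n * cos (real_of_int (j + 1) * t) + D t * cos t ^ n * cos (real_of_int (j - 1) * t)) / 2" for t
  proof -
    have "cos t * cos (real_of_int j * t) = (cos (real_of_int (j + 1) * t) + cos (real_of_int (j - 1) * t)) / 2"
      using cos_times_cos[of "real_of_int j * t" t] by (simp add: algebra_simps)
    then have "D t * cos t ^ n * (cos t * cos (real_of_int j * t)) =
      D t * cos t ^ n * ((cos (real_of_int (j + 1) * t) + cos (real_of_int (j - 1) * t)) / 2)"
      by simp
    then show ?thesis by (simp add: algebra_simps)
  qed
  then have "integral {0..pi} (\<lambda>t. D t * cos t ^ Suc n * cos (real_of_int j * t)) =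
    (integral {0..pi} (\<lambda>t. D t * cos t ^ n * cos (real_of_int (j + 1) * t))
     + integral {0..pi} (\<lambda>t. D t * cos t ^ n * cos (real_of_int (j - 1) * t))) / 2"
    by (simp only:) (subst integral_divide, subst Henstock_Kurzweil_Integration.integral_add,
       auto intro!: integrable_continuous_real continuous_intros D)
  also have "\<dots> = 0"
    using Suc.IH[of "j+1"] Suc.IH[of "j-1"] Suc.prems by simp
  finally show ?case .
qed (use zero in simp)

lemma integral_poly_cos_eq_0:
  fixes D :: "real \<Rightarrow> real" and K :: int
  assumes D: "continuous_on {0..pi} D"
    and zero: "\<And>j. \<bar>j\<bar> \<ge> K \<Longrightarrow> integral {0..pi} (\<lambda>t. D t * cos (real_of_int j * t)) = 0"
    and j: "\<bar>j\<bar> \<ge> K + int (degree p)"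
  shows "integral {0..pi} (\<lambda>t. D t * poly p (cos t) * cos (real_of_int j * t)) = 0"
proof -
  have "integral {0..pi} (\<lambda>t. D t * poly p (cos t) * cos (real_of_int j * t)) =
    integral {0..pi} (\<lambda>t. \<Sum>i\<le>degree p. coeff p i * (D t * cos t ^ i * cos (real_of_int j * t)))"
    by (simp add: poly_altdef sum_distrib_left sum_distrib_right mult_ac)
  also have "\<dots> = (\<Sum>i\<le>degree p. coeff p i * integral {0..pi} (\<lambda>t. D t * cos t ^ i * cos (real_of_int j * t)))"
    by (subst Henstock_Kurzweil_Integration.integral_sum)
       (auto intro!: integrable_continuous_real continuous_intros D)
  also have "\<dots> = 0"
    using integral_cos_power_eq_0[OF D zero] j by (intro sum.neutral) auto
  finally show ?thesis .
qed

lemma integral_low_degree_cos_eq_0: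
  assumes "degree p < k"
  shows "integral {0..pi} (\<lambda>t. poly p (cos t) * cos (real k * t)) = 0"
  using integral_poly_cos_eq_0[of "\<lambda>_. 1" 1 p "int k"] assms integral_cos_int by simp

text \<open>The square of the distance between \<open>g\<close> and its partial cosine sum over
\<open>J\<close> is nonnegative. The frequency \<open>0\<close> is excluded because its
normalisation differs by a factor \<open>2\<close>.\<close>

lemma bessel_cosine:
  fixes g :: "real \<Rightarrow> real"
  assumes g: "continuous_on {0..pi} g" and J: "finite J" "0 \<notin> J"
  defines "c \<equiv> \<lambda>k::nat. 2 / pi * integral {0..pi} (\<lambda>t. g t * cos (real k * t))"
  shows "pi / 2 * (\<Sum>k\<in>J. (c k)\<^sup>2) \<le> integral {0..pi} (\<lambda>t. (g t)\<^sup>2)"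
proof -
  define S where "S = (\<lambda>t. \<Sum>k\<in>J. c k * cos (real k * t))"
  have contS: "continuous_on {0..pi} S" unfolding S_def by (intro continuous_intros)
  have gc: "integral {0..pi} (\<lambda>t. g t * cos (real k * t)) = pi / 2 * c k" for k
    by (simp add: c_def)
  have gS: "integral {0..pi} (\<lambda>t. g t * S t) = pi / 2 * (\<Sum>k\<in>J. (c k)\<^sup>2)"
  proof -
    have "integral {0..pi} (\<lambda>t. g t * S t) = integral {0..pi} (\<lambda>t. \<Sum>k\<in>J. c k * (g t * cos (real k * t)))"
      by (simp add: S_def sum_distrib_left mult_ac)
    also have "\<dots> = (\<Sum>k\<in>J. c k * (pi / 2 * c k))"
      by (subst Henstock_Kurzweil_Integration.integral_sum)
         (auto intro!: integrable_continuous_real continuous_intros g J simp: gc)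
    finally show ?thesis by (simp add: sum_distrib_left power2_eq_square mult_ac)
  qed
  have "integral {0..pi} (\<lambda>t. cos (real k * t) * S t) = pi / 2 * c k" if k: "k \<in> J" for k
  proof -
    from k J have "k \<noteq> 0" by metis
    have "integral {0..pi} (\<lambda>t. cos (real k * t) * S t)
      = integral {0..pi} (\<lambda>t. \<Sum>i\<in>J. c i * (cos (real i * t) * cos (real k * t)))"
      by (simp add: S_def sum_distrib_left mult_ac)
    also have "\<dots> = (\<Sum>i\<in>J. c i * integral {0..pi} (\<lambda>t. cos (real i * t) * cos (real k * t)))"
      by (subst Henstock_Kurzweil_Integration.integral_sum)
         (auto intro!: integrable_continuous_real continuous_intros J)
    also have "\<dots> = (\<Sum>i\<in>J. if k = i then c i * (pi / 2) else 0)"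
      using J \<open>k \<noteq> 0\<close> by (intro sum.cong refl, subst integral_cos_cos) auto
    finally show ?thesis using J k by simp
  qed
  then have SS: "integral {0..pi} (\<lambda>t. S t * S t) = pi / 2 * (\<Sum>k\<in>J. (c k)\<^sup>2)"
  proof -
    assume *: "\<And>k. k \<in> J \<Longrightarrow> integral {0..pi} (\<lambda>t. cos (real k * t) * S t) = pi / 2 * c k"
    have "integral {0..pi} (\<lambda>t. S t * S t) = integral {0..pi} (\<lambda>t. \<Sum>k\<in>J. c k * (cos (real k * t) * S t))"
      by (subst (1) S_def) (simp add: sum_distrib_left sum_distrib_right mult_ac)
    also have "\<dots> = (\<Sum>k\<in>J. c k * (pi / 2 * c k))"
      by (subst Henstock_Kurzweil_Integration.integral_sum)
         (auto intro!: integrable_continuous_real continuous_intros contS J simp: *)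
    finally show ?thesis by (simp add: sum_distrib_left power2_eq_square mult_ac)
  qed
  have "0 \<le> integral {0..pi} (\<lambda>t. (g t - S t)\<^sup>2)"
    by (rule integral_nonneg) (auto intro!: integrable_continuous_real continuous_intros g contS)
  also have "(\<lambda>t. (g t - S t)\<^sup>2) = (\<lambda>t. (g t)\<^sup>2 - 2 * (g t * S t) + S t * S t)"
    by (auto simp: power2_eq_square algebra_simps)
  also have "integral {0..pi} \<dots> = integral {0..pi} (\<lambda>t. (g t)\<^sup>2)
     - 2 * integral {0..pi} (\<lambda>t. g t * S t) + integral {0..pi} (\<lambda>t. S t * S t)"
    by (subst Henstock_Kurzweil_Integration.integral_add, (auto intro!: integrable_continuous_real continuous_intros g contS)[2],
        subst Henstock_Kurzweil_Integration.integral_diff, (auto intro!: integrable_continuous_real continuous_intros g contS)[2]) simp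
  finally show ?thesis using gS SS by simp
qed

section \<open>The remainder of the Chebyshev series\<close>

lemma abs_cos_series_summable:
  fixes b :: "nat \<Rightarrow> real"
  assumes "summable (\<lambda>k. \<bar>b k\<bar>)" "\<And>k. \<bar>c k\<bar> \<le> 1"
  shows "summable (\<lambda>k. b k * c k)"
proof (rule summable_comparison_test'[OF assms(1), of 0])
  show "norm (b n * c n) \<le> \<bar>b n\<bar>" for n
    using mult_left_mono[OF assms(2)[of n], of "\<bar>b n\<bar>"] by (simp add: abs_mult)
qed

text \<open>Let \<open>s\<close> be the uniform sum of the series. The difference \<open>d = f -
s\<close> is continuous and all its cosine coefficients vanish, so it is orthogonal to every
polynomial. By the Weierstrass theorem it is orthogonal to itself, hence zero.\<close>

lemma cheb_series_sums:
  fixes f :: "real \<Rightarrow> real"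
  assumes f: "continuous_on {-1..1} f" and sm: "summable (\<lambda>k. \<bar>cheb_coeff f k\<bar>)"
    and x: "x \<in> {-1..1}"
  shows "(\<lambda>k. cheb_coeff f (Suc k) * poly (cheb_T (Suc k)) x) sums (f x - cheb_coeff f 0 / 2)"
proof -
  define a where "a = (\<lambda>k. if k = 0 then cheb_coeff f 0 / 2 else cheb_coeff f k)"
  have sma: "summable (\<lambda>k. \<bar>a k\<bar>)"
    using sm by (rule summable_comparison_test'[of _ 0]) (auto simp: a_def)
  define s where "s = (\<lambda>x. \<Sum>k. a k * poly (cheb_T k) x)"
  have unif: "uniform_limit {-1..1} (\<lambda>n x. \<Sum>k<n. a k * poly (cheb_T k) x) s sequentially"
    unfolding s_def
  proof (rule Weierstrass_m_test[OF _ sma])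
    fix n and y :: real assume "y \<in> {-1..1}"
    from mult_left_mono[OF abs_poly_cheb_T_le_1[OF this, of n], of "\<bar>a n\<bar>"]
    show "norm (a n * poly (cheb_T n) y) \<le> \<bar>a n\<bar>" by (simp add: abs_mult)
  qed
  have conts: "continuous_on {-1..1} s"
    by (rule uniform_limit_theorem[OF _ unif]) (auto intro!: always_eventually continuous_intros)
  define d where "d = (\<lambda>x. f x - s x)"
  have contd: "continuous_on {-1..1} d" unfolding d_def by (intro continuous_intros f conts)
  have contD: "continuous_on {0..pi} (\<lambda>t. h (cos t))" if "continuous_on {-1..1} h" for h :: "real \<Rightarrow> real"
    by (rule continuous_on_compose2[OF that]) (auto intro!: continuous_intros)
  have s_coeff: "integral {0..pi} (\<lambda>t. s (cos t) * cos (real j * t)) = integral {0..pi} (\<lambda>t. f (cos t) * cos (real j * t))" for j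
  proof -
    have part: "integral {0..pi} (\<lambda>t. (\<Sum>k<n. a k * poly (cheb_T k) (cos t)) * cos (real j * t))
      = integral {0..pi} (\<lambda>t. f (cos t) * cos (real j * t))" if n: "n > j" for n
    proof -
      have c0: "integral {0..pi} (\<lambda>t. cos (real k * t) * cos (real j * t)) =
        (if k = j then if j = 0 then pi else pi / 2 else 0)" for k
        using integral_cos_cos[of j k] integral_cos_cos[of k j]
        by (cases "j = 0"; cases "k = 0") (auto simp: mult.commute[of "cos (real k * _)"])
      have "integral {0..pi} (\<lambda>t. (\<Sum>k<n. a k * poly (cheb_T k) (cos t)) * cos (real j * t))
        = integral {0..pi} (\<lambda>t. \<Sum>k<n. a k * (cos (real k * t) * cos (real j * t)))"
        by (simp add: poly_cheb_T_cos sum_distrib_left sum_distrib_right mult_ac)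
      also have "\<dots> = (\<Sum>k<n. a k * (if k = j then if j = 0 then pi else pi / 2 else 0))"
        by (subst Henstock_Kurzweil_Integration.integral_sum)
           (auto intro!: integrable_continuous_real continuous_intros simp: c0)
      also have "\<dots> = a j * (if j = 0 then pi else pi / 2)"
        using n by (simp add: if_distrib[of "\<lambda>x. a _ * x"] sum.delta cong: if_cong)
      also have "\<dots> = integral {0..pi} (\<lambda>t. f (cos t) * cos (real j * t))"
        using cheb_coeff_eq_cosine_integral[OF f, of j]
        by (cases "j = 0") (simp_all add: a_def field_simps)
      finally show ?thesis .
    qed
    have u: "uniform_limit {0..pi} (\<lambda>n t. (\<Sum>k<n. a k * poly (cheb_T k) (cos t)) * cos (real j * t))
        (\<lambda>t. s (cos t) * cos (real j * t)) sequentially"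
    proof (rule uniform_lim_mult)
      show "uniform_limit {0..pi} (\<lambda>n t. \<Sum>k<n. a k * poly (cheb_T k) (cos t)) (\<lambda>t. s (cos t)) sequentially"
        by (rule uniform_limit_compose'[OF unif]) auto
      show "bounded ((\<lambda>t. s (cos t)) ` {0..pi})"
        by (intro compact_imp_bounded compact_continuous_image contD conts compact_Icc)
      show "bounded ((\<lambda>t. cos (real j * t)) ` {0..pi})"
        by (intro compact_imp_bounded compact_continuous_image continuous_intros compact_Icc)
    qed (rule uniform_limit_const)
    obtain I J where IJ:
      "\<And>n. ((\<lambda>t. (\<Sum>k<n. a k * poly (cheb_T k) (cos t)) * cos (real j * t)) has_integral I n) {0..pi}"
      "((\<lambda>t. s (cos t) * cos (real j * t)) has_integral J) {0..pi}" "I \<longlonglongrightarrow> J"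
      by (rule uniform_limit_integral[OF u]) (auto intro!: continuous_intros)
    have "\<forall>\<^sub>F n in sequentially. I n = integral {0..pi} (\<lambda>t. f (cos t) * cos (real j * t))"
      using eventually_gt_at_top[of j]
    proof eventually_elim
      case (elim n)
      show ?case using part[OF elim] integral_unique[OF IJ(1)[of n]] by simp
    qed
    then have "I \<longlonglongrightarrow> integral {0..pi} (\<lambda>t. f (cos t) * cos (real j * t))"
      by (rule tendsto_eventually)
    then have "J = integral {0..pi} (\<lambda>t. f (cos t) * cos (real j * t))"
      using IJ(3) LIMSEQ_unique by blast
    then show ?thesis using IJ(2) by (simp add: integral_unique)
  qed
  have d0: "integral {0..pi} (\<lambda>t. d (cos t) * cos (real_of_int j * t)) = 0" for j
  proof -
    have eq: "(\<lambda>t. d (cos t) * cos (real_of_int j * t)) =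
      (\<lambda>t. f (cos t) * cos (real (nat \<bar>j\<bar>) * t) - s (cos t) * cos (real (nat \<bar>j\<bar>) * t))"
      by (auto simp: d_def algebra_simps abs_if)
    show ?thesis
      unfolding eq using s_coeff[of "nat \<bar>j\<bar>"]
      by (subst Henstock_Kurzweil_Integration.integral_diff)
         (auto intro!: integrable_continuous_real continuous_intros contD f conts)
  qed
  have dp: "integral {0..pi} (\<lambda>t. d (cos t) * poly p (cos t)) = 0" for p
    using integral_poly_cos_eq_0[OF contD[OF contd], of "- int (degree p)" p 0] d0 by simp
  have small: "integral {0..pi} (\<lambda>t. (d (cos t))\<^sup>2) \<le> e * integral {0..pi} (\<lambda>t. \<bar>d (cos t)\<bar>)" if e: "e > 0" for e
  proof -
    obtain g where g: "real_polynomial_function g" "\<And>x. x \<in> {-1..1} \<Longrightarrow> \<bar>d x - g x\<bar> < e"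
      using Stone_Weierstrass_real_polynomial_function[OF compact_Icc contd e] by blast
    then obtain b n where gb: "g = (\<lambda>x. \<Sum>i\<le>n. b i * x^i)"
      using real_polynomial_function_iff_sum by blast
    define p where "p = (\<Sum>i\<le>n. monom (b i) i)"
    have gp: "g = poly p" by (auto simp: gb p_def poly_sum poly_monom)
    have "integral {0..pi} (\<lambda>t. (d (cos t))\<^sup>2) =
      integral {0..pi} (\<lambda>t. d (cos t) * (d (cos t) - poly p (cos t)) + d (cos t) * poly p (cos t))"
      by (simp add: power2_eq_square algebra_simps)
    also have "\<dots> = integral {0..pi} (\<lambda>t. d (cos t) * (d (cos t) - poly p (cos t)))"
      by (subst Henstock_Kurzweil_Integration.integral_add)
         (auto intro!: integrable_continuous_real continuous_intros contD contd simp: dp)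
    also have "\<dots> \<le> integral {0..pi} (\<lambda>t. e * \<bar>d (cos t)\<bar>)"
    proof (rule integral_le)
      fix t assume "t \<in> {0..pi}"
      have "\<bar>d (cos t) - poly p (cos t)\<bar> \<le> e" using g(2)[of "cos t"] by (simp add: gp)
      then have "\<bar>d (cos t)\<bar> * \<bar>d (cos t) - poly p (cos t)\<bar> \<le> \<bar>d (cos t)\<bar> * e"
        by (rule mult_left_mono) simp
      then show "d (cos t) * (d (cos t) - poly p (cos t)) \<le> e * \<bar>d (cos t)\<bar>"
        by (metis abs_le_D1 abs_mult mult.commute)
    qed (auto intro!: integrable_continuous_real continuous_intros contD contd)
    finally show ?thesis by simp
  qed
  define K where "K = integral {0..pi} (\<lambda>t. \<bar>d (cos t)\<bar>)"
  have "integral {0..pi} (\<lambda>t. (d (cos t))\<^sup>2) \<le> 0"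
  proof (rule field_le_epsilon)
    fix e :: real assume e: "e > 0"
    have K: "K \<ge> 0" unfolding K_def 
      by (rule integral_nonneg) (auto intro!: integrable_continuous_real continuous_intros contD contd)
    have "integral {0..pi} (\<lambda>t. (d (cos t))\<^sup>2) \<le> e / (K + 1) * K"
      unfolding K_def by (rule small) (use e K in \<open>simp add: K_def\<close>)
    also have "\<dots> \<le> 0 + e" using e K by (simp add: field_simps)
    finally show "integral {0..pi} (\<lambda>t. (d (cos t))\<^sup>2) \<le> 0 + e" .
  qed
  moreover have "integral {0..pi} (\<lambda>t. (d (cos t))\<^sup>2) \<ge> 0"
    by (rule integral_nonneg) (auto intro!: integrable_continuous_real continuous_intros contD contd)
  ultimately have "integral {0..pi} (\<lambda>t. (d (cos t))\<^sup>2) = 0" by simp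
  then have "\<forall>t\<in>{0..pi}. (d (cos t))\<^sup>2 = 0"
    by (subst (asm) integral_eq_0_iff) (auto intro!: continuous_intros contD contd)
  then have "d x = 0"
    using x by (auto dest!: bspec[of _ _ "arccos x"] simp: arccos_lbound arccos_ubound)
  then have fx: "f x = s x" by (simp add: d_def)
  have "summable (\<lambda>k. a k * poly (cheb_T k) x)"
    by (rule abs_cos_series_summable[OF sma abs_poly_cheb_T_le_1[OF x]])
  then have "(\<lambda>k. a k * poly (cheb_T k) x) sums f x"
    unfolding fx s_def by (rule summable_sums)
  then have "(\<lambda>k. a (Suc k) * poly (cheb_T (Suc k)) x) sums (f x - a 0 * poly (cheb_T 0) x)"
    by (subst sums_Suc_iff) simp
  then show ?thesis by (simp add: a_def)
qed

lemma cheb_rem_sums: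
  assumes "lam > 0" and "summable (\<lambda>k. \<bar>cheb_coeff (F lam) k\<bar>)" and x: "x \<in> {-1..1}"
  shows "(\<lambda>k. cheb_coeff (F lam) (k + Suc m) * poly (cheb_T (k + Suc m)) x) sums cheb_rem m lam x"
proof -
  have "(\<lambda>k. cheb_coeff (F lam) (Suc (k + m)) * poly (cheb_T (Suc (k + m))) x) sums
    (F lam x - cheb_coeff (F lam) 0 / 2 - (\<Sum>k<m. cheb_coeff (F lam) (Suc k) * poly (cheb_T (Suc k)) x))"
    by (rule sums_split_initial_segment[OF cheb_series_sums]) (use assms continuous_on_F in auto)
  moreover have "(\<Sum>k<m. cheb_coeff (F lam) (Suc k) * poly (cheb_T (Suc k)) x)
    = (\<Sum>k=1..m. cheb_coeff (F lam) k * poly (cheb_T k) x)"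
    by (rule sum.reindex_bij_witness[of _ "\<lambda>k. k - 1" Suc]) auto
  ultimately show ?thesis by (simp add: cheb_rem_def cheb_proj_def algebra_simps)
qed

lemma continuous_on_cheb_rem:
  "lam > 0 \<Longrightarrow> continuous_on {-1..1} (cheb_rem m lam)"
  unfolding cheb_rem_def[abs_def] cheb_proj_def
  by (intro continuous_intros continuous_on_F)

lemma sup_norm_cheb_rem_le:
  assumes "lam > 0" and sm: "summable (\<lambda>k. \<bar>cheb_coeff (F lam) k\<bar>)"
  shows "sup_norm (cheb_rem m lam) \<le> (\<Sum>k. \<bar>cheb_coeff (F lam) (k + Suc m)\<bar>)"
  unfolding sup_norm_def
proof (rule cSUP_least)
  fix x :: real assume x: "x \<in> {-1..1}"
  let ?a = "\<lambda>k. cheb_coeff (F lam) (k + Suc m)"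
  have sm': "summable (\<lambda>k. \<bar>?a k\<bar>)" using sm by (rule summable_ignore_initial_segment)
  have "\<bar>cheb_rem m lam x\<bar> = \<bar>\<Sum>k. ?a k * poly (cheb_T (k + Suc m)) x\<bar>"
    using cheb_rem_sums[OF assms x, of m] by (simp add: sums_iff)
  also have "\<dots> \<le> (\<Sum>k. \<bar>?a k\<bar>)"
  proof (rule norm_suminf_le[where 'a=real, unfolded real_norm_def])
    fix k show "\<bar>?a k * poly (cheb_T (k + Suc m)) x\<bar> \<le> \<bar>?a k\<bar>"
      using mult_left_mono[OF abs_poly_cheb_T_le_1[OF x, of "k + Suc m"], of "\<bar>?a k\<bar>"] by (simp add: abs_mult)
  qed (rule sm')
  finally show "\<bar>cheb_rem m lam x\<bar> \<le> (\<Sum>k. \<bar>?a k\<bar>)" .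
qed simp

lemma cheb_L2_norm_eq:
  assumes "continuous_on {-1..1} g"
  shows "cheb_L2_norm g = sqrt (integral {0..pi} (\<lambda>t. (g (cos t))\<^sup>2))"
  unfolding cheb_L2_norm_def
  by (subst chebyshev_weight_integral) (auto intro!: continuous_intros assms)

text \<open>Subtracting a polynomial of degree below \<open>k\<close> does not change the
\<open>k\<close>-th coefficient. This is why the coefficients beyond \<open>m\<close> bound every
approximation of degree \<open>m\<close> from below.\<close>

lemma cheb_coeff_minus_poly:
  assumes f: "continuous_on {-1..1} f" and "degree p < k"
  shows "2 / pi * integral {0..pi} (\<lambda>t. (f (cos t) - poly p (cos t)) * cos (real k * t)) = cheb_coeff f k"
proof -
  have contD: "continuous_on {0..pi} (\<lambda>t. f (cos t))"
    by (rule continuous_on_compose2[OF f]) (auto intro!: continuous_intros)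
  have "integral {0..pi} (\<lambda>t. (f (cos t) - poly p (cos t)) * cos (real k * t)) =
    integral {0..pi} (\<lambda>t. f (cos t) * cos (real k * t)) - integral {0..pi} (\<lambda>t. poly p (cos t) * cos (real k * t))"
    unfolding left_diff_distrib
    by (rule Henstock_Kurzweil_Integration.integral_diff) (auto intro!: integrable_continuous_real continuous_intros contD)
  then show ?thesis
    using integral_low_degree_cos_eq_0[OF assms(2)] cheb_coeff_eq_cosine_integral[OF f] by simp
qed

lemma cheb_L2_norm_minus_poly_ge:
  assumes f: "continuous_on {-1..1} f" and "degree p \<le> m"
  shows "pi / 2 * (\<Sum>k<n. (cheb_coeff f (k + Suc m))\<^sup>2) \<le> (cheb_L2_norm (\<lambda>x. f x - poly p x))\<^sup>2"
proof -
  have contD: "continuous_on {0..pi} (\<lambda>t. f (cos t) - poly p (cos t))"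
    by (intro continuous_intros continuous_on_compose2[OF f]) auto
  have "pi / 2 * (\<Sum>k<n. (cheb_coeff f (k + Suc m))\<^sup>2) = pi / 2 * (\<Sum>k\<in>(\<lambda>k. k + Suc m) ` {..<n}. (cheb_coeff f k)\<^sup>2)"
    by (subst sum.reindex) (auto simp: inj_on_def)
  also have "(\<Sum>k\<in>(\<lambda>k. k + Suc m) ` {..<n}. (cheb_coeff f k)\<^sup>2) =
    (\<Sum>k\<in>(\<lambda>k. k + Suc m) ` {..<n}. (2 / pi * integral {0..pi} (\<lambda>t. (f (cos t) - poly p (cos t)) * cos (real k * t)))\<^sup>2)"
    using assms by (intro sum.cong refl arg_cong[where f="\<lambda>x. x\<^sup>2"] cheb_coeff_minus_poly[OF f, symmetric]) auto
  also have "pi / 2 * \<dots> \<le> integral {0..pi} (\<lambda>t. (f (cos t) - poly p (cos t))\<^sup>2)"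
    by (rule bessel_cosine[OF contD]) auto
  also have "\<dots> = (cheb_L2_norm (\<lambda>x. f x - poly p x))\<^sup>2"
  proof -
    have "0 \<le> integral {0..pi} (\<lambda>t. (f (cos t) - poly p (cos t))\<^sup>2)"
      by (rule integral_nonneg) (auto intro!: integrable_continuous_real continuous_on_power contD)
    then show ?thesis by (subst cheb_L2_norm_eq) (auto intro!: continuous_intros f)
  qed
  finally show ?thesis .
qed

lemma cheb_proj_is_poly:
  obtains p where "degree p \<le> m" "cheb_rem m lam = (\<lambda>x. F lam x - poly p x)"
proof
  let ?p = "[:cheb_coeff (F lam) 0 / 2:] + (\<Sum>k=1..m. smult (cheb_coeff (F lam) k) (cheb_T k))"
  show "degree ?p \<le> m"
    by (intro degree_add_le degree_sum_le order.trans[OF degree_smult_le] order.trans[OF degree_cheb_T_le]) auto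
  show "cheb_rem m lam = (\<lambda>x. F lam x - poly ?p x)"
    by (auto simp: cheb_rem_def cheb_proj_def poly_sum)
qed

text \<open>One half of the Parseval identity for the remainder. The squared norm is obtained by
integrating the uniformly convergent series of the remainder against the remainder itself.\<close>

lemma cheb_L2_norm_rem_le:
  assumes lam: "lam > 0" and sm: "summable (\<lambda>k. \<bar>cheb_coeff (F lam) k\<bar>)"
    and B: "\<And>n. (\<Sum>k<n. (cheb_coeff (F lam) (k + Suc m))\<^sup>2) \<le> B"
  shows "(cheb_L2_norm (cheb_rem m lam))\<^sup>2 \<le> pi / 2 * B"
proof -
  let ?a = "\<lambda>k. cheb_coeff (F lam) (k + Suc m)"
  define R where "R = (\<lambda>t. cheb_rem m lam (cos t))"
  have contR: "continuous_on {0..pi} R" unfolding R_def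
    by (rule continuous_on_compose2[OF continuous_on_cheb_rem[OF lam]]) (auto intro!: continuous_intros)
  have coeff: "integral {0..pi} (\<lambda>t. R t * cos (real (k + Suc m) * t)) = pi / 2 * ?a k" for k
  proof -
    obtain p where p: "degree p \<le> m" "cheb_rem m lam = (\<lambda>x. F lam x - poly p x)"
      by (rule cheb_proj_is_poly)
    show ?thesis
      using cheb_coeff_minus_poly[OF continuous_on_F[OF lam], of p "k + Suc m"] p(1)
      by (simp add: R_def p(2) field_simps)
  qed
  have unif: "uniform_limit {0..pi} (\<lambda>n t. \<Sum>k<n. ?a k * cos (real (k + Suc m) * t)) R sequentially"
  proof -
    have "uniform_limit {0..pi} (\<lambda>n t. \<Sum>k<n. ?a k * cos (real (k + Suc m) * t))
       (\<lambda>t. \<Sum>k. ?a k * cos (real (k + Suc m) * t)) sequentially"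
    proof (rule Weierstrass_m_test)
      show "summable (\<lambda>k. \<bar>?a k\<bar>)" using sm by (rule summable_ignore_initial_segment)
      show "norm (?a n * cos (real (n + Suc m) * t)) \<le> \<bar>?a n\<bar>" for n t
        using mult_left_mono[OF abs_cos_le_one[of "real (n + Suc m) * t"], of "\<bar>?a n\<bar>"]
        by (simp add: abs_mult del: of_nat_add)
    qed
    also have "(\<lambda>t. \<Sum>k. ?a k * cos (real (k + Suc m) * t)) = R"
    proof
      fix t
      show "(\<Sum>k. ?a k * cos (real (k + Suc m) * t)) = R t"
        using cheb_rem_sums[OF lam sm, of "cos t" m] unfolding R_def sums_iff
        by (simp add: poly_cheb_T_cos)
    qed
    finally show ?thesis .
  qed
  have u2: "uniform_limit {0..pi} (\<lambda>n t. R t * (\<Sum>k<n. ?a k * cos (real (k + Suc m) * t))) (\<lambda>t. R t * R t) sequentially"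
  proof (rule uniform_lim_mult[OF uniform_limit_const unif])
    show "bounded (R ` {0..pi})" "bounded (R ` {0..pi})"
      by (intro compact_imp_bounded compact_continuous_image contR compact_Icc)+
  qed
  obtain I J where IJ:
    "\<And>n. ((\<lambda>t. R t * (\<Sum>k<n. ?a k * cos (real (k + Suc m) * t))) has_integral I n) {0..pi}"
    "((\<lambda>t. R t * R t) has_integral J) {0..pi}" "I \<longlonglongrightarrow> J"
    by (rule uniform_limit_integral[OF u2]) (auto intro!: continuous_intros contR)
  have "I n = pi / 2 * (\<Sum>k<n. (?a k)\<^sup>2)" for n
  proof -
    have "I n = integral {0..pi} (\<lambda>t. \<Sum>k<n. ?a k * (R t * cos (real (k + Suc m) * t)))"
      using IJ(1)[of n] by (simp add: integral_unique sum_distrib_left mult_ac)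
    also have "\<dots> = (\<Sum>k<n. ?a k * integral {0..pi} (\<lambda>t. R t * cos (real (k + Suc m) * t)))"
      by (subst Henstock_Kurzweil_Integration.integral_sum)
         (auto intro!: integrable_continuous_real continuous_intros contR)
    also have "\<dots> = (\<Sum>k<n. ?a k * (pi / 2 * ?a k))"
      by (simp only: coeff)
    finally show ?thesis by (simp add: sum_distrib_left power2_eq_square mult_ac)
  qed
  then have "I n \<le> pi / 2 * B" for n
    using B[of n] by (simp add: mult_left_mono)
  then have "J \<le> pi / 2 * B" by (intro LIMSEQ_le_const2[OF IJ(3)]) blast
  moreover have "J = (cheb_L2_norm (cheb_rem m lam))\<^sup>2"
    using IJ(2) integral_nonneg[of "\<lambda>t. (R t)\<^sup>2" "{0..pi}"]
    by (subst cheb_L2_norm_eq[OF continuous_on_cheb_rem[OF lam]])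
       (auto simp: R_def power2_eq_square integral_unique has_integral_integrable)
  ultimately show ?thesis by simp
qed

lemma sup_norm_bdd:
  assumes "continuous_on {-1..1} g" "x \<in> {-1..1}"
  shows "\<bar>g x\<bar> \<le> sup_norm g"
  unfolding sup_norm_def
  using assms by (intro cSUP_upper bounded_imp_bdd_above compact_imp_bounded compact_continuous_image
      compact_Icc continuous_intros)

text \<open>The weight has total mass \<open>\<pi>\<close>.\<close>

lemma cheb_L2_norm_le_sup_norm:
  assumes g: "continuous_on {-1..1} g"
  shows "cheb_L2_norm g \<le> sqrt pi * sup_norm g"
proof -
  have s0: "sup_norm g \<ge> 0" using sup_norm_bdd[OF g, of 0] by simp
  have "integral {0..pi} (\<lambda>t. (g (cos t))\<^sup>2) \<le> integral {0..pi} (\<lambda>t. (sup_norm g)\<^sup>2)"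
  proof (rule integral_le)
    show "(g (cos t))\<^sup>2 \<le> (sup_norm g)\<^sup>2" for t
      using sup_norm_bdd[OF g, of "cos t"] s0 by (simp add: abs_le_square_iff[symmetric])
  qed (auto intro!: integrable_continuous_real continuous_intros continuous_on_compose2[OF g])
  also have "\<dots> = pi * (sup_norm g)\<^sup>2" by simp
  finally have "sqrt (integral {0..pi} (\<lambda>t. (g (cos t))\<^sup>2)) \<le> sqrt (pi * (sup_norm g)\<^sup>2)" by simp
  then show ?thesis using s0 by (simp add: cheb_L2_norm_eq[OF g] real_sqrt_mult)
qed

lemma best_approx_le_sup_norm_rem:
  assumes "lam > 0"
  shows "best_approx m lam \<le> sup_norm (cheb_rem m lam)"
proof -
  obtain p where p: "degree p \<le> m" "cheb_rem m lam = (\<lambda>x. F lam x - poly p x)"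
    by (rule cheb_proj_is_poly)
  have "bdd_below ((\<lambda>p. sup_norm (\<lambda>x. F lam x - poly p x)) ` {p. degree p \<le> m})"
  proof (rule bdd_belowI2)
    fix q :: "real poly"
    show "0 \<le> sup_norm (\<lambda>x. F lam x - poly q x)"
      using sup_norm_bdd[of "\<lambda>x. F lam x - poly q x" 0] assms
      by (force intro!: continuous_intros continuous_on_F)
  qed
  then show ?thesis unfolding best_approx_def p(2) using p(1) by (intro cINF_lower) auto
qed

lemma best_approx_ge:
  assumes "lam > 0" and B: "\<And>p. degree p \<le> m \<Longrightarrow> B \<le> cheb_L2_norm (\<lambda>x. F lam x - poly p x)"
  shows "B / sqrt pi \<le> best_approx m lam"
  unfolding best_approx_def
proof (rule cINF_greatest)
  show "{p :: real poly. degree p \<le> m} \<noteq> {}" by (auto intro!: exI[of _ 0])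
  fix p :: "real poly" assume "p \<in> {p. degree p \<le> m}"
  then have "B \<le> sqrt pi * sup_norm (\<lambda>x. F lam x - poly p x)"
    using B[of p] cheb_L2_norm_le_sup_norm[of "\<lambda>x. F lam x - poly p x"] continuous_on_F[OF assms(1)]
    by (force intro!: continuous_intros)
  then show "B / sqrt pi \<le> sup_norm (\<lambda>x. F lam x - poly p x)" by (simp add: field_simps)
qed

section \<open>Chebyshev coefficients as integrals along vertical lines\<close>

lemma gaussian_abs_moment:
  fixes \<gamma> :: real
  assumes "\<gamma> > 0" and "has_bochner_integral lborel (\<lambda>x::real. indicator {0..} x *\<^sub>R (exp (-x\<^sup>2) * x ^ k)) I"
  shows "has_bochner_integral lborel (\<lambda>x::real. exp (- \<gamma> * x\<^sup>2) * \<bar>x\<bar> ^ k) (2 * I / sqrt \<gamma> ^ Suc k)"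
proof -
  have "has_bochner_integral lborel (\<lambda>x::real. indicator {0..} x *\<^sub>R (exp (-x\<^sup>2) * \<bar>x\<bar> ^ k)) I"
    by (rule has_bochner_integral_cong[THEN iffD1, OF _ _ _ assms(2)]) (auto simp: indicator_def)
  from has_bochner_integral_even_function[OF this]
  have "has_bochner_integral lborel (\<lambda>x::real. exp (-x\<^sup>2) * \<bar>x\<bar> ^ k) (2 * I)" by simp
  then have "has_bochner_integral lborel (\<lambda>x. exp (-(0 + sqrt \<gamma> * x)\<^sup>2) * \<bar>0 + sqrt \<gamma> * x\<bar> ^ k) ((2 * I) /\<^sub>R \<bar>sqrt \<gamma>\<bar>)"
    by (subst lborel_has_bochner_integral_real_affine_iff[symmetric]) (use assms in auto)
  then have "has_bochner_integral lborel (\<lambda>x. (exp (-(0 + sqrt \<gamma> * x)\<^sup>2) * \<bar>0 + sqrt \<gamma> * x\<bar> ^ k) / sqrt \<gamma> ^ k)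
     ((2 * I) /\<^sub>R \<bar>sqrt \<gamma>\<bar> / sqrt \<gamma> ^ k)"
    by (rule has_bochner_integral_divide_zero)
  also have "(\<lambda>x. (exp (-(0 + sqrt \<gamma> * x)\<^sup>2) * \<bar>0 + sqrt \<gamma> * x\<bar> ^ k) / sqrt \<gamma> ^ k)
    = (\<lambda>x. exp (- \<gamma> * x\<^sup>2) * \<bar>x\<bar> ^ k)"
    using assms(1) by (auto simp: fun_eq_iff abs_mult power_mult_distrib)
  also have "(2 * I) /\<^sub>R \<bar>sqrt \<gamma>\<bar> / sqrt \<gamma> ^ k = 2 * I / sqrt \<gamma> ^ Suc k"
    using assms(1) by (simp add: field_simps)
  finally show ?thesis .
qed

text \<open>The exact moments of order \<open>0\<close>, \<open>1\<close> and \<open>3\<close>: the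
first gives the size of the coefficients, the others measure the Lipschitz error of the amplitude
and the cubic error of the exponent in the saddle point argument.\<close>

lemma gaussian_integral:
  fixes \<gamma> :: real
  assumes "\<gamma> > 0"
  shows "has_bochner_integral lborel (\<lambda>x. exp (- \<gamma> * x\<^sup>2)) (sqrt (pi / \<gamma>))"
    and "has_bochner_integral lborel (\<lambda>x. exp (- \<gamma> * x\<^sup>2) * \<bar>x\<bar>) (1 / \<gamma>)"
    and "has_bochner_integral lborel (\<lambda>x. exp (- \<gamma> * x\<^sup>2) * \<bar>x\<bar> ^ 3) (1 / \<gamma>\<^sup>2)"
proof -
  show "has_bochner_integral lborel (\<lambda>x. exp (- \<gamma> * x\<^sup>2)) (sqrt (pi / \<gamma>))"
    using gaussian_abs_moment[OF assms, of 0 "sqrt pi / 2"] gaussian_moment_0 by (simp add: real_sqrt_divide)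
  show "has_bochner_integral lborel (\<lambda>x. exp (- \<gamma> * x\<^sup>2) * \<bar>x\<bar>) (1 / \<gamma>)"
    using gaussian_abs_moment[OF assms, of 1 "1 / 2"] gaussian_moment_1 assms by simp
  have "sqrt \<gamma> ^ Suc 3 = (sqrt \<gamma> ^ 2) ^ 2" by (simp flip: power_mult)
  also have "\<dots> = \<gamma>\<^sup>2" using assms by simp
  finally have *: "sqrt \<gamma> ^ Suc 3 = \<gamma>\<^sup>2" .
  have "has_bochner_integral lborel (\<lambda>x::real. indicator {0..} x *\<^sub>R (exp (-x\<^sup>2) * x ^ 3)) (1 / 2)"
    using gaussian_moment_odd_pos[of 1] by simp
  from gaussian_abs_moment[OF assms this, unfolded *]
  show "has_bochner_integral lborel (\<lambda>x. exp (- \<gamma> * x\<^sup>2) * \<bar>x\<bar> ^ 3) (1 / \<gamma>\<^sup>2)"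
    by simp
qed

text \<open>With \<open>z = i tan (\<theta> / 2)\<close> one has \<open>exp (- i \<theta>) = (1 - z)
/ (1 + z)\<close>, and \<open>F (cos \<theta>) = exp (lam z\<^sup>2)\<close>. The kernel is the
integrand of the coefficient of index \<open>n + 1\<close> in the variable \<open>z\<close>; the
factor \<open>1 / (1 - z\<^sup>2)\<close> from \<open>d\<theta>\<close> has been cancelled against
the power, which removes the apparent pole at \<open>1\<close> and leaves only the pole at
\<open>-1\<close>.\<close>

definition cheb_kernel :: "real \<Rightarrow> nat \<Rightarrow> complex \<Rightarrow> complex" where
  "cheb_kernel lam n z = exp (of_real lam * z\<^sup>2) * (1 - z) ^ n / (1 + z) ^ (n + 2)"

lemma Re_cheb_kernel_imag_axis:
  "Re (cheb_kernel lam n (\<i> * of_real t)) = exp (- lam * t\<^sup>2) * cos (real (Suc n) * (2 * arctan t)) / (1 + t\<^sup>2)"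
proof -
  define r where "r = sqrt (1 + t\<^sup>2)"
  define \<theta> where "\<theta> = arctan t"
  have r: "r > 0" "r\<^sup>2 = 1 + t\<^sup>2" by (auto simp: r_def add_pos_nonneg)
  have cs: "r * cos \<theta> = 1" "r * sin \<theta> = t"
    using r(1) by (auto simp: \<theta>_def r_def cos_arctan sin_arctan)
  have 1: "1 + \<i> * of_real t = of_real r * cis \<theta>" "1 - \<i> * of_real t = of_real r * cis (-\<theta>)"
    by (auto simp: complex_eq_iff cs)
  have "of_real lam * (\<i> * of_real t)\<^sup>2 = complex_of_real (- lam * t\<^sup>2)"
    by (simp add: power_mult_distrib)
  then have "exp (of_real lam * (\<i> * of_real t)\<^sup>2) = complex_of_real (exp (- lam * t\<^sup>2))"
    by (metis exp_of_real)
  then have "cheb_kernel lam n (\<i> * of_real t) = complex_of_real (exp (- lam * t\<^sup>2)) *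
      ((of_real r ^ n * cis (real n * (-\<theta>))) / (of_real r ^ (n + 2) * cis (real (n + 2) * \<theta>)))"
    unfolding cheb_kernel_def 1 by (simp only: power_mult_distrib Complex.DeMoivre times_divide_eq_right)
  also have "(of_real r ^ n * cis (real n * (-\<theta>))) / (of_real r ^ (n + 2) * cis (real (n + 2) * \<theta>))
     = complex_of_real (1 / r\<^sup>2) * (cis (real n * (-\<theta>)) / cis (real (n + 2) * \<theta>))"
    using r(1) by (simp add: power_add power2_eq_square divide_simps)
  also have "cis (real n * (-\<theta>)) / cis (real (n + 2) * \<theta>) = cis (- (real (Suc n) * (2 * \<theta>)))"
    by (simp add: cis_divide algebra_simps)
  finally show ?thesis by (simp add: \<theta>_def r(2) mult_ac)
qed

lemma integral_F_cos_substitution: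
  assumes "lam > 0" "T \<ge> 0"
  shows "((\<lambda>t. 2 * Re (cheb_kernel lam n (\<i> * of_real t))) has_integral
     integral {0..2 * arctan T} (\<lambda>\<theta>. F lam (cos \<theta>) * cos (real (Suc n) * \<theta>))) {0..T}"
proof -
  have contF: "continuous_on {0..2 * arctan T} (\<lambda>\<theta>. F lam (cos \<theta>) * cos (real (Suc n) * \<theta>))"
    using arctan_ubound[of T] assms
    by (intro continuous_intros continuous_on_compose2[OF continuous_on_F]) auto
  have eq: "(2 / (1 + t\<^sup>2)) *\<^sub>R (F lam (cos (2 * arctan t)) * cos (real (Suc n) * (2 * arctan t)))
     = 2 * Re (cheb_kernel lam n (\<i> * of_real t))" for t
  proof -
    have t: "1 + t\<^sup>2 > 0" by (simp add: add_pos_nonneg)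
    have c: "cos (2 * arctan t) = 2 / (1 + t\<^sup>2) - 1"
      using t by (simp add: cos_double_cos cos_arctan power_divide)
    have "cos (2 * arctan t) \<noteq> -1" using t by (simp add: c)
    moreover have "(1 - cos (2 * arctan t)) / (1 + cos (2 * arctan t)) = t\<^sup>2"
      using t unfolding c by (simp add: field_simps)
    ultimately have "F lam (cos (2 * arctan t)) = exp (- lam * t\<^sup>2)" by (simp add: F_def)
    then show ?thesis unfolding Re_cheb_kernel_imag_axis by (simp add: mult_ac)
  qed
  have "((\<lambda>t. (2 / (1 + t\<^sup>2)) *\<^sub>R (F lam (cos (2 * arctan t)) * cos (real (Suc n) * (2 * arctan t)))) has_integral
     integral {2 * arctan 0..2 * arctan T} (\<lambda>\<theta>. F lam (cos \<theta>) * cos (real (Suc n) * \<theta>))) {0..T}"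
    by (rule has_integral_substitution[where g="\<lambda>t. 2 * arctan t" and c=0 and d="2 * arctan T"])
       (use assms contF in \<open>auto intro!: derivative_eq_intros simp: arctan_le_iff zero_le_arctan_iff inverse_eq_divide\<close>)
  then show ?thesis by (simp only: eq arctan_zero_zero mult_zero_right)
qed

text \<open>In the right half plane \<open>\<bar>1 - z\<bar> \<le> \<bar>1 + z\<bar>\<close> and
\<open>\<bar>1 + z\<bar> \<ge> 1\<close>, so only the exponential is left.\<close>

lemma norm_cheb_kernel_le:
  assumes "Re z \<ge> 0"
  shows "norm (cheb_kernel lam n z) \<le> exp (lam * ((Re z)\<^sup>2 - (Im z)\<^sup>2))"
proof -
  have le: "norm (1 - z) \<le> norm (1 + z)"
    unfolding cmod_def using assms by (auto simp: power2_eq_square algebra_simps)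
  have ge1: "norm (1 + z) \<ge> 1"
    using assms complex_Re_le_cmod[of "1 + z"] by simp
  have "norm (1 - z) ^ n \<le> norm (1 + z) ^ n * norm (1 + z)^2"
    using power_mono[OF le, of n] one_le_power[OF ge1, of 2] mult_mono[of "norm (1 - z) ^ n" "norm (1 + z) ^ n" 1 "norm (1 + z)^2"]
    by simp
  moreover have "0 < norm (1 + z) ^ n * norm (1 + z)^2"
    using ge1 by (intro mult_pos_pos zero_less_power) linarith+
  ultimately have "exp (Re (of_real lam * z\<^sup>2)) * (norm (1 - z) ^ n / (norm (1 + z) ^ n * norm (1 + z)^2))
    \<le> exp (lam * ((Re z)\<^sup>2 - (Im z)\<^sup>2)) * 1"
    by (intro mult_mono) (simp_all add: Re_power2)
  then show ?thesis
    unfolding cheb_kernel_def norm_mult norm_divide norm_power norm_exp_eq_Re power_add by simp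
qed

lemma cheb_kernel_holomorphic: "cheb_kernel lam n holomorphic_on {z. Re z > -1}"
proof -
  have "1 + z \<noteq> 0" if "Re z > -1" for z
    using that by (auto simp: complex_eq_iff)
  then show ?thesis unfolding cheb_kernel_def[abs_def]
    by (intro holomorphic_intros) auto
qed

lemma continuous_on_cheb_kernel [continuous_intros]:
  assumes "continuous_on A g" "\<And>y. y \<in> A \<Longrightarrow> Re (g y) > -1"
  shows "continuous_on A (\<lambda>y. cheb_kernel lam n (g y))"
  by (rule continuous_on_compose2[OF holomorphic_on_imp_continuous_on[OF cheb_kernel_holomorphic] assms(1)])
     (use assms(2) in auto)

text \<open>On the convex set \<open>Re z > -1\<close> the kernel has a primitive
\<open>\<Phi>\<close>. The two vertical integrals differ by the increments of \<open>\<Phi>\<close>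
along two horizontal segments: the lower one lies on the real axis, where the kernel is real and
does not contribute, and the upper one is small because the kernel decays like a Gaussian in the
imaginary direction.\<close>

lemma cheb_kernel_shift:
  assumes x: "x \<ge> 0" and lam: "lam > 0" and T: "T \<ge> 0"
  shows "\<bar>integral {0..T} (\<lambda>t. Re (cheb_kernel lam n (Complex x t))) -
          integral {0..T} (\<lambda>t. Re (cheb_kernel lam n (Complex 0 t)))\<bar> \<le> x * exp (lam * (x\<^sup>2 - T\<^sup>2))"
proof -
  let ?S = "{z. Re z > -1}" and ?f = "cheb_kernel lam n"
  have S: "open ?S" "convex ?S" by (auto simp: open_halfspace_Re_gt convex_halfspace_Re_gt)
  obtain \<Phi> where \<Phi>: "\<And>z. z \<in> ?S \<Longrightarrow> (\<Phi> has_field_derivative ?f z) (at z)"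
    using holomorphic_convex_primitive'[OF S(2,1) cheb_kernel_holomorphic] S(1)
    by (metis at_within_open)
  have vert: "((\<lambda>t. Re (?f (Complex u t))) has_integral Im (\<Phi> (Complex u T)) - Im (\<Phi> (Complex u 0))) {0..T}"
    if u: "u \<ge> 0" for u
  proof -
    have "((\<lambda>t. \<i> * ?f (Complex u t)) has_integral \<Phi> (Complex u T) - \<Phi> (Complex u 0)) {0..T}"
    proof (rule fundamental_theorem_of_calculus[OF T])
      fix t
      have "((\<lambda>t. Complex u t) has_vector_derivative \<i>) (at t within {0..T})"
        by (auto intro!: derivative_eq_intros simp: Complex_eq has_vector_derivative_def scaleR_conv_of_real)
      from field_vector_diff_chain_within[OF this, of \<Phi> "?f (Complex u t)"]
      show "((\<lambda>t. \<Phi> (Complex u t)) has_vector_derivative \<i> * ?f (Complex u t)) (at t within {0..T})"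
        using \<Phi>[of "Complex u t"] u by (auto simp: o_def intro: has_field_derivative_at_within)
    qed
    from has_integral_linear[OF this bounded_linear_Im] show ?thesis by (simp add: o_def)
  qed
  have horiz: "((\<lambda>u. ?f (Complex u t)) has_integral \<Phi> (Complex x t) - \<Phi> (Complex 0 t)) {0..x}" for t
  proof (rule fundamental_theorem_of_calculus[OF x])
    fix u assume u: "u \<in> {0..x}"
    have "((\<lambda>u. Complex u t) has_vector_derivative 1) (at u within {0..x})"
      by (auto intro!: derivative_eq_intros simp: Complex_eq has_vector_derivative_def scaleR_conv_of_real)
    from field_vector_diff_chain_within[OF this, of \<Phi> "?f (Complex u t)"]
    show "((\<lambda>u. \<Phi> (Complex u t)) has_vector_derivative ?f (Complex u t)) (at u within {0..x})"
      using \<Phi>[of "Complex u t"] u by (auto simp: o_def intro: has_field_derivative_at_within)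
  qed
  have "norm (\<Phi> (Complex x T) - \<Phi> (Complex 0 T)) \<le> exp (lam * (x\<^sup>2 - T\<^sup>2)) * measure lborel (cbox 0 x)"
  proof (rule has_integral_bound[OF _ horiz[of T, unfolded box_real[symmetric]]])
    fix u assume "u \<in> cbox 0 x"
    then have u: "0 \<le> u" "u \<le> x" by auto
    have "norm (?f (Complex u T)) \<le> exp (lam * (u\<^sup>2 - T\<^sup>2))"
      using norm_cheb_kernel_le[of "Complex u T" lam n] u by simp
    also have "\<dots> \<le> exp (lam * (x\<^sup>2 - T\<^sup>2))" using u lam by (simp add: power_mono)
    finally show "norm (?f (Complex u T)) \<le> exp (lam * (x\<^sup>2 - T\<^sup>2))" .
  qed simp
  then have 1: "\<bar>Im (\<Phi> (Complex x T) - \<Phi> (Complex 0 T))\<bar> \<le> x * exp (lam * (x\<^sup>2 - T\<^sup>2))"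
    using abs_Im_le_cmod[of "\<Phi> (Complex x T) - \<Phi> (Complex 0 T)"] x by (simp add: mult.commute)
  have "Im (?f (Complex u 0)) = 0" for u
  proof -
    have "?f (Complex u 0) = of_real (exp (lam * u\<^sup>2) * (1 - u) ^ n / (1 + u) ^ (n + 2))"
      unfolding cheb_kernel_def by (simp add: Complex_eq exp_of_real[symmetric])
    then show ?thesis by (metis Im_complex_of_real)
  qed
  then have "((\<lambda>u. 0) has_integral Im (\<Phi> (Complex x 0) - \<Phi> (Complex 0 0))) {0..x}"
    using has_integral_linear[OF horiz[of 0] bounded_linear_Im] by (simp add: o_def)
  then have 2: "Im (\<Phi> (Complex x 0)) = Im (\<Phi> (Complex 0 0))" by (simp add: has_integral_0_eq)
  show ?thesis
    using 1 2 vert[OF x] vert[of 0] by (simp add: integral_unique)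
qed

lemma cheb_kernel_line_integrable:
  assumes x: "x \<ge> 0" and lam: "lam > 0"
  shows "set_integrable lborel {0..} (\<lambda>y. cheb_kernel lam n (Complex x y))"
  unfolding set_integrable_def
proof (rule Bochner_Integration.integrable_bound)
  show "integrable lborel (\<lambda>y. exp (lam * x\<^sup>2) * exp (- lam * y\<^sup>2))"
    using gaussian_integral(1)[OF lam] by (auto simp: has_bochner_integral_iff)
  show "(\<lambda>y. indicator {0..} y *\<^sub>R cheb_kernel lam n (Complex x y)) \<in> borel_measurable lborel"
    using x by (auto intro!: borel_measurable_continuous_on_indicator continuous_intros simp: Complex_eq)
  show "AE y in lborel. norm (indicator {0..} y *\<^sub>R cheb_kernel lam n (Complex x y)) \<le> norm (exp (lam * x\<^sup>2) * exp (- lam * y\<^sup>2))"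
  proof (rule AE_I2)
    fix y :: real
    have "norm (cheb_kernel lam n (Complex x y)) \<le> exp (lam * x\<^sup>2) * exp (- lam * y\<^sup>2)"
      using norm_cheb_kernel_le[of "Complex x y" lam n] x
      by (simp add: exp_add[symmetric] algebra_simps)
    then show "norm (indicator {0..} y *\<^sub>R cheb_kernel lam n (Complex x y)) \<le> norm (exp (lam * x\<^sup>2) * exp (- lam * y\<^sup>2))"
      by (auto simp: indicator_def)
  qed
qed

text \<open>The substitution \<open>\<theta> = 2 arctan t\<close> gives the integral over the upper
half of the imaginary axis, and the line can then be moved to any \<open>x \<ge> 0\<close>. Symmetry
of the kernel under conjugation is the reason why half a line and a real part suffice.\<close>

lemma cheb_coeff_line_integral:
  assumes x: "x \<ge> 0" and lam: "lam > 0"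
  shows "cheb_coeff (F lam) (Suc n) = 4 / pi * (LINT y:{0..}|lborel. Re (cheb_kernel lam n (Complex x y)))"
proof -
  let ?g = "\<lambda>\<theta>. F lam (cos \<theta>) * cos (real (Suc n) * \<theta>)"
  have cg: "continuous_on {0..pi} ?g"
    using lam by (intro continuous_intros continuous_on_compose2[OF continuous_on_F]) auto
  have a: "cheb_coeff (F lam) (Suc n) = 2 / pi * integral {0..pi} ?g"
    by (rule cheb_coeff_eq_cosine_integral[OF continuous_on_F[OF lam]])
  have lim1: "((\<lambda>T. integral {0..2 * arctan T} ?g) \<longlongrightarrow> integral {0..pi} ?g) at_top"
  proof -
    have c: "continuous_on {0..pi} (\<lambda>u. integral {0..u} ?g)"
      by (rule indefinite_integral_continuous_1[OF integrable_continuous_real[OF cg]])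
    show ?thesis
    proof (rule continuous_on_tendsto_compose[OF c])
      have "((\<lambda>T. 2 * arctan T) \<longlongrightarrow> 2 * (pi / 2)) at_top"
        by (intro tendsto_intros tendsto_arctan_at_top)
      then show "((\<lambda>T. 2 * arctan T) \<longlongrightarrow> pi) at_top" by simp
      show "\<forall>\<^sub>F T in at_top. 2 * arctan T \<in> {0..pi}"
        using eventually_ge_at_top[of 0]
      proof eventually_elim
        case (elim T)
        then show ?case using arctan_ubound[of T] by (simp add: zero_le_arctan_iff)
      qed
    qed simp
  qed
  have int: "set_integrable lborel {0..} (\<lambda>y. Re (cheb_kernel lam n (Complex x y)))"
    using integrable_Re[OF cheb_kernel_line_integrable[OF assms, of n, unfolded set_integrable_def]]
    by (simp add: set_integrable_def)
  have lim2: "((\<lambda>T. integral {0..T} (\<lambda>t. Re (cheb_kernel lam n (Complex x t)))) \<longlongrightarrow>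
      (LINT y:{0..}|lborel. Re (cheb_kernel lam n (Complex x y)))) at_top"
  proof (rule Lim_transform_eventually)
    show "((\<lambda>T. LINT y:{0..T}|lborel. Re (cheb_kernel lam n (Complex x y))) \<longlongrightarrow>
      (LINT y:{0..}|lborel. Re (cheb_kernel lam n (Complex x y)))) at_top"
      by (rule tendsto_set_lebesgue_integral_at_top[OF _ int]) simp
    show "\<forall>\<^sub>F T in at_top. (LINT y:{0..T}|lborel. Re (cheb_kernel lam n (Complex x y))) =
       integral {0..T} (\<lambda>t. Re (cheb_kernel lam n (Complex x t)))"
      using x by (intro always_eventually allI set_borel_integral_eq_integral(2) borel_integrable_atLeastAtMost')
         (auto intro!: continuous_intros simp: Complex_eq)
  qed
  have lim3: "((\<lambda>T. x * exp (lam * (x\<^sup>2 - T\<^sup>2))) \<longlongrightarrow> 0) at_top"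
    using lam by real_asymp
  have lim4: "((\<lambda>T. integral {0..T} (\<lambda>t. Re (cheb_kernel lam n (Complex x t))) -
          integral {0..T} (\<lambda>t. Re (cheb_kernel lam n (Complex 0 t)))) \<longlongrightarrow> 0) at_top"
    by (rule Lim_null_comparison[OF eventually_mono[OF eventually_ge_at_top[of 0]] lim3])
       (use cheb_kernel_shift[OF assms] in simp)
  have "((\<lambda>T. 2 * integral {0..T} (\<lambda>t. Re (cheb_kernel lam n (Complex 0 t)))) \<longlongrightarrow> integral {0..pi} ?g) at_top"
  proof (rule Lim_transform_eventually[OF lim1 eventually_mono[OF eventually_ge_at_top[of 0]]])
    fix T :: real assume "0 \<le> T"
    have "2 * integral {0..T} (\<lambda>t. Re (cheb_kernel lam n (Complex 0 t))) = integral {0..T} (\<lambda>t. 2 * Re (cheb_kernel lam n (\<i> * of_real t)))"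
      by (simp add: Complex_eq)
    also have "\<dots> = integral {0..2 * arctan T} ?g"
      by (rule integral_unique[OF integral_F_cos_substitution[OF lam \<open>0 \<le> T\<close>]])
    finally show "integral {0..2 * arctan T} ?g = 2 * integral {0..T} (\<lambda>t. Re (cheb_kernel lam n (Complex 0 t)))" ..
  qed
  moreover have "((\<lambda>T. 2 * integral {0..T} (\<lambda>t. Re (cheb_kernel lam n (Complex 0 t)))) \<longlongrightarrow>
     2 * (LINT y:{0..}|lborel. Re (cheb_kernel lam n (Complex x y)))) at_top"
    using tendsto_mult_left[OF tendsto_diff[OF lim2 lim4], of 2] by simp
  ultimately have "integral {0..pi} ?g = 2 * (LINT y:{0..}|lborel. Re (cheb_kernel lam n (Complex x y)))"
    by (rule tendsto_unique[rotated]) simp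
  then show ?thesis by (simp add: a)
qed

section \<open>The vertical line through the saddle and the upper bounds\<close>

lemma has_bochner_integral_shift:
  fixes f :: "real \<Rightarrow> 'a::{banach,second_countable_topology}"
  assumes "has_bochner_integral lborel f I"
  shows "has_bochner_integral lborel (\<lambda>y. f (y - a)) I"
  using lborel_has_bochner_integral_real_affine_iff[of 1 f I "-a"] assms by simp

lemma half_line_integral_gaussian_bound:
  fixes f :: "real \<Rightarrow> 'a::{banach,second_countable_topology}"
  assumes "\<gamma> > 0" and f: "set_integrable lborel {0..} f" and K: "K \<ge> 0"
    and le: "\<And>y. y \<ge> 0 \<Longrightarrow> norm (f y) \<le> K * exp (- \<gamma> * (y - a)\<^sup>2)"
  shows "norm (LINT y:{0..}|lborel. f y) \<le> K * sqrt (pi / \<gamma>)"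
proof -
  have g: "has_bochner_integral lborel (\<lambda>y. K * exp (- \<gamma> * (y - a)\<^sup>2)) (K * sqrt (pi / \<gamma>))"
    by (intro has_bochner_integral_mult_right has_bochner_integral_shift[where f="\<lambda>u. exp (- \<gamma> * u\<^sup>2)"]
          gaussian_integral assms)
  have "norm (integral\<^sup>L lborel (\<lambda>y. indicator {0..} y *\<^sub>R f y)) \<le> integral\<^sup>L lborel (\<lambda>y. K * exp (- \<gamma> * (y - a)\<^sup>2))"
    by (rule Bochner_Integration.integral_norm_bound_integral)
       (use f g le K in \<open>auto simp: set_integrable_def has_bochner_integral_iff indicator_def\<close>)
  also have "\<dots> = K * sqrt (pi / \<gamma>)" using g by (rule has_bochner_integral_integral_eq)
  finally show ?thesis by (simp add: set_lebesgue_integral_def)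
qed

text \<open>The real part \<open>x\<close> of the saddle is used as the parameter instead of
\<open>\<alpha>\<close>. The cubic has the conjugate roots \<open>x \<plusminus> i y0\<close> and
the real root \<open>- 2 x\<close>, and comparing coefficients makes \<open>\<alpha>\<close>,
\<open>y0\<close> and the decay rate explicit in \<open>x\<close>. The limit \<open>\<alpha>
\<rightarrow> 0\<close> is \<open>x \<rightarrow> \<infinity>\<close>, and \<open>\<alpha> =
alpha_c\<close> is \<open>3 x\<^sup>2 = 1\<close>. The constant \<open>c\<close> measures the
distance from this degenerate case, where the two conjugate saddles merge; the constants in all
estimates below depend on \<open>c\<close> alone.\<close>

locale saddle =
  fixes c x :: real and m :: nat
  assumes c: "0 < c" "c \<le> 1" and x_pos: "0 < x" and cx: "c * (x + 1)\<^sup>2 \<le> 3 * x\<^sup>2 - 1" and m: "m \<ge> 1"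
begin

definition "alpha = 1 / (2 * x * (4 * x\<^sup>2 - 1))"
definition "lam = alpha * real m"
definition "y0 = sqrt (3 * x\<^sup>2 - 1)"
definition "H = sqrt ((2 * x - 1) / (2 * x + 1)) * exp (alpha * (1 - 2 * x\<^sup>2))"

lemma x_sq: "3 * x\<^sup>2 > 1"
proof -
  have "0 < c * (x + 1)\<^sup>2" using c x_pos by simp
  with cx show ?thesis by linarith
qed

lemma x_gt_half: "x > 1 / 2"
proof (rule ccontr)
  assume "\<not> ?thesis"
  then have "x\<^sup>2 \<le> (1/2)\<^sup>2" using x_pos by (intro power_mono) auto
  with x_sq show False by (simp add: power2_eq_square)
qed

lemma four_sq: "4 * x\<^sup>2 - 1 \<ge> x\<^sup>2" "4 * x\<^sup>2 - 1 > 0"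
  using x_sq by (simp_all add: power2_eq_square) 

lemma alpha_pos: "alpha > 0"
  using four_sq x_pos by (simp add: alpha_def)

lemma lam_pos: "lam > 0"
  using alpha_pos m by (simp add: lam_def)

lemma y0_sq: "y0\<^sup>2 = 3 * x\<^sup>2 - 1" and y0_pos: "y0 > 0"
  using x_sq by (simp_all add: y0_def)

text \<open>\<open>x\<close> is comparable to \<open>\<alpha> powr (-1/3)\<close>,
uniformly.\<close>

lemma alpha_cube: "alpha * x ^ 3 \<ge> 1 / 8" "alpha * x ^ 3 \<le> 1 / 2"
proof -
  have e: "alpha * x ^ 3 = x\<^sup>2 / (2 * (4 * x\<^sup>2 - 1))"
    using x_pos four_sq by (simp add: alpha_def power3_eq_cube power2_eq_square)
  show "alpha * x ^ 3 \<ge> 1 / 8" "alpha * x ^ 3 \<le> 1 / 2"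
    unfolding e using four_sq by (simp_all add: field_simps)
qed

lemma H_pos: "H > 0"
  using x_gt_half by (simp add: H_def)

lemma norm_Complex_one: "norm (1 + Complex x y) = sqrt ((x + 1)\<^sup>2 + y\<^sup>2)"
  "norm (1 - Complex x y) = sqrt ((x - 1)\<^sup>2 + y\<^sup>2)"
  by (simp_all add: cmod_def add.commute power2_commute)

lemma norm_Complex_one_sq: "(norm (1 + Complex x y))\<^sup>2 = (x + 1)\<^sup>2 + y\<^sup>2"
  "(norm (1 - Complex x y))\<^sup>2 = (x - 1)\<^sup>2 + y\<^sup>2"
  by (simp_all add: norm_Complex_one)

text \<open>This is the heart of the upper bounds. With \<open>u = y\<^sup>2\<close> the quotient
\<open>X\<close> of \<open>((x - 1)\<^sup>2 + u) / ((x + 1)\<^sup>2 + u)\<close> by its value at the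
saddle satisfies \<open>X \<le> exp (X - 1)\<close>. The saddle equation makes the linear term of
\<open>(X - 1) / 2\<close> cancel against the exponential factor, and what is left is exactly
\<open>- \<alpha> (u - u0)\<^sup>2 / ((x + 1)\<^sup>2 + u)\<close>, that is, a Gaussian in \<open>y
- y0\<close> valid on the whole half line.\<close>

lemma phase_bound:
  assumes y: "y \<ge> 0"
  shows "sqrt (((x - 1)\<^sup>2 + y\<^sup>2) / ((x + 1)\<^sup>2 + y\<^sup>2)) * exp (alpha * (x\<^sup>2 - y\<^sup>2))
         \<le> H * exp (- c * alpha * (y - y0)\<^sup>2)"
proof -
  define u where "u = y\<^sup>2"
  define B where "B = (x + 1)\<^sup>2"
  define u0 where "u0 = 3 * x\<^sup>2 - 1"
  have B: "B > 0" using x_pos by (simp add: B_def)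
  have u: "u \<ge> 0" by (simp add: u_def)
  have u0: "u0 > 0" using x_sq by (simp add: u0_def)
  have A0: "(x - 1)\<^sup>2 + u0 = 2 * x * (2 * x - 1)" and B0: "B + u0 = 2 * x * (2 * x + 1)"
    by (simp_all add: B_def u0_def power2_eq_square algebra_simps)
  define X where "X = ((x - 1)\<^sup>2 + u) * (B + u0) / ((B + u) * ((x - 1)\<^sup>2 + u0))"
  have pos: "B + u > 0" "(x - 1)\<^sup>2 + u0 > 0" "B + u0 > 0"
    using B u u0 zero_le_power2[of "x - 1"] by linarith+
  have q: "((x - 1)\<^sup>2 + u) / (B + u) = X * ((2 * x - 1) / (2 * x + 1))"
  proof -
    have "(2 * x - 1) / (2 * x + 1) = ((x - 1)\<^sup>2 + u0) / (B + u0)"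
      unfolding A0 B0 using x_pos by simp
    then show ?thesis unfolding X_def using pos by simp
  qed
  have X1: "X - 1 = 4 * x * (u - u0) / ((B + u) * ((x - 1)\<^sup>2 + u0))"
  proof -
    have "((x - 1)\<^sup>2 + u) * (B + u0) - (B + u) * ((x - 1)\<^sup>2 + u0) = 4 * x * (u - u0)"
      by (simp add: B_def power2_eq_square algebra_simps)
    moreover have "X - 1 = (((x - 1)\<^sup>2 + u) * (B + u0) - (B + u) * ((x - 1)\<^sup>2 + u0)) / ((B + u) * ((x - 1)\<^sup>2 + u0))"
      using pos by (subst diff_divide_distrib, subst divide_self) (auto simp: X_def)
    ultimately show ?thesis by simp
  qed
  have alpha_eq: "alpha = 2 * x / (((x - 1)\<^sup>2 + u0) * (B + u0))"
  proof -
    have "((x - 1)\<^sup>2 + u0) * (B + u0) = 4 * x\<^sup>2 * (4 * x\<^sup>2 - 1)"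
      unfolding A0 B0 by (simp add: power2_eq_square algebra_simps)
    then show ?thesis using x_pos four_sq by (simp add: alpha_def power2_eq_square)
  qed
  have exponent: "(X - 1) / 2 - alpha * (u - u0) = - alpha * ((u - u0)\<^sup>2 / (B + u))"
    unfolding X1 alpha_eq using pos by (simp add: divide_simps) (simp add: power2_eq_square algebra_simps)
  have "c * (y - y0)\<^sup>2 \<le> (u - u0)\<^sup>2 / (B + u)"
  proof -
    have "c * (B + u) \<le> u0 + u"
      using cx c u mult_right_mono[of c 1 u] by (simp add: B_def u0_def algebra_simps)
    also have "\<dots> \<le> (y + y0)\<^sup>2"
      using y y0_pos by (simp add: u_def u0_def flip: y0_sq) (simp add: power2_sum)
    finally have "c * (B + u) * (y - y0)\<^sup>2 \<le> (y + y0)\<^sup>2 * (y - y0)\<^sup>2"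
      by (rule mult_right_mono) simp
    also have "\<dots> = (u - u0)\<^sup>2"
      unfolding u_def u0_def y0_sq[symmetric] by (simp add: power2_eq_square algebra_simps)
    finally show ?thesis using pos by (simp add: field_simps)
  qed
  then have ce: "- alpha * ((u - u0)\<^sup>2 / (B + u)) \<le> - c * alpha * (y - y0)\<^sup>2"
    using alpha_pos mult_left_mono[of "c * (y - y0)\<^sup>2" "(u - u0)\<^sup>2 / (B + u)" alpha] by (simp add: mult_ac)
  have X: "sqrt X \<le> exp ((X - 1) / 2)"
  proof (rule real_le_lsqrt)
    show "X \<le> (exp ((X - 1) / 2))\<^sup>2"
      using exp_ge_add_one_self[of "X - 1"] by (simp add: exp_double[symmetric] power2_eq_square exp_add[symmetric])
  qed simp
  have "sqrt (((x - 1)\<^sup>2 + u) / (B + u)) * exp (alpha * (x\<^sup>2 - u))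
     = sqrt X * (sqrt ((2 * x - 1) / (2 * x + 1)) * exp (alpha * (x\<^sup>2 - u)))"
    unfolding q real_sqrt_mult[of X] by simp
  also have "\<dots> \<le> exp ((X - 1) / 2) * (sqrt ((2 * x - 1) / (2 * x + 1)) * exp (alpha * (x\<^sup>2 - u)))"
    using x_gt_half by (intro mult_right_mono X) auto
  also have "\<dots> = sqrt ((2 * x - 1) / (2 * x + 1)) * exp ((X - 1) / 2 + alpha * (x\<^sup>2 - u))"
    by (simp add: exp_add)
  also have "(X - 1) / 2 + alpha * (x\<^sup>2 - u) = alpha * (1 - 2 * x\<^sup>2) + ((X - 1) / 2 - alpha * (u - u0))"
    by (simp add: u0_def algebra_simps)
  also have "sqrt ((2 * x - 1) / (2 * x + 1)) * exp \<dots> \<le>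
    sqrt ((2 * x - 1) / (2 * x + 1)) * exp (alpha * (1 - 2 * x\<^sup>2) + - c * alpha * (y - y0)\<^sup>2)"
    unfolding exponent using x_gt_half ce by (intro mult_left_mono) auto
  also have "\<dots> = H * exp (- c * alpha * (y - y0)\<^sup>2)" by (simp only: H_def exp_add mult.assoc)
  finally show ?thesis by (simp add: u_def B_def)
qed

abbreviation "ker j y \<equiv> cheb_kernel lam (m + j) (Complex x y)"

text \<open>On the imaginary axis this is \<open>exp (- i \<theta>)\<close>; the index of a
coefficient enters the kernel only through a power of it.\<close>

abbreviation "w y \<equiv> (1 - Complex x y) / (1 + Complex x y)"

lemma norm_one_plus_ge: "norm (1 + Complex x y) \<ge> x" "norm (1 + Complex x y) > 0" "1 + Complex x y \<noteq> 0"
proof -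
  show "norm (1 + Complex x y) \<ge> x" using complex_Re_le_cmod[of "1 + Complex x y"] by simp
  with x_pos show "norm (1 + Complex x y) > 0" by linarith
  then show "1 + Complex x y \<noteq> 0" by auto
qed

lemma kernel_factor: "ker j y = exp (of_real lam * (Complex x y)\<^sup>2) * w y ^ m * (w y ^ j / (1 + Complex x y)\<^sup>2)"
  using norm_one_plus_ge(3) by (simp add: cheb_kernel_def power_add power_divide power2_eq_square mult_ac)

lemma norm_phase_le:
  assumes y: "y \<ge> 0"
  shows "norm (exp (of_real lam * (Complex x y)\<^sup>2) * w y ^ m) \<le> H ^ m * exp (- c * lam * (y - y0)\<^sup>2)"
proof -
  have "norm (exp (of_real lam * (Complex x y)\<^sup>2) * w y ^ m)
    = (norm (w y) * exp (alpha * (x\<^sup>2 - y\<^sup>2))) ^ m"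
    by (simp add: norm_mult norm_power Re_power2 power_mult_distrib lam_def exp_of_nat_mult[symmetric] algebra_simps)
  also have "norm (w y) = sqrt (((x - 1)\<^sup>2 + y\<^sup>2) / ((x + 1)\<^sup>2 + y\<^sup>2))"
    by (simp add: norm_divide norm_Complex_one real_sqrt_divide)
  also have "(\<dots> * exp (alpha * (x\<^sup>2 - y\<^sup>2))) ^ m \<le> (H * exp (- c * alpha * (y - y0)\<^sup>2)) ^ m"
    by (intro power_mono phase_bound y) auto
  also have "\<dots> = H ^ m * exp (- c * lam * (y - y0)\<^sup>2)"
    by (simp add: power_mult_distrib lam_def exp_of_nat_mult[symmetric] algebra_simps)
  finally show ?thesis .
qed

lemma norm_w: "(norm (w y))\<^sup>2 = 1 - 4 * x / (norm (1 + Complex x y))\<^sup>2" "norm (w y) < 1"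
proof -
  have "(norm (1 - Complex x y))\<^sup>2 = (norm (1 + Complex x y))\<^sup>2 - 4 * x"
    unfolding norm_Complex_one_sq by (simp add: power2_eq_square algebra_simps)
  moreover have "(norm (w y))\<^sup>2 = (norm (1 - Complex x y))\<^sup>2 / (norm (1 + Complex x y))\<^sup>2"
    by (simp add: norm_divide power_divide)
  ultimately show 1: "(norm (w y))\<^sup>2 = 1 - 4 * x / (norm (1 + Complex x y))\<^sup>2"
    using norm_one_plus_ge(2)[of y] by (simp add: diff_divide_distrib)
  have "4 * x / (norm (1 + Complex x y))\<^sup>2 > 0" using norm_one_plus_ge(2)[of y] x_pos by simp
  with 1 have "(norm (w y))\<^sup>2 < 1" by linarith
  then show "norm (w y) < 1" by (simp add: abs_square_less_1)
qed

definition "coef j = cheb_coeff (F lam) (Suc (m + j))"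

lemma coef_eq: "coef j = 4 / pi * (LINT y:{0..}|lborel. Re (ker j y))"
  unfolding coef_def by (rule cheb_coeff_line_integral) (use x_pos lam_pos in auto)

lemma ker_integrable: "set_integrable lborel {0..} (\<lambda>y. ker j y)"
  by (rule cheb_kernel_line_integrable) (use x_pos lam_pos in auto)

lemma Re_ker_integrable: "set_integrable lborel {0..} (\<lambda>y. Re (ker j y))"
  using integrable_Re[OF ker_integrable[of j, unfolded set_integrable_def]]
  by (simp add: set_integrable_def)

lemma norm_ker_le:
  assumes "y \<ge> 0"
  shows "norm (ker j y) \<le> H ^ m * exp (- c * lam * (y - y0)\<^sup>2) * (norm (w y) ^ j / (norm (1 + Complex x y))\<^sup>2)"
proof -
  have "norm (w y ^ j / (1 + Complex x y)\<^sup>2) = norm (w y) ^ j / (norm (1 + Complex x y))\<^sup>2"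
    by (simp add: norm_divide norm_power)
  then show ?thesis
    unfolding kernel_factor using mult_right_mono[OF norm_phase_le[OF assms]]
    by (subst norm_mult) (metis norm_ge_zero)
qed

lemma cl_pos: "c * lam > 0" using c lam_pos by simp

lemma abs_coef_le: "\<bar>coef j\<bar> \<le> 4 / pi * (H ^ m / x\<^sup>2 * sqrt (pi / (c * lam)))"
proof -
  have "norm (LINT y:{0..}|lborel. Re (ker j y)) \<le> H ^ m / x\<^sup>2 * sqrt (pi / (c * lam))"
  proof (rule half_line_integral_gaussian_bound[OF cl_pos Re_ker_integrable, where a=y0])
    fix y :: real assume y: "y \<ge> 0"
    have "norm (w y) ^ j / (norm (1 + Complex x y))\<^sup>2 \<le> 1 / x\<^sup>2"
      using norm_w(2)[of y] norm_one_plus_ge[of y] x_pos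
      by (intro frac_le power_le_one power_mono) auto
    then have "H ^ m * exp (- c * lam * (y - y0)\<^sup>2) * (norm (w y) ^ j / (norm (1 + Complex x y))\<^sup>2)
       \<le> H ^ m * exp (- c * lam * (y - y0)\<^sup>2) * (1 / x\<^sup>2)"
      using H_pos by (intro mult_left_mono) auto
    with norm_ker_le[OF y, of j] abs_Re_le_cmod[of "ker j y"]
    show "norm (Re (ker j y)) \<le> H ^ m / x\<^sup>2 * exp (- (c * lam) * (y - y0)\<^sup>2)" by simp
  qed (use H_pos in simp)
  then have "4 / pi * \<bar>LINT y:{0..}|lborel. Re (ker j y)\<bar> \<le> 4 / pi * (H ^ m / x\<^sup>2 * sqrt (pi / (c * lam)))"
    by (intro mult_left_mono) auto
  then show ?thesis unfolding coef_eq by (simp add: abs_mult)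
qed

text \<open>Summing the kernels under the integral gives a geometric series. Its sum is at most
\<open>1 / (1 - \<bar>w\<bar>)\<close>, and \<open>1 - \<bar>w\<bar> \<ge> 2 x / \<bar>1 +
z\<bar>\<^sup>2\<close> compensates precisely the factor \<open>1 / \<bar>1 +
z\<bar>\<^sup>2\<close> of the kernel.\<close>

lemma sum_abs_coef_le: "(\<Sum>j<n. \<bar>coef j\<bar>) \<le> 4 / pi * (H ^ m / (2 * x) * sqrt (pi / (c * lam)))"
proof -
  let ?f = "\<lambda>j y. \<bar>Re (ker j y)\<bar>"
  have int: "set_integrable lborel {0..} (?f j)" for j
    by (rule set_integrable_abs[OF Re_ker_integrable])
  have "\<bar>LINT y:{0..}|lborel. Re (ker j y)\<bar> \<le> (LINT y:{0..}|lborel. ?f j y)" for j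
    using integral_norm_bound[of lborel "\<lambda>y. indicator {0..} y *\<^sub>R Re (ker j y)"]
    by (simp add: set_lebesgue_integral_def abs_mult)
  then have "(\<Sum>j<n. \<bar>coef j\<bar>) \<le> (\<Sum>j<n. 4 / pi * (LINT y:{0..}|lborel. ?f j y))"
    unfolding coef_eq by (intro sum_mono) (simp add: abs_mult divide_right_mono)
  also have "\<dots> = 4 / pi * (LINT y:{0..}|lborel. (\<Sum>j<n. ?f j y))"
  proof -
    have "(LINT y:{0..}|lborel. (\<Sum>j<n. ?f j y)) = (\<Sum>j<n. LINT y:{0..}|lborel. ?f j y)"
      unfolding set_lebesgue_integral_def scaleR_sum_right
      by (rule Bochner_Integration.integral_sum) (use int in \<open>simp add: set_integrable_def\<close>)
    then show ?thesis by (simp add: sum_distrib_left)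
  qed
  also have "(LINT y:{0..}|lborel. (\<Sum>j<n. ?f j y)) \<le> norm (LINT y:{0..}|lborel. (\<Sum>j<n. ?f j y))"
    by simp
  also have "norm (LINT y:{0..}|lborel. (\<Sum>j<n. ?f j y)) \<le> H ^ m / (2 * x) * sqrt (pi / (c * lam))"
  proof (rule half_line_integral_gaussian_bound[OF cl_pos, where a=y0])
    show "set_integrable lborel {0..} (\<lambda>y. \<Sum>j<n. ?f j y)"
      unfolding set_integrable_def scaleR_sum_right
      by (rule Bochner_Integration.integrable_sum) (use int in \<open>simp add: set_integrable_def\<close>)
    fix y :: real assume y: "y \<ge> 0"
    define \<rho> where "\<rho> = norm (w y)"
    define N where "N = (norm (1 + Complex x y))\<^sup>2"
    have \<rho>: "0 \<le> \<rho>" "\<rho> < 1" using norm_w(2) by (auto simp: \<rho>_def)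
    have N: "N > 0" using norm_one_plus_ge(2)[of y] by (simp add: N_def)
    have "4 * x / N = (1 - \<rho>) * (1 + \<rho>)"
      using norm_w(1)[of y] by (simp add: \<rho>_def N_def power2_eq_square algebra_simps)
    also have "\<dots> \<le> (1 - \<rho>) * 2" using \<rho> by (intro mult_left_mono) auto
    finally have "2 * x / N \<le> 1 - \<rho>" by simp
    then have frac: "1 / (1 - \<rho>) / N \<le> 1 / (2 * x)"
      using \<rho> N x_pos by (simp add: field_simps)
    have "(\<Sum>j<n. \<rho> ^ j) \<le> 1 / (1 - \<rho>)"
      using \<rho> by (simp add: sum_gp_strict divide_right_mono)
    then have "(\<Sum>j<n. \<rho> ^ j) / N \<le> 1 / (1 - \<rho>) / N"
      using N by (intro divide_right_mono) auto
    with frac have geo: "(\<Sum>j<n. \<rho> ^ j / N) \<le> 1 / (2 * x)" by (simp add: sum_divide_distrib)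
    have "(\<Sum>j<n. ?f j y) \<le> (\<Sum>j<n. H ^ m * exp (- c * lam * (y - y0)\<^sup>2) * (\<rho> ^ j / N))"
    proof (rule sum_mono)
      fix j
      show "?f j y \<le> H ^ m * exp (- c * lam * (y - y0)\<^sup>2) * (\<rho> ^ j / N)"
        using norm_ker_le[OF y, of j] abs_Re_le_cmod[of "ker j y"] unfolding \<rho>_def N_def by linarith
    qed
    also have "\<dots> = H ^ m * exp (- c * lam * (y - y0)\<^sup>2) * (\<Sum>j<n. \<rho> ^ j / N)"
      by (simp only: sum_distrib_left)
    also have "\<dots> \<le> H ^ m * exp (- c * lam * (y - y0)\<^sup>2) * (1 / (2 * x))"
      using H_pos by (intro mult_left_mono geo) auto
    finally have "(\<Sum>j<n. ?f j y) \<le> H ^ m * exp (- c * lam * (y - y0)\<^sup>2) * (1 / (2 * x))" .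
    then show "norm (\<Sum>j<n. ?f j y) \<le> H ^ m / (2 * x) * exp (- (c * lam) * (y - y0)\<^sup>2)"
      by (simp add: sum_nonneg)
  qed (use H_pos x_pos in simp)
  finally show ?thesis by (simp add: divide_right_mono)
qed

text \<open>With \<open>t = 1 / (2 x)\<close> the first factor of \<open>H\<close> has logarithm
\<open>- artanh t \<le> - t\<close>. Adding \<open>\<alpha> (1 - 2 x\<^sup>2)\<close> leaves
\<open>- (3 x\<^sup>2 - 1) / (x (4 x\<^sup>2 - 1))\<close>, which is negative away from the
degenerate case.\<close>

lemma ln_H_le: "ln H \<le> - c / (4 * x)"
proof -
  define t where "t = 1 / (2 * x)"
  have t: "0 < t" "t < 1" using x_gt_half by (auto simp: t_def field_simps)
  have "ln ((2 * x - 1) / (2 * x + 1)) = ln (1 - t) - ln (1 + t)"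
  proof -
    have "(2 * x - 1) / (2 * x + 1) = (1 - t) / (1 + t)"
      using x_gt_half by (simp add: t_def divide_simps)
    then show ?thesis using t by (simp add: ln_div)
  qed
  also have "\<dots> \<le> - 2 * t"
  proof -
    have "ln (1 + 0) - ln (1 - 0) - 2 * 0 \<le> ln (1 + t) - ln (1 - t) - 2 * t"
    proof (rule DERIV_nonneg_imp_nondecreasing[OF less_imp_le[OF t(1)]])
      fix s assume s: "0 \<le> s" "s \<le> t"
      have "1 / (1 + s) + 1 / (1 - s) - 2 = 2 * s\<^sup>2 / ((1 + s) * (1 - s))"
        using s t by (simp add: divide_simps) (simp add: power2_eq_square algebra_simps)
      also have "\<dots> \<ge> 0" using s t by (intro divide_nonneg_nonneg mult_nonneg_nonneg) auto
      finally show "\<exists>y. ((\<lambda>s. ln (1 + s) - ln (1 - s) - 2 * s) has_real_derivative y) (at s) \<and> 0 \<le> y"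
        using s t by (intro exI[of _ "1 / (1 + s) + 1 / (1 - s) - 2"]) (auto intro!: derivative_eq_intros)
    qed
    then show ?thesis by simp
  qed
  finally have l: "ln ((2 * x - 1) / (2 * x + 1)) \<le> - 1 / x" by (simp add: t_def)
  have "ln H = ln ((2 * x - 1) / (2 * x + 1)) / 2 + alpha * (1 - 2 * x\<^sup>2)"
    using x_gt_half by (simp add: H_def ln_mult ln_sqrt)
  also have "\<dots> \<le> - 1 / (2 * x) + alpha * (1 - 2 * x\<^sup>2)" using l by simp
  also have "\<dots> = - ((3 * x\<^sup>2 - 1) / (4 * x\<^sup>2 - 1) / x)"
    using x_pos four_sq by (simp add: alpha_def divide_simps)
  also have "\<dots> \<le> - c / (4 * x)"
  proof -
    have "c * (4 * x\<^sup>2 - 1) \<le> 4 * (c * (x + 1)\<^sup>2)"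
      using c x_pos by (simp add: power2_eq_square algebra_simps)
    also have "\<dots> \<le> 4 * (3 * x\<^sup>2 - 1)" using cx by simp
    finally have "c / 4 \<le> (3 * x\<^sup>2 - 1) / (4 * x\<^sup>2 - 1)"
      using four_sq by (simp add: field_simps)
    then have "c / 4 / x \<le> (3 * x\<^sup>2 - 1) / (4 * x\<^sup>2 - 1) / x"
      using x_pos by (intro divide_right_mono) auto
    then show ?thesis by simp
  qed
  finally show ?thesis .
qed

end

section \<open>Gaussian integrals with complex rate\<close>

lemma vector_derivative_increment_bound:
  fixes f :: "real \<Rightarrow> 'a::real_normed_vector"
  assumes "\<And>t. t \<in> closed_segment a b \<Longrightarrow> (f has_vector_derivative f' t) (at t)"
    and "\<And>t. t \<in> closed_segment a b \<Longrightarrow> norm (f' t) \<le> B"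
  shows "norm (f b - f a) \<le> B * \<bar>b - a\<bar>"
  unfolding real_norm_def[symmetric]
proof (rule differentiable_bound[of "closed_segment a b" f "\<lambda>t h. h *\<^sub>R f' t"])
  fix t assume t: "t \<in> closed_segment a b"
  show "(f has_derivative (\<lambda>h. h *\<^sub>R f' t)) (at t within closed_segment a b)"
    using assms(1)[OF t] unfolding has_vector_derivative_def by (rule has_derivative_at_withinI)
  show "onorm (\<lambda>h. h *\<^sub>R f' t) \<le> B"
    by (rule onorm_le) (use assms(2)[OF t] in \<open>simp add: mult.commute[of _ "norm _"] mult_right_mono\<close>)
qed (auto simp: convex_closed_segment)

text \<open>The substitution by a square root \<open>s\<close> of \<open>\<kappa>\<close> turns the
integral into one along a rotated ray. As \<open>Re \<kappa> > 0\<close>, the ray stays in the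
sector where \<open>exp (- z\<^sup>2)\<close> decays, so it can be rotated back to the real
axis.\<close>

lemma complex_gaussian_integral:
  fixes \<kappa> :: complex
  assumes \<kappa>: "Re \<kappa> > 0"
  obtains J where "has_bochner_integral lborel (\<lambda>u::real. exp (- \<kappa> * of_real (u\<^sup>2))) J"
    and "norm J = sqrt (pi / norm \<kappa>)"
proof -
  define s where "s = csqrt \<kappa>"
  have s2: "s\<^sup>2 = \<kappa>" by (simp add: s_def)
  have Re_s: "Re s \<ge> 0" using csqrt_principal[of \<kappa>] by (auto simp: s_def)
  have "s \<noteq> 0" using \<kappa> by (auto simp: s_def)
  have s_re: "(Re s)\<^sup>2 - (Im s)\<^sup>2 = Re \<kappa>" by (simp add: s2[symmetric] Re_power2)
  define \<delta> where "\<delta> = min 1 (Re \<kappa>) / 2"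
  have \<delta>: "\<delta> > 0" using \<kappa> by (simp add: \<delta>_def)
  let ?f = "\<lambda>z::complex. exp (- (z\<^sup>2))"
  obtain \<Phi> where \<Phi>: "\<And>z. (\<Phi> has_field_derivative ?f z) (at z)"
  proof -
    have "?f holomorphic_on UNIV" by (intro holomorphic_intros)
    then show thesis
      using holomorphic_convex_primitive'[of UNIV ?f] that by (metis UNIV_I convex_UNIV open_UNIV)
  qed
  have ray: "((\<lambda>u. a * ?f (a * of_real u)) has_integral \<Phi> (a * of_real R) - \<Phi> 0) {0..R}" if "R \<ge> 0" for a :: complex and R :: real
  proof -
    have "((\<lambda>u. a * ?f (a * of_real u)) has_integral \<Phi> (a * of_real R) - \<Phi> (a * of_real 0)) {0..R}"
    proof (rule fundamental_theorem_of_calculus[OF that])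
      fix u
      have "((\<lambda>u. a * of_real u) has_vector_derivative a) (at u within {0..R})"
        by (auto intro!: derivative_eq_intros simp: has_vector_derivative_def scaleR_conv_of_real mult.commute)
      from field_vector_diff_chain_within[OF this, of \<Phi> "?f (a * of_real u)"]
      show "((\<lambda>u. \<Phi> (a * of_real u)) has_vector_derivative a * ?f (a * of_real u)) (at u within {0..R})"
        using \<Phi>[of "a * of_real u"] by (auto simp: o_def intro: has_field_derivative_at_within)
    qed
    then show ?thesis by simp
  qed
  \<comment> \<open>The increment of the primitive between the endpoints of the two rays vanishes in the limit.\<close>
  have arc: "norm (\<Phi> (s * of_real R) - \<Phi> (of_real R)) \<le> norm (s - 1) * R * exp (- \<delta> * R\<^sup>2)" if R: "R \<ge> 0" for R
  proof -
    let ?g = "\<lambda>\<tau>. of_real R * (1 + of_real \<tau> * (s - 1))"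
    have "norm (\<Phi> (?g 1) - \<Phi> (?g 0)) \<le> (norm (s - 1) * R * exp (- \<delta> * R\<^sup>2)) * \<bar>1 - 0\<bar>"
    proof (rule vector_derivative_increment_bound)
      fix \<tau> :: real assume "\<tau> \<in> closed_segment 0 1"
      then have \<tau>: "0 \<le> \<tau>" "\<tau> \<le> 1" by (auto simp: closed_segment_eq_real_ivl)
      have "(?g has_vector_derivative of_real R * (s - 1)) (at \<tau>)"
        by (auto intro!: derivative_eq_intros simp: has_vector_derivative_def scaleR_conv_of_real mult_ac)
      from field_vector_diff_chain_at[OF this, of \<Phi> "?f (?g \<tau>)"] \<Phi>[of "?g \<tau>"]
      show "((\<lambda>\<tau>. \<Phi> (?g \<tau>)) has_vector_derivative (of_real R * (s - 1)) * ?f (?g \<tau>)) (at \<tau>)"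
        by (simp add: o_def)
      have "Re ((1 + of_real \<tau> * (s - 1))\<^sup>2) = (1 - \<tau>)\<^sup>2 + 2 * \<tau> * (1 - \<tau>) * Re s + \<tau>\<^sup>2 * Re \<kappa>"
        unfolding s_re[symmetric] by (simp add: Re_power2 power2_eq_square algebra_simps)
      also have "\<dots> \<ge> (1 - \<tau>)\<^sup>2 + \<tau>\<^sup>2 * Re \<kappa>" using \<tau> Re_s by simp
      also have "(1 - \<tau>)\<^sup>2 + \<tau>\<^sup>2 * Re \<kappa> \<ge> min 1 (Re \<kappa>) * ((1 - \<tau>)\<^sup>2 + \<tau>\<^sup>2)"
      proof -
        have "min 1 (Re \<kappa>) * (1 - \<tau>)\<^sup>2 \<le> 1 * (1 - \<tau>)\<^sup>2" by (rule mult_right_mono) auto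
        moreover have "min 1 (Re \<kappa>) * \<tau>\<^sup>2 \<le> Re \<kappa> * \<tau>\<^sup>2" by (rule mult_right_mono) auto
        ultimately show ?thesis by (simp only: distrib_left mult.commute[of "\<tau>\<^sup>2" "Re \<kappa>"] mult_1_left)
      qed
      also have "min 1 (Re \<kappa>) * ((1 - \<tau>)\<^sup>2 + \<tau>\<^sup>2) \<ge> min 1 (Re \<kappa>) * (1 / 2)"
      proof -
        have "(1 - \<tau>)\<^sup>2 + \<tau>\<^sup>2 - 1 / 2 = 2 * (\<tau> - 1 / 2)\<^sup>2" by (simp add: power2_eq_square algebra_simps)
        also have "\<dots> \<ge> 0" by simp
        finally show ?thesis using \<kappa> by (intro mult_left_mono) auto
      qed
      finally have "\<delta> \<le> Re ((1 + of_real \<tau> * (s - 1))\<^sup>2)" by (simp add: \<delta>_def)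
      then have "R\<^sup>2 * \<delta> \<le> R\<^sup>2 * Re ((1 + of_real \<tau> * (s - 1))\<^sup>2)" by (rule mult_left_mono) simp
      also have "\<dots> = Re ((?g \<tau>)\<^sup>2)" by (simp add: power_mult_distrib flip: of_real_power)
      finally show "norm ((of_real R * (s - 1)) * ?f (?g \<tau>)) \<le> norm (s - 1) * R * exp (- \<delta> * R\<^sup>2)"
        using R by (auto simp: norm_mult norm_exp_eq_Re mult_ac intro!: mult_left_mono)
    qed
    then show ?thesis by (simp add: mult.commute)
  qed
  have arc0: "((\<lambda>R. \<Phi> (s * of_real R) - \<Phi> (of_real R)) \<longlongrightarrow> 0) at_top"
  proof (rule Lim_null_comparison)
    show "\<forall>\<^sub>F R in at_top. norm (\<Phi> (s * of_real R) - \<Phi> (of_real R)) \<le> norm (s - 1) * R * exp (- \<delta> * R\<^sup>2)"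
      using eventually_ge_at_top[of 0] by eventually_elim (rule arc)
    have "((\<lambda>R. norm (s - 1) * (R * exp (- \<delta> * R\<^sup>2))) \<longlongrightarrow> norm (s - 1) * 0) at_top"
      using \<delta> by (intro tendsto_intros) real_asymp
    then show "((\<lambda>R. norm (s - 1) * R * exp (- \<delta> * R\<^sup>2)) \<longlongrightarrow> 0) at_top" by (simp add: mult.assoc)
  qed
  let ?h = "\<lambda>u::real. exp (- \<kappa> * of_real (u\<^sup>2))"
  have full: "integrable lborel ?h"
  proof (rule Bochner_Integration.integrable_bound)
    show "integrable lborel (\<lambda>u. exp (- Re \<kappa> * u\<^sup>2))"
      using gaussian_integral(1)[OF \<kappa>] by (simp add: has_bochner_integral_iff)
    show "?h \<in> borel_measurable lborel" 
      by (auto intro!: borel_measurable_continuous_onI continuous_intros)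
  qed (auto simp: norm_exp_eq_Re simp flip: of_real_power)
  then have int: "set_integrable lborel {0..} ?h"
    unfolding set_integrable_def by (intro integrable_mult_indicator) auto
  have ray_lim: "((\<lambda>R. integral {0..R} (\<lambda>u. exp (- a * of_real (u\<^sup>2)))) \<longlongrightarrow> (LINT u:{0..}|lborel. exp (- a * of_real (u\<^sup>2)))) at_top"
    if "set_integrable lborel {0..} (\<lambda>u. exp (- a * of_real (u\<^sup>2)))" for a :: complex
  proof (rule Lim_transform_eventually)
    show "((\<lambda>R. LINT u:{0..R}|lborel. exp (- a * of_real (u\<^sup>2))) \<longlongrightarrow> (LINT u:{0..}|lborel. exp (- a * of_real (u\<^sup>2)))) at_top"
      by (rule tendsto_set_lebesgue_integral_at_top[OF _ that]) simp
    show "\<forall>\<^sub>F R in at_top. (LINT u:{0..R}|lborel. exp (- a * of_real (u\<^sup>2))) = integral {0..R} (\<lambda>u. exp (- a * of_real (u\<^sup>2)))"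
      by (intro always_eventually allI set_borel_integral_eq_integral(2) borel_integrable_atLeastAtMost' continuous_intros)
  qed
  have real_half: "has_bochner_integral lborel (\<lambda>u. indicator {0..} u *\<^sub>R exp (- 1 * complex_of_real (u\<^sup>2))) (of_real (sqrt pi / 2))"
    using has_bochner_integral_of_real[OF gaussian_moment_0, where 'a=complex]
    by (simp add: scaleR_conv_of_real exp_of_real[symmetric])
  have "s * (LINT u:{0..}|lborel. ?h u) = of_real (sqrt pi / 2)"
  proof (rule tendsto_unique)
    have "((\<lambda>R. integral {0..R} (\<lambda>u. exp (- 1 * complex_of_real (u\<^sup>2)))) \<longlongrightarrow> of_real (sqrt pi / 2)) at_top"
    proof -
      have "set_integrable lborel {0..} (\<lambda>u. exp (- 1 * complex_of_real (u\<^sup>2)))"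
        using real_half by (simp only: has_bochner_integral_iff set_integrable_def)
      moreover have "(LINT u:{0..}|lborel. exp (- 1 * complex_of_real (u\<^sup>2))) = of_real (sqrt pi / 2)"
        using has_bochner_integral_integral_eq[OF real_half] by (simp only: set_lebesgue_integral_def)
      ultimately show ?thesis using ray_lim[of 1] by (simp only:)
    qed
    then have "((\<lambda>R. \<Phi> (of_real R) - \<Phi> 0) \<longlongrightarrow> of_real (sqrt pi / 2)) at_top"
    proof (rule Lim_transform_eventually)
      show "\<forall>\<^sub>F R in at_top. integral {0..R} (\<lambda>u. exp (- 1 * complex_of_real (u\<^sup>2))) = \<Phi> (of_real R) - \<Phi> 0"
        using eventually_ge_at_top[of 0]
        by eventually_elim (use ray[of _ 1] in \<open>simp add: integral_unique\<close>)
    qed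
    from tendsto_add[OF this arc0]
    have "((\<lambda>R. \<Phi> (s * of_real R) - \<Phi> 0) \<longlongrightarrow> of_real (sqrt pi / 2)) at_top" by simp
    then show "((\<lambda>R. s * integral {0..R} ?h) \<longlongrightarrow> of_real (sqrt pi / 2)) at_top"
    proof (rule Lim_transform_eventually)
      show "\<forall>\<^sub>F R in at_top. \<Phi> (s * of_real R) - \<Phi> 0 = s * integral {0..R} ?h"
        using eventually_ge_at_top[of 0]
      proof eventually_elim
        case (elim R)
        have "s * integral {0..R} ?h = integral {0..R} (\<lambda>u. s * ?f (s * of_real u))"
          by (simp add: power_mult_distrib s2)
        then show ?case using integral_unique[OF ray[OF elim, of s]] by (simp only:)
      qed
    qed
    show "((\<lambda>R. s * integral {0..R} ?h) \<longlongrightarrow> s * (LINT u:{0..}|lborel. ?h u)) at_top"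
      by (intro tendsto_intros ray_lim int)
  qed simp
  then have half: "(LINT u:{0..}|lborel. ?h u) = of_real (sqrt pi / 2) / s"
    using \<open>s \<noteq> 0\<close> by (simp add: field_simps)
  have "has_bochner_integral lborel (\<lambda>u. indicator {0..} u *\<^sub>R ?h u) (of_real (sqrt pi / 2) / s)"
    using int half by (simp add: has_bochner_integral_iff set_integrable_def set_lebesgue_integral_def)
  then have "has_bochner_integral lborel ?h (2 *\<^sub>R (of_real (sqrt pi / 2) / s))"
    by (rule has_bochner_integral_even_function) simp
  moreover have "norm (2 *\<^sub>R (of_real (sqrt pi / 2) / s)) = sqrt (pi / norm \<kappa>)"
    by (simp add: norm_divide s_def real_sqrt_divide)
  ultimately show thesis by (rule that)
qed

section \<open>Laplace asymptotics at the saddle\<close>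

context saddle
begin

text \<open>The point \<open>z0\<close> is the saddle, \<open>phase\<close> is the rapidly varying
factor of the kernel on the vertical line, and \<open>curvature\<close> is the second derivative at
\<open>z0\<close> of the exponent \<open>\<alpha> z\<^sup>2 + ln ((1 - z) / (1 + z))\<close>,
simplified by the saddle equation.\<close>

definition "z0 = Complex x y0"
definition "phase y = exp (of_real lam * (Complex x y)\<^sup>2) * w y ^ m"
definition "curvature = of_real (6 * alpha) - of_real (4 * alpha\<^sup>2) * z0"
definition "q0 = z0\<^sup>2 - 1"

lemma y0_bounds: "y0 \<ge> sqrt c * x" "y0 \<le> 2 * x" "sqrt c > 0" "sqrt c \<le> 1"
proof -
  have "(sqrt c * x)\<^sup>2 \<le> y0\<^sup>2"
  proof -
    have "(sqrt c * x)\<^sup>2 = c * x\<^sup>2" using c by (simp add: power_mult_distrib)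
    also have "\<dots> \<le> c * (x + 1)\<^sup>2" using c x_pos by (intro mult_left_mono power_mono) auto
    finally show ?thesis using cx by (simp add: y0_sq)
  qed
  then show "y0 \<ge> sqrt c * x" by (rule power2_le_imp_le) (use y0_pos in simp)
  have "-1 \<le> x\<^sup>2" using zero_le_power2[of x] by linarith
  then have "y0\<^sup>2 \<le> (2 * x)\<^sup>2" by (simp add: y0_sq power_mult_distrib)
  then show "y0 \<le> 2 * x" by (rule power2_le_imp_le) (use x_pos in simp)
qed (use c in auto)

lemma norm_z0: "(norm z0)\<^sup>2 = 4 * x\<^sup>2 - 1" "norm z0 \<le> 2 * x" "norm z0 \<ge> sqrt (1 + c) * x" "z0 \<noteq> 0"
proof -
  show 1: "(norm z0)\<^sup>2 = 4 * x\<^sup>2 - 1" by (simp add: z0_def cmod_power2 y0_sq)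
  show "norm z0 \<le> 2 * x" by (rule power2_le_imp_le) (use 1 x_pos in \<open>auto simp: power_mult_distrib\<close>)
  show "norm z0 \<ge> sqrt (1 + c) * x"
  proof (rule power2_le_imp_le)
    have "c * x\<^sup>2 \<le> c * (x + 1)\<^sup>2" using c x_pos by (intro mult_left_mono power_mono) auto
    moreover have "(sqrt (1 + c) * x)\<^sup>2 = x\<^sup>2 + c * x\<^sup>2" using c by (simp add: power_mult_distrib algebra_simps)
    ultimately show "(sqrt (1 + c) * x)\<^sup>2 \<le> (norm z0)\<^sup>2" using cx unfolding 1 by linarith
  qed simp
  show "z0 \<noteq> 0" using 1 four_sq by auto
qed

lemma saddle_equation: "of_real alpha * z0 * q0 = -1"
proof -
  have y: "y0 * y0 = 3 * x\<^sup>2 - 1" using y0_sq by (simp add: power2_eq_square)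
  have "z0 * q0 = - of_real (2 * x * (4 * x\<^sup>2 - 1))"
    by (simp add: z0_def q0_def complex_eq_iff power2_eq_square)
       (use y in \<open>simp add: power2_eq_square, algebra\<close>)
  moreover have "2 * x * (4 * x\<^sup>2 - 1) \<noteq> 0" using x_pos four_sq by simp
  ultimately have "of_real alpha * (z0 * q0) = - of_real (alpha * (2 * x * (4 * x\<^sup>2 - 1)))" by simp
  also have "alpha * (2 * x * (4 * x\<^sup>2 - 1)) = 1" using x_pos four_sq by (simp add: alpha_def)
  finally show ?thesis by (simp add: mult.assoc)
qed

lemma norm_q0: "norm q0 \<ge> 2 * x\<^sup>2" "q0 \<noteq> 0" "norm q0 * (alpha * norm z0) = 1"
proof -
  have n: "alpha * norm z0 * norm q0 = 1"
    using arg_cong[OF saddle_equation, of norm] alpha_pos by (simp add: norm_mult)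
  then show "norm q0 * (alpha * norm z0) = 1" by (simp add: mult_ac)
  show "q0 \<noteq> 0" using n by auto
  have "alpha * norm z0 * (2 * x\<^sup>2) \<le> 1"
  proof -
    have "(x * norm z0)\<^sup>2 \<le> ((norm z0)\<^sup>2)\<^sup>2"
      unfolding power_mult_distrib norm_z0(1) using four_sq by (simp add: power2_eq_square mult_right_mono)
    then have "x * norm z0 \<le> 4 * x\<^sup>2 - 1"
      unfolding norm_z0(1) by (rule power2_le_imp_le) (use four_sq in simp)
    then have "x * norm z0 / (4 * x\<^sup>2 - 1) \<le> 1" using four_sq by simp
    moreover have "alpha * norm z0 * (2 * x\<^sup>2) = x * norm z0 / (4 * x\<^sup>2 - 1)"
      using x_pos by (simp add: alpha_def power2_eq_square)
    ultimately show ?thesis by simp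
  qed
  then have "alpha * norm z0 * (2 * x\<^sup>2) \<le> alpha * norm z0 * norm q0" using n by simp
  then show "norm q0 \<ge> 2 * x\<^sup>2" using alpha_pos norm_z0(4) by simp
qed

lemma curvature_alt: "curvature = of_real (2 * alpha) - 4 * z0 / q0\<^sup>2"
proof -
  have i: "1 / q0 = - of_real alpha * z0"
    using saddle_equation norm_q0(2) by (simp add: field_simps minus_equation_iff)
  have "of_real alpha * z0 * z0\<^sup>2 = of_real alpha * z0 - 1"
    using saddle_equation unfolding q0_def by (simp add: algebra_simps)
  have "4 * z0 / q0\<^sup>2 = 4 * z0 * (1 / q0)\<^sup>2" by (simp add: power_divide)
  also have "\<dots> = 4 * of_real alpha * (of_real alpha * z0 * z0\<^sup>2)"
    unfolding i by (simp add: power2_eq_square)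
  also have "of_real alpha * z0 * z0\<^sup>2 = of_real alpha * z0 - 1" by fact
  finally show ?thesis by (simp add: curvature_def power2_eq_square algebra_simps)
qed

text \<open>The lower bound says that the Gaussian at the saddle decays at least as fast as the
global majorant of the phase.\<close>

lemma Re_curvature: "2 * c * alpha \<le> Re curvature" and norm_curvature: "norm curvature \<le> 12 * alpha"
proof -
  have e: "Re curvature = alpha * (6 - 4 * (alpha * x))"
    by (simp add: curvature_def z0_def power2_eq_square algebra_simps)
  have ax: "alpha * x = 1 / (2 * (4 * x\<^sup>2 - 1))" using x_pos by (simp add: alpha_def)
  have "c * (4 * x\<^sup>2 - 1) \<le> 4 * (c * (x + 1)\<^sup>2)"
    using c x_pos by (simp add: power2_eq_square algebra_simps)
  also have "\<dots> \<le> 4 * (3 * x\<^sup>2 - 1)" using cx by simp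
  finally have "2 * c \<le> 6 - 4 * (alpha * x)"
    unfolding ax using four_sq by (simp add: field_simps)
  then show "2 * c * alpha \<le> Re curvature" unfolding e using alpha_pos by (simp add: mult.commute mult_left_mono)
  have "2 * x\<^sup>2 * (alpha * norm z0) \<le> 1"
    using mult_right_mono[OF norm_q0(1), of "alpha * norm z0"] norm_q0(3) alpha_pos by simp
  moreover have "2 / 3 * (alpha * norm z0) \<le> 2 * x\<^sup>2 * (alpha * norm z0)"
    using x_sq alpha_pos by (intro mult_right_mono) auto
  ultimately have "2 / 3 * (alpha * norm z0) \<le> 1" by (rule order.trans[rotated])
  then have az: "alpha * norm z0 \<le> 3 / 2" by simp
  have "norm curvature \<le> 6 * alpha + 4 * alpha * (alpha * norm z0)"
    unfolding curvature_def using alpha_pos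
    by (intro order.trans[OF norm_triangle_ineq4]) (simp add: norm_mult power2_eq_square)
  also have "\<dots> \<le> 6 * alpha + 4 * alpha * (3 / 2)" using az alpha_pos by (intro add_left_mono mult_left_mono) auto
  finally show "norm curvature \<le> 12 * alpha" by simp
qed

lemma z_minus_one: "y > 0 \<Longrightarrow> Complex x y - 1 \<noteq> 0" "y > 0 \<Longrightarrow> (Complex x y)\<^sup>2 - 1 \<noteq> 0"
proof -
  assume y: "y > 0"
  show 1: "Complex x y - 1 \<noteq> 0" using y by (simp add: complex_eq_iff)
  have "(Complex x y)\<^sup>2 - 1 = (Complex x y - 1) * (1 + Complex x y)" by (simp add: power2_eq_square algebra_simps)
  with 1 show "(Complex x y)\<^sup>2 - 1 \<noteq> 0" using norm_one_plus_ge(3) by simp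
qed

text \<open>The logarithmic derivative of the phase along the line, divided by \<open>m\<close>. It
is a rational function, so the expansion at the saddle is possible without a branch of the
logarithm.\<close>

definition "slope u = \<i> * (2 * of_real alpha * Complex x (y0 + u) + 2 / ((Complex x (y0 + u))\<^sup>2 - 1))"

text \<open>The slope vanishes at the saddle and has derivative \<open>- curvature\<close> there;
the quadratic Taylor remainder is computed exactly with \<open>q = z\<^sup>2 - 1\<close>. The
condition on \<open>u\<close> keeps \<open>z\<close> away from the zero \<open>1\<close> of
\<open>q\<close>, which comes close to the line when \<open>x\<close> is near
\<open>1\<close>.\<close>

lemma slope_bound:
  assumes u: "\<bar>u\<bar> \<le> y0 / 2"
  shows "norm (slope u + curvature * of_real u) \<le> 24 / (sqrt c * x ^ 4) * u\<^sup>2"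
proof -
  define z where "z = Complex x (y0 + u)"
  define q where "q = z\<^sup>2 - 1"
  have yu: "y0 + u \<ge> y0 / 2" "y0 + u > 0" using u y0_pos by auto
  have q: "q \<noteq> 0" unfolding q_def z_def by (rule z_minus_one(2)[OF yu(2)])
  have z: "z = z0 + \<i> * of_real u" by (simp add: z_def z0_def complex_eq_iff)
  have s0: "of_real alpha * z0 = - 1 / q0" using saddle_equation norm_q0(2) by (simp add: field_simps)
  have qq: "q = q0 + \<i> * of_real u * (2 * z0 + \<i> * of_real u)"
    by (simp add: q_def q0_def z power2_eq_square algebra_simps)
  have "slope u + curvature * of_real u = \<i> * (2 * (of_real alpha * z0) + 2 * of_real alpha * \<i> * of_real u + 2 / q) + curvature * of_real u"
    unfolding slope_def z_def[symmetric] q_def[symmetric] by (simp add: z algebra_simps)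
  also have "\<dots> = \<i> * (- 2 / q0 + 2 / q) - 4 * z0 / q0\<^sup>2 * of_real u"
    unfolding s0 curvature_alt by (simp add: algebra_simps)
  also have "\<dots> = 2 * \<i> * of_real (u\<^sup>2) / q * (q0 - 2 * z0 * (2 * z0 + \<i> * of_real u)) / q0\<^sup>2"
  proof -
    have "\<i> * (- 2 / q0 + 2 / q) - 4 * z0 / q0\<^sup>2 * of_real u = (2 * \<i> * (q0 - q) * q0 - 4 * z0 * of_real u * q) / (q * q0\<^sup>2)"
      using q norm_q0(2) by (simp add: field_simps power2_eq_square)
    also have "2 * \<i> * (q0 - q) * q0 - 4 * z0 * of_real u * q = 2 * \<i> * of_real (u\<^sup>2) * (q0 - 2 * z0 * (2 * z0 + \<i> * of_real u))"
      unfolding qq by (simp add: power2_eq_square algebra_simps)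
    finally show ?thesis by simp
  qed
  finally have eq: "slope u + curvature * of_real u = 2 * \<i> * of_real (u\<^sup>2) / q * (q0 - 2 * z0 * (2 * z0 + \<i> * of_real u)) / q0\<^sup>2" .
  have qn: "norm q \<ge> sqrt c * x\<^sup>2 / 2"
  proof -
    have "q = (z - 1) * (1 + z)" by (simp add: q_def power2_eq_square algebra_simps)
    then have "norm q = norm (z - 1) * norm (1 + z)" by (simp add: norm_mult)
    moreover have "norm (z - 1) \<ge> sqrt c * x / 2"
      using abs_Im_le_cmod[of "z - 1"] yu y0_bounds(1) by (simp add: z_def)
    moreover have "norm (1 + z) \<ge> x" unfolding z_def by (rule norm_one_plus_ge)
    ultimately show ?thesis
      using mult_mono[of "sqrt c * x / 2" "norm (z - 1)" x "norm (1 + z)"] x_pos c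
      by (simp add: power2_eq_square mult_ac)
  qed
  have bracket: "norm (q0 - 2 * z0 * (2 * z0 + \<i> * of_real u)) / (norm q0)\<^sup>2 \<le> 6 / x\<^sup>2"
  proof -
    have "norm (2 * z0 + \<i> * of_real u) \<le> 2 * norm z0 + \<bar>u\<bar>"
      by (rule order.trans[OF norm_triangle_ineq]) (simp add: norm_mult)
    also have "\<dots> \<le> 5 * x" using norm_z0(2) u y0_bounds(2) by simp
    finally have "norm (2 * z0 * (2 * z0 + \<i> * of_real u)) \<le> (2 * (2 * x)) * (5 * x)"
      unfolding norm_mult using norm_z0(2) x_pos by (intro mult_mono) auto
    then have "norm (q0 - 2 * z0 * (2 * z0 + \<i> * of_real u)) \<le> norm q0 + 20 * x\<^sup>2"
      by (intro order.trans[OF norm_triangle_ineq4] add_left_mono) (simp add: power2_eq_square)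
    then have "norm (q0 - 2 * z0 * (2 * z0 + \<i> * of_real u)) / (norm q0)\<^sup>2 \<le> (norm q0 + 20 * x\<^sup>2) / (norm q0)\<^sup>2"
      by (intro divide_right_mono) auto
    also have "\<dots> = 1 / norm q0 + 20 * x\<^sup>2 / (norm q0)\<^sup>2"
      using norm_q0(2) by (simp add: add_divide_distrib power2_eq_square)
    also have "\<dots> \<le> 1 / (2 * x\<^sup>2) + 20 * x\<^sup>2 / (2 * x\<^sup>2)\<^sup>2"
      using norm_q0 x_pos by (intro add_mono divide_left_mono power_mono mult_pos_pos) auto
    also have "\<dots> \<le> 6 / x\<^sup>2" using x_pos by (simp add: field_simps power2_eq_square)
    finally show ?thesis .
  qed
  have "norm (slope u + curvature * of_real u) = 2 * u\<^sup>2 / norm q * (norm (q0 - 2 * z0 * (2 * z0 + \<i> * of_real u)) / (norm q0)\<^sup>2)"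
    unfolding eq by (simp add: norm_mult norm_divide norm_power)
  also have "\<dots> \<le> 2 * u\<^sup>2 / (sqrt c * x\<^sup>2 / 2) * (6 / x\<^sup>2)"
    using qn bracket x_pos c q by (intro mult_mono divide_left_mono mult_pos_pos) auto
  also have "\<dots> = 24 / (sqrt c * x ^ 4) * u\<^sup>2"
    using x_pos c by (simp add: power4_eq_xxxx power2_eq_square)
  finally show ?thesis .
qed

lemma norm_phase_y0: "norm (phase y0) = H ^ m"
proof -
  have "(norm (1 - Complex x y0))\<^sup>2 = 2 * x * (2 * x - 1)" "(norm (1 + Complex x y0))\<^sup>2 = 2 * x * (2 * x + 1)"
    unfolding norm_Complex_one_sq y0_sq by (simp_all add: power2_eq_square algebra_simps)
  then have "(norm (w y0))\<^sup>2 = (2 * x - 1) / (2 * x + 1)"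
    using x_pos by (simp add: norm_divide power_divide)
  then have nw: "norm (w y0) = sqrt ((2 * x - 1) / (2 * x + 1))"
    by (metis norm_ge_zero real_sqrt_unique)
  have "norm (phase y0) = (norm (w y0) * exp (alpha * (1 - 2 * x\<^sup>2))) ^ m"
    by (simp add: phase_def norm_mult norm_power Re_power2 y0_sq power_mult_distrib lam_def exp_of_nat_mult[symmetric] algebra_simps)
  then show ?thesis unfolding nw H_def .
qed

lemma norm_w_y0: "(norm (w y0))\<^sup>2 = 1 - 2 / (2 * x + 1)"
proof -
  have "(norm (1 + Complex x y0))\<^sup>2 = 2 * x * (2 * x + 1)"
    unfolding norm_Complex_one_sq y0_sq by (simp_all add: power2_eq_square algebra_simps)
  then have "(norm (w y0))\<^sup>2 = 1 - 4 * x / (2 * x * (2 * x + 1))" unfolding norm_w(1) by simp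
  also have "4 * x / (2 * x * (2 * x + 1)) = 2 / (2 * x + 1)" using x_pos by (simp add: divide_simps)
  finally show ?thesis .
qed

lemma phase_derivative:
  assumes "y0 + u > 0"
  shows "((\<lambda>u. phase (y0 + u)) has_vector_derivative (of_nat m * slope u * phase (y0 + u))) (at u)"
proof -
  define z where "z = Complex x (y0 + u)"
  have zp: "1 + z \<noteq> 0" unfolding z_def by (rule norm_one_plus_ge)
  have zm: "z - 1 \<noteq> 0" unfolding z_def by (rule z_minus_one[OF assms])
  obtain k where k: "m = Suc k" using m by (cases m) auto
  have zq: "z\<^sup>2 - 1 = (z - 1) * (1 + z)" by (simp add: power2_eq_square algebra_simps)
  let ?P = "\<lambda>z. exp (of_real lam * z\<^sup>2) * ((1 - z) / (1 + z)) ^ m"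
  have d1: "((\<lambda>z. (1 - z) / (1 + z)) has_field_derivative (- 2 / (1 + z)\<^sup>2)) (at z)"
    using zp by (auto intro!: derivative_eq_intros simp: power2_eq_square divide_simps)
  have d2: "((\<lambda>z. ((1 - z) / (1 + z)) ^ m) has_field_derivative of_nat m * ((1 - z) / (1 + z)) ^ k * (- 2 / (1 + z)\<^sup>2)) (at z)"
    using DERIV_power[OF d1, of m] by (simp add: k mult_ac del: of_nat_Suc)
  have d3: "((\<lambda>z. exp (of_real lam * z\<^sup>2)) has_field_derivative exp (of_real lam * z\<^sup>2) * (of_real lam * (2 * z))) (at z)"
    by (auto intro!: derivative_eq_intros)
  have "(?P has_field_derivative
     (exp (of_real lam * z\<^sup>2) * (of_real lam * (2 * z))) * ((1 - z) / (1 + z)) ^ m +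
     exp (of_real lam * z\<^sup>2) * (of_nat m * ((1 - z) / (1 + z)) ^ k * (- 2 / (1 + z)\<^sup>2))) (at z)"
    using DERIV_mult[OF d3 d2] by (simp only: mult_ac)
  also have "(exp (of_real lam * z\<^sup>2) * (of_real lam * (2 * z))) * ((1 - z) / (1 + z)) ^ m +
     exp (of_real lam * z\<^sup>2) * (of_nat m * ((1 - z) / (1 + z)) ^ k * (- 2 / (1 + z)\<^sup>2))
     = of_nat m * (2 * of_real alpha * z + 2 / (z\<^sup>2 - 1)) * ?P z"
  proof -
    have "- 2 / (1 + z)\<^sup>2 = 2 / (z\<^sup>2 - 1) * ((1 - z) / (1 + z))"
      unfolding zq using zp zm by (simp add: divide_simps power2_eq_square)
    then have e: "((1 - z) / (1 + z)) ^ k * (- 2 / (1 + z)\<^sup>2) = 2 / (z\<^sup>2 - 1) * ((1 - z) / (1 + z)) ^ m"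
      unfolding k by simp
    show ?thesis unfolding mult.assoc e unfolding lam_def by (simp add: algebra_simps)
  qed
  finally have d: "(?P has_field_derivative of_nat m * (2 * of_real alpha * z + 2 / (z\<^sup>2 - 1)) * ?P z) (at z)" .
  have "((\<lambda>u. Complex x (y0 + u)) has_vector_derivative \<i>) (at u)"
    by (auto intro!: derivative_eq_intros simp: Complex_eq has_vector_derivative_def scaleR_conv_of_real algebra_simps)
  from field_vector_diff_chain_at[OF this, of ?P, folded z_def, OF d]
  show ?thesis by (simp add: o_def phase_def slope_def z_def[symmetric] mult_ac)
qed

lemma norm_phase_bound: "y \<ge> 0 \<Longrightarrow> norm (phase y) \<le> H ^ m * exp (- c * lam * (y - y0)\<^sup>2)"
  unfolding phase_def by (rule norm_phase_le)

abbreviation "gauss u \<equiv> exp (- (of_nat m * curvature / 2) * complex_of_real (u\<^sup>2))"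

lemma scaled_curvature_bounds: "c * lam \<le> Re (of_nat m * curvature / 2)" "norm (of_nat m * curvature / 2) \<le> 6 * lam"
  using Re_curvature norm_curvature mult_left_mono[of "2 * c * alpha" "Re curvature" "real m"]
    mult_left_mono[of "norm curvature" "12 * alpha" "real m"]
  by (simp_all add: lam_def norm_mult mult_ac)

lemma norm_gauss: "norm (gauss u) \<le> exp (- c * lam * u\<^sup>2)"
proof -
  have "norm (gauss u) = exp (- (Re (of_nat m * curvature / 2) * u\<^sup>2))"
    by (simp add: norm_exp_eq_Re flip: of_real_power)
  also have "\<dots> \<le> exp (- (c * lam * u\<^sup>2))"
    using mult_right_mono[OF scaled_curvature_bounds(1), of "u\<^sup>2"] by simp
  finally show ?thesis by simp
qed

text \<open>The product \<open>D\<close> of the phase and the inverse Gaussian satisfies \<open>D' =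
m (slope + curvature v) D\<close>. The first factor is quadratically small, and \<open>D\<close> is
bounded by an increasing function of \<open>\<bar>v\<bar>\<close> because the Gaussian majorant of
the phase is the slower one. Integrating from the saddle gives the cubic error without losing the
Gaussian decay.\<close>

lemma phase_expansion:
  assumes u: "\<bar>u\<bar> \<le> y0 / 2"
  shows "norm (phase (y0 + u) - phase y0 * gauss u)
    \<le> H ^ m * (real m * (24 / (sqrt c * x ^ 4)) * \<bar>u\<bar> ^ 3) * exp (- c * lam * u\<^sup>2)"
proof -
  define K where "K = 24 / (sqrt c * x ^ 4)"
  have K: "K \<ge> 0" using c x_pos by (simp add: K_def)
  define \<mu> where "\<mu> = of_nat m * curvature / 2"
  define \<nu> where "\<nu> = Re \<mu> - c * lam"
  have \<nu>: "\<nu> \<ge> 0" using scaled_curvature_bounds(1) by (simp add: \<nu>_def \<mu>_def)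
  define D where "D = (\<lambda>v. phase (y0 + v) * exp (\<mu> * complex_of_real (v\<^sup>2)))"
  have "norm (D u - D 0) \<le> (H ^ m * (real m * (K * u\<^sup>2)) * exp (\<nu> * u\<^sup>2)) * \<bar>u - 0\<bar>"
  proof (rule vector_derivative_increment_bound)
    fix v assume "v \<in> closed_segment 0 u"
    then have v: "\<bar>v\<bar> \<le> \<bar>u\<bar>" by (auto simp: closed_segment_eq_real_ivl split: if_splits)
    with u y0_pos have v0: "y0 + v > 0" "\<bar>v\<bar> \<le> y0 / 2" by linarith+
    have v2: "v\<^sup>2 \<le> u\<^sup>2" using v by (simp add: abs_le_square_iff)
    have "((\<lambda>v. exp (\<mu> * complex_of_real (v\<^sup>2))) has_vector_derivative (2 * of_real v * \<mu> * exp (\<mu> * complex_of_real (v\<^sup>2)))) (at v)"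
    proof -
      have "((\<lambda>v. complex_of_real (v\<^sup>2)) has_vector_derivative complex_of_real (2 * v)) (at v)"
        unfolding has_vector_derivative_def of_real_power
        by (auto intro!: derivative_eq_intros simp: scaleR_conv_of_real)
      moreover have "((\<lambda>z. exp (\<mu> * z)) has_field_derivative \<mu> * exp (\<mu> * complex_of_real (v\<^sup>2))) (at (complex_of_real (v\<^sup>2)))"
        by (auto intro!: derivative_eq_intros)
      ultimately show ?thesis
        using field_vector_diff_chain_at by (fastforce simp: o_def mult_ac)
    qed
    from has_vector_derivative_mult[OF phase_derivative[OF v0(1)] this]
    have "(D has_vector_derivative (of_nat m * slope v * phase (y0 + v) * exp (\<mu> * complex_of_real (v\<^sup>2))
      + phase (y0 + v) * (2 * of_real v * \<mu> * exp (\<mu> * complex_of_real (v\<^sup>2))))) (at v)"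
      unfolding D_def by (simp add: add.commute)
    also have "of_nat m * slope v * phase (y0 + v) * exp (\<mu> * complex_of_real (v\<^sup>2))
      + phase (y0 + v) * (2 * of_real v * \<mu> * exp (\<mu> * complex_of_real (v\<^sup>2)))
      = of_nat m * (slope v + curvature * of_real v) * D v"
      by (simp add: D_def \<mu>_def algebra_simps)
    finally show "(D has_vector_derivative of_nat m * (slope v + curvature * of_real v) * D v) (at v)" .
    have "norm (D v) \<le> H ^ m * exp (- c * lam * v\<^sup>2) * exp (Re \<mu> * v\<^sup>2)"
      using norm_phase_bound[of "y0 + v"] v0(1)
      by (auto simp: D_def norm_mult norm_exp_eq_Re intro!: mult_right_mono simp flip: of_real_power)
    also have "\<dots> = H ^ m * exp (\<nu> * v\<^sup>2)"
      by (simp add: \<nu>_def exp_add[symmetric] algebra_simps)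
    also have "\<dots> \<le> H ^ m * exp (\<nu> * u\<^sup>2)"
      using v2 \<nu> H_pos by (simp add: mult_left_mono)
    finally have Dv: "norm (D v) \<le> H ^ m * exp (\<nu> * u\<^sup>2)" .
    have "norm (slope v + curvature * of_real v) \<le> K * u\<^sup>2"
      using slope_bound[OF v0(2)] mult_left_mono[OF v2 K] by (simp add: K_def)
    then have "real m * norm (slope v + curvature * of_real v) * norm (D v) \<le> real m * (K * u\<^sup>2) * (H ^ m * exp (\<nu> * u\<^sup>2))"
      using K by (intro mult_mono Dv mult_left_mono) auto
    then show "norm (of_nat m * (slope v + curvature * of_real v) * D v) \<le> H ^ m * (real m * (K * u\<^sup>2)) * exp (\<nu> * u\<^sup>2)"
      by (simp add: norm_mult mult_ac)
  qed
  moreover have "phase (y0 + u) - phase y0 * gauss u = (D u - D 0) * gauss u"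
    by (simp add: D_def \<mu>_def left_diff_distrib mult.assoc exp_minus flip: exp_add)
  moreover have "norm (gauss u) = exp (- (Re \<mu> * u\<^sup>2))"
    by (simp add: norm_exp_eq_Re \<mu>_def flip: of_real_power)
  ultimately have "norm (phase (y0 + u) - phase y0 * gauss u)
    \<le> (H ^ m * (real m * (K * u\<^sup>2)) * exp (\<nu> * u\<^sup>2)) * \<bar>u\<bar> * exp (- (Re \<mu> * u\<^sup>2))"
    by (simp only: norm_mult) (simp add: mult_right_mono)
  also have "\<dots> = H ^ m * (real m * K * (u\<^sup>2 * \<bar>u\<bar>)) * (exp (\<nu> * u\<^sup>2) * exp (- (Re \<mu> * u\<^sup>2)))"
    by (simp only: mult_ac)
  also have "u\<^sup>2 * \<bar>u\<bar> = \<bar>u\<bar> ^ 3" by (simp add: power3_eq_cube power2_eq_square abs_mult)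
  also have "exp (\<nu> * u\<^sup>2) * exp (- (Re \<mu> * u\<^sup>2)) = exp (- c * lam * u\<^sup>2)"
    by (simp add: \<nu>_def exp_add[symmetric] algebra_simps)
  finally show ?thesis by (simp add: K_def)
qed

text \<open>Both the error of the phase and the variation of \<open>G\<close> are compared with the
Gaussian majorant. Far from the saddle, and on the negative half line that is added to complete the
Gaussian integral, the factor \<open>2 \<bar>y - y0\<bar> / y0 \<ge> 1\<close> can be inserted; so a
single majorant with first and third moments covers the whole line.\<close>

lemma laplace_half_line:
  assumes meas: "continuous_on {0..} G"
    and g: "\<And>y. y \<ge> 0 \<Longrightarrow> norm (G y) \<le> g"
    and L: "\<And>y. y \<ge> 0 \<Longrightarrow> norm (G y - G y0) \<le> L * \<bar>y - y0\<bar>"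
    and J: "has_bochner_integral lborel gauss J"
  shows "norm ((LINT y:{0..}|lborel. phase y * G y) - phase y0 * G y0 * J)
    \<le> H ^ m * ((L + 4 * g / y0) / (c * lam) + g * (real m * (24 / (sqrt c * x ^ 4))) / (c * lam)\<^sup>2)"
proof -
  define K where "K = real m * (24 / (sqrt c * x ^ 4))"
  have K: "K \<ge> 0" using c x_pos by (simp add: K_def)
  have g0: "g \<ge> 0" using g[of 0] norm_ge_zero[of "G 0"] by linarith
  have L0: "L \<ge> 0" using order.trans[OF norm_ge_zero L[of "y0 + 1"]] y0_pos by simp
  define A where "A = L + 4 * g / y0"
  have A: "A \<ge> 4 * g / y0" "A \<ge> L" using L0 g0 y0_pos by (auto simp: A_def)
  have A0: "A \<ge> 0" using A L0 by linarith
  let ?e = "\<lambda>y. exp (- (c * lam) * (y - y0)\<^sup>2)"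
  let ?bd = "\<lambda>y. H ^ m * (A * (?e y * \<bar>y - y0\<bar>) + g * K * (?e y * \<bar>y - y0\<bar> ^ 3))"
  have contP: "continuous_on {0..} phase"
    unfolding phase_def using norm_one_plus_ge(3) by (auto intro!: continuous_intros simp: Complex_eq)
  have bd: "has_bochner_integral lborel ?bd (H ^ m * (A * (1 / (c * lam)) + g * K * (1 / (c * lam)\<^sup>2)))"
    by (intro has_bochner_integral_mult_right has_bochner_integral_add
        has_bochner_integral_shift[where f="\<lambda>u. exp (- (c * lam) * u\<^sup>2) * \<bar>u\<bar>"]
        has_bochner_integral_shift[where f="\<lambda>u. exp (- (c * lam) * u\<^sup>2) * \<bar>u\<bar> ^ 3"]
        gaussian_integral cl_pos)
  have Jy: "has_bochner_integral lborel (\<lambda>y. phase y0 * G y0 * gauss (y - y0)) (phase y0 * G y0 * J)"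
    by (intro has_bochner_integral_mult_right has_bochner_integral_shift[where f=gauss] J)
  have Pn: "norm (phase y * G y) \<le> H ^ m * ?e y * g" if "y \<ge> 0" for y
    unfolding norm_mult using norm_phase_bound[OF that] g[OF that] H_pos by (intro mult_mono) auto
  have gn: "norm (phase y0 * G y0 * gauss (y - y0)) \<le> H ^ m * ?e y * g" for y
  proof -
    have "norm (phase y0 * G y0 * gauss (y - y0)) \<le> H ^ m * g * ?e y"
      unfolding norm_mult norm_phase_y0 using norm_gauss[of "y - y0"] g[of y0] y0_pos H_pos g0
      by (intro mult_mono mult_left_mono) auto
    then show ?thesis by (simp add: mult_ac)
  qed
  have int: "integrable lborel (\<lambda>y. indicator {0..} y *\<^sub>R (phase y * G y))"
  proof (rule Bochner_Integration.integrable_bound)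
    have "has_bochner_integral lborel (\<lambda>y. H ^ m * g * ?e y) (H ^ m * g * sqrt (pi / (c * lam)))"
      by (intro has_bochner_integral_mult_right has_bochner_integral_shift[where f="\<lambda>u. exp (- (c * lam) * u\<^sup>2)"]
        gaussian_integral cl_pos)
    then show "integrable lborel (\<lambda>y. H ^ m * g * ?e y)" by (simp add: has_bochner_integral_iff)
    show "(\<lambda>y. indicator {0..} y *\<^sub>R (phase y * G y)) \<in> borel_measurable lborel"
      using borel_measurable_continuous_on_indicator[OF _ continuous_on_mult[OF contP meas]] by simp
    show "AE y in lborel. norm (indicator {0..} y *\<^sub>R (phase y * G y)) \<le> norm (H ^ m * g * ?e y)"
      using Pn H_pos g0 by (intro AE_I2) (auto simp: indicator_def abs_mult mult_ac)
  qed
  have far: "2 * (H ^ m * ?e y * g) \<le> ?bd y" if "\<bar>y - y0\<bar> \<ge> y0 / 2" for y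
  proof -
    have "2 * g \<le> 4 * g / y0 * \<bar>y - y0\<bar>"
      using mult_left_mono[OF that, of "4 * g / y0"] g0 y0_pos by simp
    also have "\<dots> \<le> A * \<bar>y - y0\<bar>" using A by (intro mult_right_mono) auto
    finally have "H ^ m * ?e y * (2 * g) \<le> H ^ m * ?e y * (A * \<bar>y - y0\<bar>)"
      using H_pos by (intro mult_left_mono) auto
    also have "\<dots> \<le> ?bd y" using H_pos g0 K by (simp add: distrib_left mult_ac)
    finally show ?thesis by (simp add: mult_ac)
  qed
  have pw: "norm (indicator {0..} y *\<^sub>R (phase y * G y) - phase y0 * G y0 * gauss (y - y0)) \<le> ?bd y" for y
  proof (cases "y \<ge> 0")
    case False
    then have "\<bar>y - y0\<bar> \<ge> y0 / 2" using y0_pos by linarith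
    moreover have "0 \<le> H ^ m * ?e y * g" using H_pos g0 by simp
    ultimately have "H ^ m * ?e y * g \<le> ?bd y" using far[of y] by linarith
    then show ?thesis using gn[of y] False by simp
  next
    case True
    show ?thesis
    proof (cases "\<bar>y - y0\<bar> \<ge> y0 / 2")
      case far': True
      have "norm (phase y * G y - phase y0 * G y0 * gauss (y - y0)) \<le> norm (phase y * G y) + norm (phase y0 * G y0 * gauss (y - y0))"
        by (rule norm_triangle_ineq4)
      also have "\<dots> \<le> 2 * (H ^ m * ?e y * g)" using Pn[OF True] gn[of y] by linarith
      also have "\<dots> \<le> ?bd y" by (rule far[OF far'])
      finally show ?thesis using True by simp
    next
      case False
      define u where "u = y - y0"
      have y: "y = y0 + u" by (simp add: u_def)
      have "phase y * G y - phase y0 * G y0 * gauss u = phase y * (G y - G y0) + (phase y - phase y0 * gauss u) * G y0"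
        by (simp add: algebra_simps)
      then have "norm (phase y * G y - phase y0 * G y0 * gauss u)
        \<le> norm (phase y) * norm (G y - G y0) + norm (phase y - phase y0 * gauss u) * norm (G y0)"
        using norm_triangle_ineq by (metis norm_mult)
      also have "\<dots> \<le> (H ^ m * ?e y) * (L * \<bar>u\<bar>) + (H ^ m * (K * \<bar>u\<bar> ^ 3) * ?e y) * g"
      proof (intro add_mono mult_mono)
        show "norm (phase y) \<le> H ^ m * ?e y" using norm_phase_bound[OF True] by simp
        show "norm (G y - G y0) \<le> L * \<bar>u\<bar>" using L[OF True] by (simp add: u_def)
        show "norm (phase y - phase y0 * gauss u) \<le> H ^ m * (K * \<bar>u\<bar> ^ 3) * ?e y"
          using phase_expansion[of u] False unfolding K_def y by (simp add: u_def)
        show "norm (G y0) \<le> g" using g y0_pos by simp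
      qed (use H_pos K in auto)
      also have "\<dots> \<le> ?bd y"
      proof -
        have "(H ^ m * ?e y) * (L * \<bar>u\<bar>) \<le> (H ^ m * ?e y) * (A * \<bar>u\<bar>)"
          using A H_pos by (intro mult_left_mono mult_right_mono) auto
        then show ?thesis by (simp add: u_def algebra_simps)
      qed
      finally show ?thesis using True by (simp add: u_def)
    qed
  qed
  have "norm (integral\<^sup>L lborel (\<lambda>y. indicator {0..} y *\<^sub>R (phase y * G y) - phase y0 * G y0 * gauss (y - y0)))
    \<le> integral\<^sup>L lborel ?bd"
    by (rule Bochner_Integration.integral_norm_bound_integral)
       (use int Jy bd pw in \<open>auto simp: has_bochner_integral_iff\<close>)
  also have "integral\<^sup>L lborel (\<lambda>y. indicator {0..} y *\<^sub>R (phase y * G y) - phase y0 * G y0 * gauss (y - y0))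
    = (LINT y:{0..}|lborel. phase y * G y) - phase y0 * G y0 * J"
    using int Jy by (simp add: has_bochner_integral_iff set_lebesgue_integral_def)
  also have "integral\<^sup>L lborel ?bd = H ^ m * (A * (1 / (c * lam)) + g * K * (1 / (c * lam)\<^sup>2))"
    using bd by (rule has_bochner_integral_integral_eq)
  finally show ?thesis unfolding A_def K_def by simp
qed

end

section \<open>A lower bound for the tail of the coefficients\<close>

context saddle
begin

definition "w0 = w y0"

lemma norm_w0: "norm w0 < 1" "1 - (norm w0)\<^sup>2 = 2 / (2 * x + 1)"
  using norm_w(2)[of y0] norm_w_y0 by (simp_all add: w0_def)

text \<open>The tail of the coefficients is tested against the real part of a rotated geometric
sequence. Its ratio is the conjugate of the value \<open>w0\<close> at the saddle, which makes the
contribution of the saddle coherent: up to constants this is the reproducing kernel at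
\<open>w0\<close> of the Hardy space of the disc.\<close>

definition "test_coef \<beta> j = Re (\<beta> * cnj w0 ^ j)"

lemma test_coef_le: "norm \<beta> = 1 \<Longrightarrow> \<bar>test_coef \<beta> j\<bar> \<le> norm w0 ^ j"
  using abs_Re_le_cmod[of "\<beta> * cnj w0 ^ j"] by (simp add: test_coef_def norm_mult norm_power)

lemma sum_test_coef_sq_le:
  assumes "norm \<beta> = 1"
  shows "(\<Sum>j<n. (test_coef \<beta> j)\<^sup>2) \<le> 2 * x"
proof -
  define r where "r = (norm w0)\<^sup>2"
  have r: "0 \<le> r" "r < 1" using norm_w0 by (auto simp: r_def abs_square_less_1)
  have "(\<Sum>j<n. (test_coef \<beta> j)\<^sup>2) \<le> (\<Sum>j<n. r ^ j)"
  proof (rule sum_mono)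
    fix j
    have "(test_coef \<beta> j)\<^sup>2 \<le> (norm w0 ^ j)\<^sup>2" using test_coef_le[OF assms, of j] by (simp add: abs_le_square_iff[symmetric])
    then show "(test_coef \<beta> j)\<^sup>2 \<le> r ^ j" by (simp add: r_def mult.commute flip: power_mult)
  qed
  also have "\<dots> \<le> 1 / (1 - r)" using r by (simp add: sum_gp_strict divide_right_mono)
  also have "\<dots> = (2 * x + 1) / 2" using norm_w0(2) x_pos by (simp add: r_def)
  also have "\<dots> \<le> 2 * x" using x_gt_half by simp
  finally show ?thesis .
qed

text \<open>The generating function of the test sequence, together with the slowly varying factor of
the kernel, in closed form.\<close>

definition "weight \<beta> y = (1 / (1 + Complex x y)) * (1 / 4) *
   (\<beta> * (1 + cnj z0) / (Complex x y + cnj z0) + cnj \<beta> * (1 + z0) / (Complex x y + z0))"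

text \<open>Two geometric series in \<open>cnj w0 * w\<close> and \<open>w0 * w\<close>. As
\<open>w\<close> is a Moebius image of \<open>z\<close>, the sums \<open>1 / (1 - cnj w0 *
w)\<close> and \<open>1 / (1 - w0 * w)\<close> become multiples of \<open>1 / (z + cnj z0)\<close>
and \<open>1 / (z + z0)\<close>.\<close>

lemma weight_sums:
  "(\<lambda>j. of_real (test_coef \<beta> j) * (w y ^ j / (1 + Complex x y)\<^sup>2)) sums weight \<beta> y"
proof -
  define z where "z = Complex x y"
  have zp: "1 + z \<noteq> 0" unfolding z_def by (rule norm_one_plus_ge)
  have z0p: "1 + z0 \<noteq> 0" "1 + cnj z0 \<noteq> 0" by (auto simp: z0_def complex_eq_iff) (use x_pos in linarith)+
  have w0z: "w0 = (1 - z0) / (1 + z0)" by (simp add: w0_def z0_def)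
  have n: "norm (cnj w0 * w y) < 1" "norm (w0 * w y) < 1"
  proof -
    have "norm w0 * norm (w y) < 1"
      using mult_strict_mono[of "norm w0" 1 "norm (w y)" 1] norm_w0(1) norm_w(2)[of y] by simp
    then show "norm (cnj w0 * w y) < 1" "norm (w0 * w y) < 1"
      by (simp_all only: norm_mult complex_mod_cnj)
  qed
  have fr: "1 - b / d = (d - b) / d" if "d \<noteq> 0" for b d :: complex
    using that by (simp add: diff_divide_distrib)
  have k1: "1 / (1 - cnj w0 * w y) = (1 + z) * (1 + cnj z0) / (2 * (z + cnj z0))"
  proof -
    have "1 - cnj w0 * w y = ((1 + z) * (1 + cnj z0) - (1 - z) * (1 - cnj z0)) / ((1 + z) * (1 + cnj z0))"
      unfolding fr[OF no_zero_divisors[OF zp z0p(2)], symmetric] by (simp add: w0z z_def mult.commute)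
    also have "(1 + z) * (1 + cnj z0) - (1 - z) * (1 - cnj z0) = 2 * (z + cnj z0)" by (simp add: algebra_simps)
    finally show ?thesis by simp
  qed
  have k2: "1 / (1 - w0 * w y) = (1 + z) * (1 + z0) / (2 * (z + z0))"
  proof -
    have "1 - w0 * w y = ((1 + z) * (1 + z0) - (1 - z) * (1 - z0)) / ((1 + z) * (1 + z0))"
      unfolding fr[OF no_zero_divisors[OF zp z0p(1)], symmetric] by (simp add: w0z z_def mult.commute)
    also have "(1 + z) * (1 + z0) - (1 - z) * (1 - z0) = 2 * (z + z0)" by (simp add: algebra_simps)
    finally show ?thesis by simp
  qed
  have t: "of_real (test_coef \<beta> j) = (\<beta> * cnj w0 ^ j + cnj \<beta> * w0 ^ j) / 2" for j
  proof -
    have "of_real (Re u) = (u + cnj u) / 2" for u :: complex by (simp add: complex_eq_iff)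
    from this[of "\<beta> * cnj w0 ^ j"] show ?thesis by (simp add: test_coef_def)
  qed
  have "(\<lambda>j. (1 / (2 * (1 + z)\<^sup>2)) * (\<beta> * (cnj w0 * w y) ^ j + cnj \<beta> * (w0 * w y) ^ j)) sums
    ((1 / (2 * (1 + z)\<^sup>2)) * (\<beta> * (1 / (1 - cnj w0 * w y)) + cnj \<beta> * (1 / (1 - w0 * w y))))"
    by (intro sums_mult sums_add geometric_sums n)
  also have "(\<lambda>j. (1 / (2 * (1 + z)\<^sup>2)) * (\<beta> * (cnj w0 * w y) ^ j + cnj \<beta> * (w0 * w y) ^ j))
     = (\<lambda>j. of_real (test_coef \<beta> j) * (w y ^ j / (1 + Complex x y)\<^sup>2))"
  proof -
    have "(1 / (2 * D)) * (\<beta> * (a * v) + g * (b * v)) = (\<beta> * a + g * b) / 2 * (v / D)" for D a b v g :: complex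
      by (simp add: distrib_left distrib_right add_divide_distrib mult_ac)
    then show ?thesis unfolding t z_def by (simp only: power_mult_distrib)
  qed
  also have "((1 / (2 * (1 + z)\<^sup>2)) * (\<beta> * (1 / (1 - cnj w0 * w y)) + cnj \<beta> * (1 / (1 - w0 * w y)))) = weight \<beta> y"
  proof -
    have "(1 / (2 * A\<^sup>2)) * (\<beta> * (A * b / (2 * t)) + g * (A * d / (2 * s))) = (1 / A) * (1 / 4) * (\<beta> * b / t + g * d / s)"
      if "A \<noteq> 0" for A b t g d s :: complex
      using that by (simp add: power2_eq_square distrib_left mult_ac)
    from this[OF zp] show ?thesis unfolding k1 k2 unfolding weight_def z_def[symmetric] by this
  qed
  finally show ?thesis .
qed

text \<open>Summation and integration are exchanged; the factor \<open>norm w0 ^ j\<close> makes the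
integrals of the norms summable.\<close>

lemma sum_coef_test_coef_sums:
  assumes \<beta>: "norm \<beta> = 1"
  shows "(\<lambda>j. coef j * test_coef \<beta> j) sums (4 / pi * Re (LINT y:{0..}|lborel. phase y * weight \<beta> y))"
proof -
  let ?f = "\<lambda>j y. indicator {0..} y *\<^sub>R (of_real (test_coef \<beta> j) * ker j y)"
  have int: "integrable lborel (?f j)" for j
    using integrable_mult_right[OF ker_integrable[of j, unfolded set_integrable_def], of "of_real (test_coef \<beta> j)"]
    by simp
  have lint: "integral\<^sup>L lborel (?f j) = of_real (test_coef \<beta> j) * (LINT y:{0..}|lborel. ker j y)" for j
    unfolding set_lebesgue_integral_def by (subst integral_mult_right_zero[symmetric]) (simp add: mult_ac)
  have nle: "norm (?f j y) \<le> norm w0 ^ j * (H ^ m / x\<^sup>2 * exp (- (c * lam) * (y - y0)\<^sup>2))" for j y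
  proof (cases "y \<ge> 0")
    case True
    have "norm (w y) ^ j / (norm (1 + Complex x y))\<^sup>2 \<le> 1 / x\<^sup>2"
      using norm_w(2)[of y] norm_one_plus_ge[of y] x_pos
      by (intro frac_le power_le_one power_mono) auto
    then have "H ^ m * exp (- c * lam * (y - y0)\<^sup>2) * (norm (w y) ^ j / (norm (1 + Complex x y))\<^sup>2)
       \<le> H ^ m * exp (- c * lam * (y - y0)\<^sup>2) * (1 / x\<^sup>2)"
      using H_pos by (intro mult_left_mono) auto
    with norm_ker_le[OF True, of j] have k: "norm (ker j y) \<le> H ^ m / x\<^sup>2 * exp (- (c * lam) * (y - y0)\<^sup>2)" by simp
    have "\<bar>test_coef \<beta> j\<bar> * norm (ker j y) \<le> norm w0 ^ j * (H ^ m / x\<^sup>2 * exp (- (c * lam) * (y - y0)\<^sup>2))"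
      by (intro mult_mono test_coef_le \<beta> k) auto
    with True show ?thesis by (simp add: norm_mult)
  qed (use H_pos in simp)
  have gi: "has_bochner_integral lborel (\<lambda>y. H ^ m / x\<^sup>2 * exp (- (c * lam) * (y - y0)\<^sup>2)) (H ^ m / x\<^sup>2 * sqrt (pi / (c * lam)))"
    by (intro has_bochner_integral_mult_right has_bochner_integral_shift[where f="\<lambda>u. exp (- (c * lam) * u\<^sup>2)"]
        gaussian_integral cl_pos)
  have geo: "summable (\<lambda>j. norm w0 ^ j * B)" for B using norm_w0(1) by (intro summable_mult2 summable_geometric) simp
  have "(\<lambda>j. integral\<^sup>L lborel (?f j)) sums (\<integral>y. (\<Sum>j. ?f j y) \<partial>lborel)"
  proof (rule sums_integral[OF int])
    show "AE y in lborel. summable (\<lambda>j. norm (?f j y))"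
    proof (rule AE_I2)
      fix y
      show "summable (\<lambda>j. norm (?f j y))"
        by (rule summable_comparison_test'[OF geo[of "H ^ m / x\<^sup>2 * exp (- (c * lam) * (y - y0)\<^sup>2)"], of 0])
           (simp only: real_norm_def abs_norm_cancel nle)
    qed
    show "summable (\<lambda>j. \<integral>y. norm (?f j y) \<partial>lborel)"
    proof (rule summable_comparison_test'[OF geo, of 0])
      fix j
      have "(\<integral>y. norm (?f j y) \<partial>lborel) \<le> (\<integral>y. norm w0 ^ j * (H ^ m / x\<^sup>2 * exp (- (c * lam) * (y - y0)\<^sup>2)) \<partial>lborel)"
        by (rule integral_mono[OF integrable_norm[OF int] integrable_mult_right nle])
           (use gi in \<open>simp only: has_bochner_integral_iff\<close>)
      also have "\<dots> = norm w0 ^ j * (H ^ m / x\<^sup>2 * sqrt (pi / (c * lam)))"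
        by (subst integral_mult_right_zero) (simp only: has_bochner_integral_integral_eq[OF gi])
      finally show "norm (\<integral>y. norm (?f j y) \<partial>lborel) \<le> norm w0 ^ j * (H ^ m / x\<^sup>2 * sqrt (pi / (c * lam)))"
        by (simp add: integral_nonneg_AE)
    qed
  qed
  also have "(\<lambda>y. \<Sum>j. ?f j y) = (\<lambda>y. indicator {0..} y *\<^sub>R (phase y * weight \<beta> y))"
  proof
    fix y
    have "(\<lambda>j. indicator {0..} y *\<^sub>R (phase y * (of_real (test_coef \<beta> j) * (w y ^ j / (1 + Complex x y)\<^sup>2)))) sums
      (indicator {0..} y *\<^sub>R (phase y * weight \<beta> y))"
      by (intro sums_scaleR_right sums_mult weight_sums)
    then show "(\<Sum>j. ?f j y) = indicator {0..} y *\<^sub>R (phase y * weight \<beta> y)"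
      unfolding kernel_factor phase_def by (simp add: sums_iff mult_ac)
  qed
  finally have "(\<lambda>j. of_real (test_coef \<beta> j) * (LINT y:{0..}|lborel. ker j y)) sums (LINT y:{0..}|lborel. phase y * weight \<beta> y)"
    unfolding lint by (simp only: set_lebesgue_integral_def)
  from sums_mult[OF sums_Re[OF this], of "4 / pi"]
  have "(\<lambda>j. 4 / pi * Re (of_real (test_coef \<beta> j) * (LINT y:{0..}|lborel. ker j y))) sums (4 / pi * Re (LINT y:{0..}|lborel. phase y * weight \<beta> y))" .
  moreover have "Re (LINT y:{0..}|lborel. ker j y) = (LINT y:{0..}|lborel. Re (ker j y))" for j
    using integral_Re[OF ker_integrable[of j, unfolded set_integrable_def]]
    by (simp add: set_lebesgue_integral_def)
  ultimately show ?thesis unfolding coef_eq by (simp add: mult_ac)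
qed

lemma norm_add_z0_ge: "norm (Complex x y + cnj z0) \<ge> 2 * x" "norm (Complex x y + z0) \<ge> 2 * x"
  using complex_Re_le_cmod[of "Complex x y + cnj z0"] complex_Re_le_cmod[of "Complex x y + z0"]
  by (simp_all add: z0_def)

lemma norm_one_plus_z0: "norm (1 + z0) \<le> 3 * x" "norm (1 + z0) \<ge> 2 * x" "norm (1 + cnj z0) = norm (1 + z0)"
proof -
  have sq: "(norm (1 + z0))\<^sup>2 = 2 * x * (2 * x + 1)"
    unfolding z0_def norm_Complex_one_sq y0_sq by (simp add: power2_eq_square algebra_simps)
  show "norm (1 + z0) \<le> 3 * x"
  proof (rule power2_le_imp_le)
    have "2 * x * (2 * x + 1) \<le> 2 * x * (4 * x)" using x_gt_half by (intro mult_left_mono) auto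
    then show "(norm (1 + z0))\<^sup>2 \<le> (3 * x)\<^sup>2" unfolding sq by (simp add: power2_eq_square)
        (use zero_le_square[of x] in linarith)
  qed (use x_pos in simp)
  show "norm (1 + z0) \<ge> 2 * x"
  proof (rule power2_le_imp_le)
    show "(2 * x)\<^sup>2 \<le> (norm (1 + z0))\<^sup>2"
      unfolding sq using x_pos by (simp add: power2_eq_square algebra_simps)
  qed simp
  show "norm (1 + cnj z0) = norm (1 + z0)" by (simp add: cmod_def)
qed

text \<open>The weight has size \<open>1 / x\<close> and varies on the scale
\<open>x\<close>.\<close>

lemma weight_bounds:
  assumes \<beta>: "norm \<beta> = 1"
  shows "norm (weight \<beta> y) \<le> 1 / x"
    and "norm (weight \<beta> y - weight \<beta> y0) \<le> 1 / x\<^sup>2 * \<bar>y - y0\<bar>"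
    and "continuous_on {0..} (weight \<beta>)"
proof -
  define z where "z = Complex x y"
  define N where "N = norm (1 + z0)"
  have N: "N \<le> 3 * x" "N \<ge> 2 * x" "norm (1 + cnj z0) = N" using norm_one_plus_z0 by (simp_all add: N_def)
  define T where "T p z = 1 / ((1 + z) * (z + p))" for p z :: complex
  have wT: "weight \<beta> y = (1 / 4) * (\<beta> * (1 + cnj z0) * T (cnj z0) (Complex x y) + cnj \<beta> * (1 + z0) * T z0 (Complex x y))" for y
    by (simp only: weight_def T_def divide_inverse inverse_mult_distrib mult_1_left) (simp only: algebra_simps)
  have comb: "norm ((1 / 4) * (\<beta> * (1 + cnj z0) * a + cnj \<beta> * (1 + z0) * b)) \<le> N / 4 * (norm a + norm b)" for a b
  proof -
    have "norm (\<beta> * (1 + cnj z0) * a + cnj \<beta> * (1 + z0) * b) \<le> N * norm a + N * norm b"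
      by (rule order.trans[OF norm_triangle_ineq]) (simp add: norm_mult \<beta> N N_def[symmetric])
    from mult_left_mono[OF this, of "1 / 4"]
    show ?thesis unfolding norm_mult[of "1 / 4"] by (simp add: algebra_simps)
  qed
  have Tn: "norm (T p (Complex x y)) \<le> 1 / (x * (2 * x))" if "p = z0 \<or> p = cnj z0" for p
  proof -
    have "norm (Complex x y + p) \<ge> 2 * x" using that norm_add_z0_ge by auto
    then show ?thesis
      unfolding T_def norm_divide norm_mult norm_one using x_pos norm_one_plus_ge(1)
      by (intro frac_le mult_mono) auto
  qed
  have "norm (weight \<beta> y) \<le> N / 4 * (1 / (x * (2 * x)) + 1 / (x * (2 * x)))"
    unfolding wT using N x_pos by (intro order.trans[OF comb] mult_left_mono add_mono Tn) auto
  also have "\<dots> \<le> 3 * x / 4 * (1 / (x * (2 * x)) + 1 / (x * (2 * x)))"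
    using N x_pos by (intro mult_right_mono) auto
  also have "\<dots> \<le> 1 / x" using x_pos by (simp add: field_simps)
  finally show "norm (weight \<beta> y) \<le> 1 / x" .
  have Td: "norm (T p z - T p z0) \<le> \<bar>y - y0\<bar> * (3 / (4 * x\<^sup>2)) / N" if p: "p = z0 \<or> p = cnj z0" for p
  proof -
    have n: "norm (z + p) \<ge> 2 * x" "norm (z0 + p) \<ge> 2 * x" "norm (1 + z) \<ge> x"
      using p norm_add_z0_ge[of y] norm_add_z0_ge[of y0] norm_one_plus_ge(1)[of y] by (auto simp: z_def z0_def)
    have nz: "z + p \<noteq> 0" "z0 + p \<noteq> 0" "1 + z \<noteq> 0" "1 + z0 \<noteq> 0"
      using n N x_pos by (auto simp: N_def)
    have "T p z - T p z0 = (z0 - z) * (1 / ((z + p) * (z0 + p)) + 1 / ((1 + z) * (z + p))) / (1 + z0)"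
    proof -
      have frac: "1 / (A * B) - 1 / (C * D) = \<delta> * (1 / (B * D) + 1 / (A * B)) / C"
        if "C = A + \<delta>" "D = B + \<delta>" "A \<noteq> 0" "B \<noteq> 0" "C \<noteq> 0" "D \<noteq> 0" for A B C D \<delta> :: complex
      proof -
        have "1 / (A * B) - 1 / (C * D) = (C * D - A * B) / (A * B * C * D)"
          using that(3-6) by (simp add: field_simps)
        also have "C * D - A * B = \<delta> * (A + D)" unfolding that(1,2) by (simp add: algebra_simps)
        also have "\<delta> * (A + D) / (A * B * C * D) = \<delta> * (1 / (B * D) + 1 / (A * B)) / C"
          using that(3-6) by (simp add: divide_simps)
        finally show ?thesis .
      qed
      show ?thesis unfolding T_def by (rule frac) (use nz in auto)
    qed
    then have "norm (T p z - T p z0) = norm (z0 - z) * norm (1 / ((z + p) * (z0 + p)) + 1 / ((1 + z) * (z + p))) / N"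
      by (simp add: norm_mult norm_divide N_def)
    also have "norm (z0 - z) = \<bar>y - y0\<bar>" by (simp add: z_def z0_def cmod_def abs_minus_commute)
    also have "\<bar>y - y0\<bar> * norm (1 / ((z + p) * (z0 + p)) + 1 / ((1 + z) * (z + p))) / N \<le> \<bar>y - y0\<bar> * (3 / (4 * x\<^sup>2)) / N"
    proof (intro divide_right_mono mult_left_mono)
      have "norm (1 / ((z + p) * (z0 + p)) + 1 / ((1 + z) * (z + p))) \<le> 1 / ((2 * x) * (2 * x)) + 1 / (x * (2 * x))"
      proof (rule order.trans[OF norm_triangle_ineq add_mono])
        show "norm (1 / ((z + p) * (z0 + p))) \<le> 1 / ((2 * x) * (2 * x))" "norm (1 / ((1 + z) * (z + p))) \<le> 1 / (x * (2 * x))"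
          unfolding norm_divide norm_mult norm_one using n x_pos by (intro frac_le mult_mono; simp)+
      qed
      also have "\<dots> = 3 / (4 * x\<^sup>2)" using x_pos by (simp add: field_simps power2_eq_square)
      finally show "norm (1 / ((z + p) * (z0 + p)) + 1 / ((1 + z) * (z + p))) \<le> 3 / (4 * x\<^sup>2)" .
    qed (use N x_pos in auto)
    finally show ?thesis .
  qed
  have "weight \<beta> y - weight \<beta> y0 = (1 / 4) * (\<beta> * (1 + cnj z0) * (T (cnj z0) z - T (cnj z0) z0) + cnj \<beta> * (1 + z0) * (T z0 z - T z0 z0))"
    unfolding wT z_def z0_def[symmetric] by (simp add: algebra_simps)
  then have "norm (weight \<beta> y - weight \<beta> y0) \<le> N / 4 * (norm (T (cnj z0) z - T (cnj z0) z0) + norm (T z0 z - T z0 z0))"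
    by (simp only: comb)
  also have "\<dots> \<le> N / 4 * (\<bar>y - y0\<bar> * (3 / (4 * x\<^sup>2)) / N + \<bar>y - y0\<bar> * (3 / (4 * x\<^sup>2)) / N)"
    using N x_pos by (intro mult_left_mono add_mono Td) auto
  also have "\<dots> = 3 / 8 * (1 / x\<^sup>2 * \<bar>y - y0\<bar>)" using N x_pos by (simp add: field_simps)
  also have "\<dots> \<le> 1 / x\<^sup>2 * \<bar>y - y0\<bar>"
  proof -
    have "0 \<le> 1 / x\<^sup>2 * \<bar>y - y0\<bar>" by simp
    then show ?thesis by linarith
  qed
  finally show "norm (weight \<beta> y - weight \<beta> y0) \<le> 1 / x\<^sup>2 * \<bar>y - y0\<bar>" .
  have "Complex x y + cnj z0 \<noteq> 0" "Complex x y + z0 \<noteq> 0" for y using x_pos by (auto simp: z0_def complex_eq_iff)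
  then show "continuous_on {0..} (weight \<beta>)"
    unfolding weight_def[abs_def] using norm_one_plus_ge(3) by (intro continuous_intros) (auto simp: Complex_eq intro!: continuous_intros)
qed

text \<open>The two terms of the weight at the saddle have moduli proportional to \<open>1 /
x\<close> and \<open>1 / \<bar>z0\<bar>\<close>, and \<open>\<bar>z0\<bar> \<ge> sqrt (1 + c)
x\<close>. So \<open>gap\<close> is the fraction of the first term that the second one cannot
cancel. The other constant collects the two error terms of the Laplace expansion.\<close>

definition "gap = 1 - 1 / sqrt (1 + c)"
definition "err_const = 5 / (sqrt c * c) + 192 / (sqrt c * c\<^sup>2)"

lemma gap_pos: "gap > 0"
  using c by (simp add: gap_def)

text \<open>The unimodular factor \<open>\<beta>\<close> is chosen so that the first term of the
leading contribution \<open>phase y0 * weight \<beta> y0 * J\<close> is real and positive. The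
second term, which comes from the conjugate saddle and has an uncontrolled phase, is smaller in
modulus by a fixed factor; hence the oscillation of the coefficients cannot destroy the
bound.\<close>

lemma correlation_lower_bound:
  obtains \<beta> where "norm \<beta> = 1" and
    "Re (LINT y:{0..}|lborel. phase y * weight \<beta> y) \<ge> H ^ m * (gap / (8 * x) * sqrt (pi / (6 * lam)) - err_const / (x\<^sup>2 * lam))"
proof -
  have "Re (of_nat m * curvature / 2) > 0" using scaled_curvature_bounds(1) cl_pos by linarith
  then obtain J where J: "has_bochner_integral lborel gauss J" and nJ: "norm J = sqrt (pi / norm (of_nat m * curvature / 2))"
    by (rule complex_gaussian_integral)
  have kn: "norm (of_nat m * curvature / 2) > 0" using \<open>Re (of_nat m * curvature / 2) > 0\<close> complex_Re_le_cmod[of "of_nat m * curvature / 2"] by linarith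
  have J_ge: "norm J \<ge> sqrt (pi / (6 * lam))"
    unfolding nJ using scaled_curvature_bounds(2) kn lam_pos by (intro real_sqrt_le_mono divide_left_mono) auto
  have J_pos: "norm J > 0" unfolding nJ using kn by simp
  define \<Theta> where "\<Theta> = phase y0 * J * ((1 + cnj z0) / (1 + z0))"
  have n1: "norm (1 + z0) > 0" using norm_one_plus_z0(2) x_pos by linarith
  have n\<Theta>: "norm \<Theta> = H ^ m * norm J"
    using n1 unfolding \<Theta>_def norm_mult norm_divide norm_phase_y0 norm_one_plus_z0(3) by simp
  have \<Theta>0: "norm \<Theta> > 0" unfolding n\<Theta> using H_pos J_pos by simp
  define \<beta> where "\<beta> = cnj \<Theta> / of_real (norm \<Theta>)"
  have \<beta>: "norm \<beta> = 1" using \<Theta>0 by (simp add: \<beta>_def norm_divide)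
  have \<beta>\<Theta>: "\<beta> * \<Theta> = of_real (norm \<Theta>)"
  proof -
    have "cnj \<Theta> * \<Theta> = of_real (norm \<Theta>) * of_real (norm \<Theta>)"
      using complex_norm_square[of \<Theta>] by (simp add: power2_eq_square mult.commute)
    then show ?thesis using \<Theta>0 by (simp add: \<beta>_def)
  qed
  have zsum: "z0 + cnj z0 = of_real (2 * x)" "z0 + z0 = 2 * z0"
    by (simp_all add: z0_def complex_eq_iff)
  have expand: "P * ((1 / a) * (1 / 4) * (r * b / t + e * a / s)) * j = r * (P * j * (b / a)) / (4 * t) + e * (P * j) / (4 * s)"
    if "a \<noteq> 0" for P a b r t e s j :: complex
    using that by (simp add: distrib_left distrib_right mult_ac)
  have "1 + z0 \<noteq> 0" using n1 by auto
  then have "phase y0 * weight \<beta> y0 * J = (\<beta> * \<Theta>) / (4 * of_real (2 * x)) + cnj \<beta> * (phase y0 * J) / (4 * (2 * z0))"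
    unfolding weight_def zsum \<Theta>_def z0_def[symmetric] by (rule expand)
  also have "(\<beta> * \<Theta>) / (4 * of_real (2 * x)) = of_real (norm \<Theta> / (8 * x))" unfolding \<beta>\<Theta> by simp
  also have "4 * (2 * z0) = 8 * z0" by simp
  finally have main: "Re (phase y0 * weight \<beta> y0 * J) = norm \<Theta> / (8 * x) + Re (cnj \<beta> * (phase y0 * J) / (8 * z0))"
    by (simp only: plus_complex.simps Re_complex_of_real)
  have "norm (cnj \<beta> * (phase y0 * J) / (8 * z0)) = H ^ m * norm J / (8 * norm z0)"
    by (simp add: norm_mult norm_divide \<beta> norm_phase_y0)
  also have "\<dots> \<le> H ^ m * norm J / (8 * (sqrt (1 + c) * x))"
    using norm_z0(3,4) c x_pos H_pos J_pos by (intro divide_left_mono mult_left_mono mult_pos_pos) auto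
  finally have "Re (cnj \<beta> * (phase y0 * J) / (8 * z0)) \<ge> - (H ^ m * norm J / (8 * (sqrt (1 + c) * x)))"
    using abs_Re_le_cmod[of "cnj \<beta> * (phase y0 * J) / (8 * z0)"] by linarith
  then have "Re (phase y0 * weight \<beta> y0 * J) \<ge> H ^ m * norm J / (8 * x) - H ^ m * norm J / (8 * (sqrt (1 + c) * x))"
    unfolding main n\<Theta> by linarith
  also have "H ^ m * norm J / (8 * x) - H ^ m * norm J / (8 * (sqrt (1 + c) * x)) = H ^ m * (gap / (8 * x) * norm J)"
    using x_pos c by (simp add: gap_def field_simps)
  finally have R1: "Re (phase y0 * weight \<beta> y0 * J) \<ge> H ^ m * (gap / (8 * x) * norm J)" .
  have R2: "H ^ m * (gap / (8 * x) * norm J) \<ge> H ^ m * (gap / (8 * x) * sqrt (pi / (6 * lam)))"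
    using J_ge H_pos gap_pos x_pos by (intro mult_left_mono) auto
  have err: "norm ((LINT y:{0..}|lborel. phase y * weight \<beta> y) - phase y0 * weight \<beta> y0 * J)
    \<le> H ^ m * ((1 / x\<^sup>2 + 4 * (1 / x) / y0) / (c * lam) + (1 / x) * (real m * (24 / (sqrt c * x ^ 4))) / (c * lam)\<^sup>2)"
    by (rule laplace_half_line[OF weight_bounds(3)[OF \<beta>] weight_bounds(1)[OF \<beta>] weight_bounds(2)[OF \<beta>] J])
  have e1: "(1 / x\<^sup>2 + 4 * (1 / x) / y0) / (c * lam) \<le> 5 / (sqrt c * c) * (1 / (x\<^sup>2 * lam))"
  proof -
    have "4 * (1 / x) / y0 \<le> 4 * (1 / x) / (sqrt c * x)"
      using y0_bounds c x_pos y0_pos by (intro divide_left_mono mult_pos_pos) auto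
    moreover have "1 / x\<^sup>2 \<le> 1 / (sqrt c * x\<^sup>2)"
      using y0_bounds c x_pos by (intro divide_left_mono mult_pos_pos) (auto simp: mult_le_cancel_right1)
    moreover have "4 * (1 / x) / (sqrt c * x) = 4 * (1 / (sqrt c * x\<^sup>2))" "5 / (sqrt c * x\<^sup>2) = 5 * (1 / (sqrt c * x\<^sup>2))"
      by (simp_all add: power2_eq_square mult_ac)
    ultimately have "1 / x\<^sup>2 + 4 * (1 / x) / y0 \<le> 5 / (sqrt c * x\<^sup>2)"
      by linarith
    then have "(1 / x\<^sup>2 + 4 * (1 / x) / y0) / (c * lam) \<le> 5 / (sqrt c * x\<^sup>2) / (c * lam)"
      using cl_pos by (intro divide_right_mono) auto
    then show ?thesis by (simp add: mult_ac)
  qed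
  have e2: "(1 / x) * (real m * (24 / (sqrt c * x ^ 4))) / (c * lam)\<^sup>2 \<le> 192 / (sqrt c * c\<^sup>2) * (1 / (x\<^sup>2 * lam))"
  proof -
    have "real m = lam / alpha" using alpha_pos by (simp add: lam_def)
    also have "lam / alpha \<le> 8 * x ^ 3 * lam"
      using alpha_cube(1) alpha_pos lam_pos by (simp add: field_simps)
    finally have mle: "real m \<le> 8 * x ^ 3 * lam" .
    have "(1 / x) * (real m * (24 / (sqrt c * x ^ 4))) / (c * lam)\<^sup>2 \<le> (1 / x) * (8 * x ^ 3 * lam * (24 / (sqrt c * x ^ 4))) / (c * lam)\<^sup>2"
      using mle x_pos c by (intro divide_right_mono mult_left_mono mult_right_mono) auto
    also have "\<dots> = 192 / (sqrt c * c\<^sup>2) * (1 / (x\<^sup>2 * lam))"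
      using x_pos c lam_pos by (simp add: field_simps power2_eq_square power3_eq_cube power4_eq_xxxx)
    finally show ?thesis .
  qed
  have "norm ((LINT y:{0..}|lborel. phase y * weight \<beta> y) - phase y0 * weight \<beta> y0 * J) \<le> H ^ m * (err_const / (x\<^sup>2 * lam))"
  proof -
    have "(1 / x\<^sup>2 + 4 * (1 / x) / y0) / (c * lam) + (1 / x) * (real m * (24 / (sqrt c * x ^ 4))) / (c * lam)\<^sup>2 \<le> err_const / (x\<^sup>2 * lam)"
      using e1 e2 by (simp add: err_const_def add_divide_distrib)
    then show ?thesis using err H_pos by (meson mult_left_mono order.trans zero_le_power less_imp_le)
  qed
  then have "\<bar>Re (LINT y:{0..}|lborel. phase y * weight \<beta> y) - Re (phase y0 * weight \<beta> y0 * J)\<bar> \<le> H ^ m * (err_const / (x\<^sup>2 * lam))"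
    using abs_Re_le_cmod[of "(LINT y:{0..}|lborel. phase y * weight \<beta> y) - phase y0 * weight \<beta> y0 * J"] by simp
  with R1 R2 have "Re (LINT y:{0..}|lborel. phase y * weight \<beta> y) \<ge> H ^ m * (gap / (8 * x) * sqrt (pi / (6 * lam))) - H ^ m * (err_const / (x\<^sup>2 * lam))"
    by linarith
  then show thesis using that[OF \<beta>] by (simp add: right_diff_distrib)
qed

text \<open>By the inequality of Cauchy and Schwarz the correlation with the test sequence, whose
squared norm is at most \<open>2 x\<close>, bounds the sum of squares from below. The hypothesis on
\<open>x * sqrt lam\<close> makes the Laplace error at most half of the main term.\<close>

lemma sum_coef_sq_ge:
  assumes A: "\<And>n. (\<Sum>j<n. (coef j)\<^sup>2) \<le> A" and large: "x * sqrt lam \<ge> 32 * err_const / gap"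
  shows "A \<ge> (gap / 32)\<^sup>2 * (H ^ m)\<^sup>2 / real m"
proof -
  obtain \<beta> where \<beta>: "norm \<beta> = 1" and
    lower: "Re (LINT y:{0..}|lborel. phase y * weight \<beta> y) \<ge> H ^ m * (gap / (8 * x) * sqrt (pi / (6 * lam)) - err_const / (x\<^sup>2 * lam))"
    by (rule correlation_lower_bound)
  define S where "S = 4 / pi * Re (LINT y:{0..}|lborel. phase y * weight \<beta> y)"
  define s where "s = x * sqrt lam"
  have s: "s > 0" "s \<ge> 32 * err_const / gap" using x_pos lam_pos large by (auto simp: s_def)
  have s2: "s\<^sup>2 = x\<^sup>2 * lam" using lam_pos by (simp add: s_def power_mult_distrib)
  have sq: "sqrt (pi / (6 * lam)) \<ge> 1 / (2 * sqrt lam)"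
  proof -
    have "1 / (4 * lam) \<le> pi / (6 * lam)" using pi_gt3 lam_pos by (simp add: field_simps)
    then have "sqrt (1 / (4 * lam)) \<le> sqrt (pi / (6 * lam))" by (rule real_sqrt_le_mono)
    then show ?thesis by (simp add: real_sqrt_divide real_sqrt_mult)
  qed
  have "gap / (8 * x) * sqrt (pi / (6 * lam)) \<ge> gap / (8 * x) * (1 / (2 * sqrt lam))"
    using sq gap_pos x_pos by (intro mult_left_mono) auto
  then have a1: "gap / (8 * x) * sqrt (pi / (6 * lam)) \<ge> gap / 16 / s" by (simp add: s_def)
  have a2: "err_const / s\<^sup>2 \<le> gap / 32 / s"
  proof -
    have "err_const \<le> gap / 32 * s" using s gap_pos by (simp add: field_simps)
    then have "err_const / s\<^sup>2 \<le> gap / 32 * s / s\<^sup>2" by (rule divide_right_mono) simp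
    then show ?thesis using s by (simp add: power2_eq_square)
  qed
  have "gap / 32 / s \<le> gap / (8 * x) * sqrt (pi / (6 * lam)) - err_const / s\<^sup>2" using a1 a2 by (simp add: field_simps)
  then have I: "H ^ m * (gap / 32 / s) \<le> Re (LINT y:{0..}|lborel. phase y * weight \<beta> y)"
    using lower H_pos unfolding s2[symmetric] by (meson mult_left_mono order.trans zero_le_power less_imp_le)
  have Ipos: "H ^ m * (gap / 32 / s) \<ge> 0" using H_pos gap_pos s by simp
  have "1 \<le> 4 / pi" using pi_less_4 by simp
  then have "1 * (H ^ m * (gap / 32 / s)) \<le> S"
    unfolding S_def using I Ipos by (intro mult_mono) auto
  then have "(H ^ m * (gap / 32 / s))\<^sup>2 \<le> S\<^sup>2" using Ipos by (intro power_mono) auto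
  also have "S\<^sup>2 \<le> A * (2 * x)"
  proof -
    have "(\<lambda>n. (\<Sum>j<n. coef j * test_coef \<beta> j)\<^sup>2) \<longlonglongrightarrow> S\<^sup>2"
      using sum_coef_test_coef_sums[OF \<beta>] unfolding sums_def S_def by (intro tendsto_intros)
    moreover have "(\<Sum>j<n. coef j * test_coef \<beta> j)\<^sup>2 \<le> A * (2 * x)" for n
    proof -
      have "(\<Sum>j<n. coef j * test_coef \<beta> j)\<^sup>2 \<le> (\<Sum>j<n. (coef j)\<^sup>2) * (\<Sum>j<n. (test_coef \<beta> j)\<^sup>2)"
        by (rule Cauchy_Schwarz_ineq_sum)
      also have "\<dots> \<le> A * (2 * x)"
        using A[of n] A[of 0] by (intro mult_mono sum_test_coef_sq_le \<beta>) (auto intro!: sum_nonneg)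
      finally show ?thesis .
    qed
    ultimately show ?thesis by (intro LIMSEQ_le_const2) auto
  qed
  finally have f: "(H ^ m * (gap / 32 / s))\<^sup>2 \<le> A * (2 * x)" .
  have e: "(H ^ m * (gap / 32 / s))\<^sup>2 = (gap / 32)\<^sup>2 * (H ^ m)\<^sup>2 / (x\<^sup>2 * lam)"
    unfolding s2[symmetric] by (simp add: power_mult_distrib power_divide)
  have "(gap / 32)\<^sup>2 * (H ^ m)\<^sup>2 \<le> A * (2 * x) * (x\<^sup>2 * lam)"
    using f x_pos lam_pos unfolding e by (simp add: pos_divide_le_eq)
  also have "\<dots> = A * real m * (2 * (alpha * x ^ 3))"
    by (simp add: lam_def power2_eq_square power3_eq_cube)
  also have "\<dots> \<le> A * real m * 1"
    using alpha_cube(2) A[of 0] by (intro mult_left_mono) auto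
  finally show ?thesis using m by (simp add: pos_divide_le_eq)
qed

end

section \<open>Two-sided bounds for a single degree\<close>

context saddle
begin

lemma coef_shift: "coef k = cheb_coeff (F lam) (k + Suc m)"
  by (simp add: coef_def add.commute)

lemma summable_cheb_coeff: "summable (\<lambda>k. \<bar>cheb_coeff (F lam) k\<bar>)"
proof -
  have "summable (\<lambda>k. \<bar>coef k\<bar>)"
    by (rule summableI_nonneg_bounded[OF _ sum_abs_coef_le]) simp
  then show ?thesis unfolding coef_shift by (subst (asm) summable_iff_shift)
qed

text \<open>\<open>\<alpha> powr (1/3)\<close> and \<open>1 / x\<close> differ at most by a factor
\<open>2\<close>; this translates the estimates in terms of \<open>x\<close> into the natural large
parameter.\<close>

lemma scaled_saddle:
  defines "a \<equiv> alpha powr (1/3)"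
  shows "a > 0" "a ^ 3 = alpha" "1 \<le> 2 * (a * x)" "a * x \<le> 1"
proof -
  show a: "a > 0" using alpha_pos by (simp add: a_def)
  have "a ^ 3 = a powr 3" using a by (simp add: powr_numeral)
  then show a3: "a ^ 3 = alpha" using alpha_pos by (simp add: a_def powr_powr)
  have ax: "(a * x) ^ 3 = alpha * x ^ 3" by (simp add: power_mult_distrib a3)
  have "(1 / 2) ^ 3 \<le> (a * x) ^ 3" unfolding ax using alpha_cube(1) by (simp add: power3_eq_cube)
  then show "1 \<le> 2 * (a * x)" using power_le_imp_le_base[of "1/2" 2 "a * x"] a x_pos by (simp add: numeral_3_eq_3)
  have "(a * x) ^ 3 \<le> 1 ^ 3" unfolding ax using alpha_cube(2) by simp
  then show "a * x \<le> 1" using power_le_imp_le_base[of "a * x" 2 1] by (simp add: numeral_3_eq_3)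
qed

lemma Lambda_eq: "(lam * real m ^ 2) powr (1/3) = alpha powr (1/3) * real m"
proof -
  define z where "z = alpha powr (1/3) * real m"
  have z: "z > 0" using alpha_pos m by (simp add: z_def)
  have "lam * real m ^ 2 = z ^ 3"
    unfolding z_def power_mult_distrib scaled_saddle(2) by (simp add: lam_def power2_eq_square power3_eq_cube)
  also have "z ^ 3 = z powr 3" using z by (simp add: powr_numeral)
  finally show ?thesis using z by (simp only: powr_powr z_def[symmetric]) simp
qed

lemma x_sq_lam_ge: "x\<^sup>2 * lam \<ge> (lam * real m ^ 2) powr (1/3) / 4"
proof -
  define a where "a = alpha powr (1/3)"
  note a = scaled_saddle[folded a_def]
  have "1\<^sup>2 \<le> (2 * (a * x))\<^sup>2" using a(3) by (intro power_mono) auto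
  then have "(1 / 4) * (a * real m) \<le> (a * x)\<^sup>2 * (a * real m)"
    using a(1) by (intro mult_right_mono) (auto simp: power2_eq_square)
  also have "\<dots> = x\<^sup>2 * (a ^ 3 * real m)" by (simp add: power2_eq_square power3_eq_cube)
  finally show ?thesis unfolding Lambda_eq a_def[symmetric] a(2) by (simp add: lam_def)
qed

lemma ln_H_m_le: "real m * ln H \<le> - (c / 4) * (lam * real m ^ 2) powr (1/3)"
proof -
  define a where "a = alpha powr (1/3)"
  note a = scaled_saddle[folded a_def]
  have "a \<le> 1 / x" using a(4) x_pos by (simp add: field_simps)
  then have "c / 4 * a \<le> c / 4 * (1 / x)" using c by (intro mult_left_mono) auto
  then have "ln H \<le> - (c / 4 * a)" using ln_H_le by simp
  then have "real m * ln H \<le> real m * - (c / 4 * a)" by (intro mult_left_mono) auto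
  then show ?thesis unfolding Lambda_eq a_def[symmetric] by (simp add: mult_ac)
qed

lemma sup_norm_rem_upper:
  "sup_norm (cheb_rem m lam) \<le> 4 / c * lam powr (-1/6) * real m powr (-1/3) * H ^ m"
proof -
  define a where "a = alpha powr (1/3)"
  note a = scaled_saddle[folded a_def]
  have "sup_norm (cheb_rem m lam) \<le> (\<Sum>k. \<bar>coef k\<bar>)"
    unfolding coef_shift by (rule sup_norm_cheb_rem_le[OF lam_pos summable_cheb_coeff])
  also have "\<dots> \<le> 4 / pi * (H ^ m / (2 * x) * sqrt (pi / (c * lam)))"
    by (intro suminf_le_const summableI_nonneg_bounded[OF _ sum_abs_coef_le] sum_abs_coef_le) simp
  also have "\<dots> \<le> 4 / pi * (H ^ m / (2 * x) * (pi / (c * sqrt lam)))"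
  proof -
    \<comment> \<open>Generous constants: only the dependence on \<open>c\<close> matters.\<close>
    have "sqrt pi \<le> pi" using pi_gt3 by (intro real_le_lsqrt) (auto simp: power2_eq_square)
    moreover have "c \<le> sqrt c" using c by (intro real_le_rsqrt) (auto simp: power2_eq_square mult_left_le)
    ultimately have "sqrt pi / (sqrt c * sqrt lam) \<le> pi / (c * sqrt lam)"
      using c lam_pos by (intro frac_le mult_right_mono) auto
    then have "sqrt (pi / (c * lam)) \<le> pi / (c * sqrt lam)" by (simp add: real_sqrt_divide real_sqrt_mult)
    then show ?thesis using H_pos x_pos by (intro mult_left_mono) auto
  qed
  also have "\<dots> = 2 / c * (1 / x) / sqrt lam * H ^ m" by simp
  also have "\<dots> \<le> 2 / c * (2 * a) / sqrt lam * H ^ m"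
    using a(3) x_pos c H_pos lam_pos
    by (intro mult_right_mono divide_right_mono mult_left_mono) (auto simp: field_simps)
  also have "2 / c * (2 * a) / sqrt lam * H ^ m = 4 / c * (a / sqrt lam) * H ^ m" by simp
  also have "a / sqrt lam = lam powr (-1/6) * real m powr (-1/3)"
  proof -
    have "alpha = lam / real m" using m by (simp add: lam_def)
    then have "a = lam powr (1/3) * real m powr (-1/3)"
      using lam_pos by (simp add: a_def powr_divide powr_minus_divide)
    then have "a / sqrt lam = lam powr (1/3) * lam powr (-1/2) * real m powr (-1/3)"
      using lam_pos by (simp add: powr_half_sqrt[symmetric] powr_minus_divide)
    also have "lam powr (1/3) * lam powr (-1/2) = lam powr (-1/6)" by (simp add: powr_add[symmetric])
    finally show ?thesis .
  qed
  finally show ?thesis by (simp only: mult.assoc)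
qed

lemma powr_neg_half: "real m powr (-1/2) = 1 / sqrt (real m)"
  using m by (simp add: powr_half_sqrt[symmetric] powr_minus_divide)

text \<open>The sum of squares is at most the product of the supremum and the sum of the absolute
values. Nothing is lost in order of magnitude, as about \<open>x\<close> coefficients of comparable
size dominate.\<close>

lemma L2_norm_rem_upper:
  "cheb_L2_norm (cheb_rem m lam) \<le> 6 / c * real m powr (-1/2) * H ^ m"
proof -
  let ?B0 = "4 / pi * (H ^ m / x\<^sup>2 * sqrt (pi / (c * lam)))"
  let ?B1 = "4 / pi * (H ^ m / (2 * x) * sqrt (pi / (c * lam)))"
  have B0: "?B0 \<ge> 0" using H_pos cl_pos by simp
  have "(\<Sum>k<n. (coef k)\<^sup>2) \<le> ?B0 * ?B1" for n
  proof -
    have "(\<Sum>k<n. (coef k)\<^sup>2) = (\<Sum>k<n. \<bar>coef k\<bar> * \<bar>coef k\<bar>)" by (simp add: power2_eq_square)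
    also have "\<dots> \<le> (\<Sum>k<n. ?B0 * \<bar>coef k\<bar>)" by (intro sum_mono mult_right_mono abs_coef_le) auto
    also have "\<dots> = ?B0 * (\<Sum>k<n. \<bar>coef k\<bar>)" by (simp only: sum_distrib_left)
    also have "\<dots> \<le> ?B0 * ?B1" by (rule mult_left_mono[OF sum_abs_coef_le B0])
    finally show ?thesis .
  qed
  then have "(cheb_L2_norm (cheb_rem m lam))\<^sup>2 \<le> pi / 2 * (?B0 * ?B1)"
    unfolding coef_shift by (rule cheb_L2_norm_rem_le[OF lam_pos summable_cheb_coeff])
  also have "?B0 * ?B1 = (4 / pi)\<^sup>2 * (H ^ m)\<^sup>2 / (2 * x ^ 3) * (sqrt (pi / (c * lam)))\<^sup>2"
  proof -
    have "p * (h / x\<^sup>2 * s) * (p * (h / (2 * x) * s)) = p\<^sup>2 * h\<^sup>2 / (2 * x ^ 3) * s\<^sup>2" for p h s :: real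
      by (simp add: power2_eq_square power3_eq_cube mult_ac)
    then show ?thesis .
  qed
  also have "(sqrt (pi / (c * lam)))\<^sup>2 = pi / (c * lam)" using cl_pos by simp
  also have "pi / 2 * ((4 / pi)\<^sup>2 * (H ^ m)\<^sup>2 / (2 * x ^ 3) * (pi / (c * lam))) = 4 / c * (H ^ m)\<^sup>2 / (alpha * x ^ 3 * real m)"
  proof -
    have "pi / 2 * ((4 / pi)\<^sup>2 * h / (2 * x ^ 3) * (pi / (c * (alpha * k)))) = 4 / c * h / (alpha * x ^ 3 * k)" for h k
      by (simp add: power2_eq_square)
    then show ?thesis unfolding lam_def .
  qed
  also have "\<dots> \<le> 4 / c * (H ^ m)\<^sup>2 / (1 / 8 * real m)"
    using alpha_cube(1) m c alpha_pos x_pos by (intro divide_left_mono mult_right_mono mult_pos_pos) auto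
  also have "\<dots> \<le> 36 / c\<^sup>2 * (H ^ m)\<^sup>2 / real m"
  proof -
    have "32 / c \<le> 36 / c\<^sup>2" using c by (simp add: field_simps power2_eq_square)
    then have "32 / c * ((H ^ m)\<^sup>2 / real m) \<le> 36 / c\<^sup>2 * ((H ^ m)\<^sup>2 / real m)" by (rule mult_right_mono) simp
    then show ?thesis by simp
  qed
  also have "\<dots> = (6 / c * real m powr (-1/2) * H ^ m)\<^sup>2"
    unfolding powr_neg_half using m by (simp add: power_mult_distrib power_divide)
  finally show ?thesis
    by (rule power2_le_imp_le) (use c H_pos in auto)
qed

lemma L2_norm_minus_poly_lower:
  assumes large: "(lam * real m ^ 2) powr (1/3) \<ge> 4 * (32 * err_const / gap)\<^sup>2" and p: "degree p \<le> m"
  shows "gap / 32 * real m powr (-1/2) * H ^ m \<le> cheb_L2_norm (\<lambda>y. F lam y - poly p y)"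
proof -
  define A where "A = 2 / pi * (cheb_L2_norm (\<lambda>y. F lam y - poly p y))\<^sup>2"
  have "(\<Sum>j<n. (coef j)\<^sup>2) \<le> A" for n
    using cheb_L2_norm_minus_poly_ge[OF continuous_on_F[OF lam_pos] p, of n]
    unfolding A_def coef_shift by (simp add: field_simps)
  moreover have "32 * err_const / gap \<le> x * sqrt lam"
  proof (rule power2_le_imp_le)
    have "(32 * err_const / gap)\<^sup>2 \<le> x\<^sup>2 * lam" using large x_sq_lam_ge by linarith
    then show "(32 * err_const / gap)\<^sup>2 \<le> (x * sqrt lam)\<^sup>2" using lam_pos by (simp add: power_mult_distrib)
  qed (use x_pos lam_pos in simp)
  ultimately have "(gap / 32)\<^sup>2 * (H ^ m)\<^sup>2 / real m \<le> A" by (rule sum_coef_sq_ge)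
  also have "A \<le> (cheb_L2_norm (\<lambda>y. F lam y - poly p y))\<^sup>2"
    unfolding A_def using pi_gt3 by (intro mult_left_le_one_le) auto
  finally have "(gap / 32 * real m powr (-1/2) * H ^ m)\<^sup>2 \<le> (cheb_L2_norm (\<lambda>y. F lam y - poly p y))\<^sup>2"
    unfolding powr_neg_half using m by (simp add: power_mult_distrib power_divide)
  moreover have "0 \<le> cheb_L2_norm (\<lambda>y. F lam y - poly p y)"
    by (subst cheb_L2_norm_eq) (auto intro!: continuous_intros continuous_on_F lam_pos integral_nonneg
        integrable_continuous_real continuous_on_compose2[OF continuous_on_F[OF lam_pos]])
  ultimately show ?thesis by (rule power2_le_imp_le)
qed

lemma best_approx_lower:
  assumes large: "(lam * real m ^ 2) powr (1/3) \<ge> 4 * (32 * err_const / gap)\<^sup>2"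
  shows "gap / 64 * real m powr (-1/2) * H ^ m \<le> best_approx m lam"
proof -
  have "gap / 64 * real m powr (-1/2) * H ^ m = (gap / 32 * real m powr (-1/2) * H ^ m) / 2" by simp
  also have "\<dots> \<le> (gap / 32 * real m powr (-1/2) * H ^ m) / sqrt pi"
  proof (rule divide_left_mono)
    show "sqrt pi \<le> 2" using pi_less_4 by (intro real_le_lsqrt) auto
  qed (use gap_pos H_pos in auto)
  also have "\<dots> \<le> best_approx m lam"
    by (rule best_approx_ge[OF lam_pos L2_norm_minus_poly_lower[OF large]])
  finally show ?thesis .
qed

end

section \<open>The root in the first quadrant\<close>

lemma saddle_cubic_strict_mono:
  assumes "0 < x" "3 * x\<^sup>2 \<ge> 1" "x < (x' :: real)"
  shows "2 * x * (4 * x\<^sup>2 - 1) < 2 * x' * (4 * x'\<^sup>2 - 1)"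
proof -
  have sq: "x\<^sup>2 < x'\<^sup>2" using assms by (intro power_strict_mono) auto
  have "2 * x * (4 * x\<^sup>2 - 1) < 2 * x' * (4 * x\<^sup>2 - 1)" using assms by (intro mult_strict_right_mono) auto
  also have "\<dots> < 2 * x' * (4 * x'\<^sup>2 - 1)" using assms sq by (intro mult_strict_left_mono) auto
  finally show ?thesis .
qed

lemma saddle_param_exists:
  assumes "0 < \<alpha>" "\<alpha> < alpha_c"
  obtains x where "0 < x" "3 * x\<^sup>2 > 1" "\<alpha> * (2 * x * (4 * x\<^sup>2 - 1)) = 1"
proof -
  let ?g = "\<lambda>x::real. 2 * x * (4 * x\<^sup>2 - 1)"
  define b where "b = 1 / sqrt 3"
  have b: "b > 0" "b\<^sup>2 = 1 / 3" by (simp_all add: b_def power_divide)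
  have gb: "?g b = 1 / alpha_c"
    unfolding b(2) by (simp add: b_def alpha_c_def)
  have "b \<le> 1 + 1 / \<alpha>"
  proof -
    have "b \<le> 1" by (simp add: b_def)
    then show ?thesis using assms by (simp add: add_increasing2)
  qed
  moreover have "?g b \<le> 1 / \<alpha>" unfolding gb using assms by (intro divide_left_mono) auto
  moreover have "1 / \<alpha> \<le> ?g (1 + 1 / \<alpha>)"
  proof -
    define t where "t = 1 / \<alpha>"
    have t: "t > 0" using assms by (simp add: t_def)
    have "1 \<le> (1 + t)\<^sup>2" using t by (intro one_le_power) auto
    then have "1 \<le> 4 * (1 + t)\<^sup>2 - 1" by linarith
    then have "t * 1 \<le> 2 * (1 + t) * (4 * (1 + t)\<^sup>2 - 1)" using t by (intro mult_mono) auto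
    then show ?thesis by (simp add: t_def)
  qed
  moreover have "continuous_on {b..1 + 1 / \<alpha>} ?g" by (intro continuous_intros)
  ultimately obtain x where x: "b \<le> x" "?g x = 1 / \<alpha>" using IVT'[of ?g b "1 / \<alpha>" "1 + 1 / \<alpha>"] by auto
  have "x \<noteq> b"
  proof
    assume "x = b"
    with x(2) gb have "1 / \<alpha> = 1 / alpha_c" by (simp only:)
    then show False using assms by simp
  qed
  with x have "b < x" by simp
  then have "b\<^sup>2 < x\<^sup>2" using b by (intro power_strict_mono) auto
  then show thesis using that[of x] x b \<open>b < x\<close> assms by (simp add: field_simps)
qed

text \<open>For a root with positive imaginary part the imaginary part of the equation reads
\<open>(Im z)\<^sup>2 = 3 (Re z)\<^sup>2 - 1\<close>. Inserted into the real part it leaves the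
equation for \<open>x\<close>, whose left side is strictly increasing on the relevant range.\<close>

lemma zeta_eq:
  assumes x: "0 < x" "3 * x\<^sup>2 > 1" "\<alpha> * (2 * x * (4 * x\<^sup>2 - 1)) = 1"
  shows "zeta \<alpha> = Complex x (sqrt (3 * x\<^sup>2 - 1))"
  unfolding zeta_def
proof (rule the_equality)
  have \<alpha>0: "\<alpha> \<noteq> 0" using x(3) by auto
  have reim: "complex_of_real \<alpha> * (z ^ 3 - z) + 1 = 0 \<longleftrightarrow>
     \<alpha> * ((Re z) ^ 3 - 3 * Re z * (Im z)\<^sup>2 - Re z) + 1 = 0 \<and> Im z * (3 * (Re z)\<^sup>2 - (Im z)\<^sup>2 - 1) = 0" for z
  proof -
    have "Re (complex_of_real \<alpha> * (z ^ 3 - z) + 1) = \<alpha> * ((Re z) ^ 3 - 3 * Re z * (Im z)\<^sup>2 - Re z) + 1"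
      "Im (complex_of_real \<alpha> * (z ^ 3 - z) + 1) = \<alpha> * (Im z * (3 * (Re z)\<^sup>2 - (Im z)\<^sup>2 - 1))"
      by (simp_all add: power3_eq_cube power2_eq_square algebra_simps)
    then show ?thesis using \<alpha>0 by (simp only: complex_eq_iff zero_complex.simps mult_eq_0_iff simp_thms)
  qed
  show "0 < Re (Complex x (sqrt (3 * x\<^sup>2 - 1))) \<and> 0 < Im (Complex x (sqrt (3 * x\<^sup>2 - 1))) \<and>
    complex_of_real \<alpha> * (Complex x (sqrt (3 * x\<^sup>2 - 1)) ^ 3 - Complex x (sqrt (3 * x\<^sup>2 - 1))) + 1 = 0"
    unfolding reim using x by (simp add: power3_eq_cube power2_eq_square algebra_simps)
  fix z assume z: "0 < Re z \<and> 0 < Im z \<and> complex_of_real \<alpha> * (z ^ 3 - z) + 1 = 0"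
  then have im: "(Im z)\<^sup>2 = 3 * (Re z)\<^sup>2 - 1" and re: "\<alpha> * ((Re z) ^ 3 - 3 * Re z * (Im z)\<^sup>2 - Re z) + 1 = 0"
    unfolding reim by auto
  have gz: "\<alpha> * (2 * Re z * (4 * (Re z)\<^sup>2 - 1)) = 1"
    using re unfolding im by (simp add: power3_eq_cube power2_eq_square algebra_simps)
  have z3: "3 * (Re z)\<^sup>2 \<ge> 1" using im z zero_le_power2[of "Im z"] by linarith
  have "2 * Re z * (4 * (Re z)\<^sup>2 - 1) = 2 * x * (4 * x\<^sup>2 - 1)"
    using gz x(3) \<alpha>0 by (metis mult_cancel_left)
  then have "Re z = x"
    using saddle_cubic_strict_mono[of x "Re z"] saddle_cubic_strict_mono[of "Re z" x] x z z3
    by (metis less_irrefl less_imp_le linorder_neqE)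
  moreover have "Im z = sqrt (3 * x\<^sup>2 - 1)"
    using im z \<open>Re z = x\<close> by (metis less_imp_le real_sqrt_unique)
  ultimately show "z = Complex x (sqrt (3 * x\<^sup>2 - 1))" by (simp add: complex_eq_iff)
qed

lemma H_e_eq:
  assumes x: "0 < x" "3 * x\<^sup>2 > 1" "\<alpha> * (2 * x * (4 * x\<^sup>2 - 1)) = 1"
  shows "H_e \<alpha> = sqrt ((2 * x - 1) / (2 * x + 1)) * exp (\<alpha> * (1 - 2 * x\<^sup>2))"
proof -
  define z where "z = Complex x (sqrt (3 * x\<^sup>2 - 1))"
  have s: "(sqrt (3 * x\<^sup>2 - 1))\<^sup>2 = 3 * x\<^sup>2 - 1" using x by simp
  have "cmod (z - 1) = sqrt (2 * x * (2 * x - 1))" "cmod (z + 1) = sqrt (2 * x * (2 * x + 1))"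
    by (simp_all add: cmod_def z_def s) (simp_all add: power2_eq_square algebra_simps)
  then have "cmod ((z - 1) / (z + 1)) = sqrt ((2 * x - 1) / (2 * x + 1))"
    using x(1) by (simp add: norm_divide real_sqrt_mult real_sqrt_divide)
  moreover have "Re (z\<^sup>2) = 1 - 2 * x\<^sup>2" by (simp add: Re_power2 z_def s)
  ultimately show ?thesis by (simp add: H_e_def zeta_eq[OF x] z_def)
qed

text \<open>As \<open>\<alpha>\<close> decreases, \<open>x\<close> increases, and \<open>(3
x\<^sup>2 - 1) / (x + 1)\<^sup>2\<close> is increasing in \<open>x\<close>. So the value at
\<open>\<alpha>\<^sub>0\<close> serves for all smaller \<open>\<alpha>\<close>.\<close>

lemma uniform_saddle:
  assumes "0 < \<alpha>\<^sub>0" "\<alpha>\<^sub>0 < alpha_c"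
  obtains c where "0 < c" "c \<le> 1"
    "\<And>\<alpha>. 0 < \<alpha> \<Longrightarrow> \<alpha> \<le> \<alpha>\<^sub>0 \<Longrightarrow> \<exists>x. 0 < x \<and> c * (x + 1)\<^sup>2 \<le> 3 * x\<^sup>2 - 1 \<and> \<alpha> * (2 * x * (4 * x\<^sup>2 - 1)) = 1"
proof -
  obtain x0 where x0: "0 < x0" "3 * x0\<^sup>2 > 1" "\<alpha>\<^sub>0 * (2 * x0 * (4 * x0\<^sup>2 - 1)) = 1"
    using saddle_param_exists[OF assms] .
  define c where "c = min 1 ((3 * x0\<^sup>2 - 1) / (x0 + 1)\<^sup>2)"
  have c: "0 < c" "c \<le> 1" "c * (x0 + 1)\<^sup>2 \<le> 3 * x0\<^sup>2 - 1"
  proof -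
    show "0 < c" "c \<le> 1" using x0 by (auto simp: c_def)
    have "c * (x0 + 1)\<^sup>2 \<le> (3 * x0\<^sup>2 - 1) / (x0 + 1)\<^sup>2 * (x0 + 1)\<^sup>2"
      by (intro mult_right_mono) (auto simp: c_def)
    then show "c * (x0 + 1)\<^sup>2 \<le> 3 * x0\<^sup>2 - 1" using x0 by simp
  qed
  show thesis
  proof (rule that[OF c(1,2)])
    fix \<alpha> assume \<alpha>: "0 < \<alpha>" "\<alpha> \<le> \<alpha>\<^sub>0"
    then obtain x where x: "0 < x" "3 * x\<^sup>2 > 1" "\<alpha> * (2 * x * (4 * x\<^sup>2 - 1)) = 1"
      using saddle_param_exists[of \<alpha>] assms by auto
    have "x0 \<le> x"
    proof (rule ccontr)
      assume "\<not> x0 \<le> x"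
      then have lt: "2 * x * (4 * x\<^sup>2 - 1) < 2 * x0 * (4 * x0\<^sup>2 - 1)"
        using saddle_cubic_strict_mono[of x x0] x by auto
      have pos: "0 < 2 * x * (4 * x\<^sup>2 - 1)" using x by (intro mult_pos_pos) auto
      have "\<alpha> * (2 * x * (4 * x\<^sup>2 - 1)) < \<alpha>\<^sub>0 * (2 * x0 * (4 * x0\<^sup>2 - 1))"
        by (rule mult_le_less_imp_less[OF \<alpha>(2) lt \<alpha>(1) less_imp_le[OF pos]])
      then show False unfolding x(3) x0(3) by simp
    qed
    have "(3 * x0\<^sup>2 - 1) * (x + 1)\<^sup>2 \<le> (3 * x\<^sup>2 - 1) * (x0 + 1)\<^sup>2"
    proof -
      have "(3 * x\<^sup>2 - 1) * (x0 + 1)\<^sup>2 - (3 * x0\<^sup>2 - 1) * (x + 1)\<^sup>2 = (x - x0) * (6 * x * x0 + 4 * x + 4 * x0 + 2)"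
        by (simp add: power2_eq_square algebra_simps)
      also have "\<dots> \<ge> 0" using \<open>x0 \<le> x\<close> x x0 by (intro mult_nonneg_nonneg) auto
      finally show ?thesis by simp
    qed
    moreover have "c * (x0 + 1)\<^sup>2 * (x + 1)\<^sup>2 \<le> (3 * x0\<^sup>2 - 1) * (x + 1)\<^sup>2" using c(3) by (intro mult_right_mono) auto
    ultimately have "c * (x + 1)\<^sup>2 * (x0 + 1)\<^sup>2 \<le> (3 * x\<^sup>2 - 1) * (x0 + 1)\<^sup>2" by (simp add: mult_ac)
    then have "c * (x + 1)\<^sup>2 \<le> 3 * x\<^sup>2 - 1" by (rule mult_right_le_imp_le) (use x0 in simp)
    with x show "\<exists>x. 0 < x \<and> c * (x + 1)\<^sup>2 \<le> 3 * x\<^sup>2 - 1 \<and> \<alpha> * (2 * x * (4 * x\<^sup>2 - 1)) = 1" by auto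
  qed
qed

section \<open>Logarithmic asymptotics and the theorem\<close>

text \<open>An error \<open>K + ln m\<close> is negligible against \<open>L m\<close> as soon as
\<open>\<bar>L m\<bar>\<close> is at least a multiple of \<open>\<Lambda> m\<close>.\<close>

lemma log_quotient_tendsto_1:
  fixes l L \<Lambda> :: "nat \<Rightarrow> real"
  assumes close: "\<forall>\<^sub>F m in sequentially. \<bar>l m - L m\<bar> \<le> K + ln (real m)"
    and L: "\<forall>\<^sub>F m in sequentially. L m \<le> - d * \<Lambda> m" and d: "d > 0"
    and \<Lambda>: "filterlim \<Lambda> at_top sequentially" "filterlim (\<lambda>m. \<Lambda> m / ln (real m)) at_top sequentially"
  shows "(\<lambda>m. l m / L m) \<longlonglongrightarrow> 1"
proof -
  have "(\<lambda>m. K * inverse (\<Lambda> m) + inverse (\<Lambda> m / ln (real m))) \<longlonglongrightarrow> K * 0 + 0"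
    by (intro tendsto_intros filterlim_compose[OF tendsto_inverse_0_at_top \<Lambda>(1)] filterlim_compose[OF tendsto_inverse_0_at_top \<Lambda>(2)]
          tendsto_inverse_0_at_top \<Lambda>)
  then have lim: "(\<lambda>m. (K * inverse (\<Lambda> m) + inverse (\<Lambda> m / ln (real m))) / d) \<longlonglongrightarrow> 0"
    using d by (auto intro: tendsto_eq_intros)
  have "(\<lambda>m. l m / L m - 1) \<longlonglongrightarrow> 0"
  proof (rule Lim_null_comparison[OF _ lim])
    have "\<forall>\<^sub>F m in sequentially. \<Lambda> m > 0" using \<Lambda>(1) by (simp add: filterlim_at_top_dense)
    with close L show "\<forall>\<^sub>F m in sequentially. norm (l m / L m - 1) \<le> (K * inverse (\<Lambda> m) + inverse (\<Lambda> m / ln (real m))) / d"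
    proof eventually_elim
      case (elim m)
      have dL: "0 < d * \<Lambda> m" using elim d by simp
      with elim have Lm: "d * \<Lambda> m \<le> \<bar>L m\<bar>" "L m \<noteq> 0" by auto
      have "norm (l m / L m - 1) = \<bar>l m - L m\<bar> / \<bar>L m\<bar>"
        using Lm by (simp add: diff_divide_distrib flip: abs_divide)
      also have "\<dots> \<le> (K + ln (real m)) / (d * \<Lambda> m)"
        using elim Lm dL by (intro frac_le) auto
      also have "\<dots> = (K * inverse (\<Lambda> m) + inverse (\<Lambda> m / ln (real m))) / d"
        using d elim by (simp add: field_simps)
      finally show ?case .
    qed
  qed
  then show ?thesis by (simp add: LIM_zero_iff)
qed

theorem theorem5p4:
  fixes \<alpha>\<^sub>0 :: real
  assumes "0 < \<alpha>\<^sub>0" and "\<alpha>\<^sub>0 < alpha_c"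
  shows "\<exists>c>0. \<exists>C>0. \<forall>lam :: nat \<Rightarrow> real.
    (\<forall>m\<ge>1. 0 < lam m \<and> lam m / real m \<le> \<alpha>\<^sub>0) \<longrightarrow>
    filterlim (\<lambda>m. (lam m * real m ^ 2) powr (1/3)) at_top sequentially \<longrightarrow>
      (\<forall>\<^sub>F m in sequentially.
         c * real m powr (-1/2) * H_e (lam m / real m) ^ m \<le> cheb_L2_norm (cheb_rem m (lam m)) \<and>
         cheb_L2_norm (cheb_rem m (lam m)) \<le> C * real m powr (-1/2) * H_e (lam m / real m) ^ m \<and>
         c * real m powr (-1/2) * H_e (lam m / real m) ^ m \<le> best_approx m (lam m) \<and>
         best_approx m (lam m) \<le> sup_norm (cheb_rem m (lam m)) \<and>
         sup_norm (cheb_rem m (lam m))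
           \<le> C * lam m powr (-1/6) * real m powr (-1/3) * H_e (lam m / real m) ^ m) \<and>
      (filterlim (\<lambda>m. (lam m * real m ^ 2) powr (1/3) / ln (real m)) at_top sequentially \<longrightarrow>
         (\<lambda>m. ln (cheb_L2_norm (cheb_rem m (lam m))) / ln (sup_norm (cheb_rem m (lam m))))
           \<longlonglongrightarrow> 1 \<and>
         (\<lambda>m. ln (sup_norm (cheb_rem m (lam m))) / ln (best_approx m (lam m)))
           \<longlonglongrightarrow> 1 \<and>
         (\<lambda>m. ln (best_approx m (lam m)) / (real m * ln (H_e (lam m / real m))))
           \<longlonglongrightarrow> 1)"
proof -
  obtain d where d: "0 < d" "d \<le> 1" and param:
    "\<And>\<alpha>. 0 < \<alpha> \<Longrightarrow> \<alpha> \<le> \<alpha>\<^sub>0 \<Longrightarrow> \<exists>x. 0 < x \<and> d * (x + 1)\<^sup>2 \<le> 3 * x\<^sup>2 - 1 \<and> \<alpha> * (2 * x * (4 * x\<^sup>2 - 1)) = 1"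
    by (rule uniform_saddle[OF assms]) blast
  define r where "r = 1 - 1 / sqrt (1 + d)"
  define c where "c = r / 64"
  define C where "C = 6 / d"
  \<comment> \<open>The threshold for the large parameter beyond which the Laplace error is harmless.\<close>
  define N where "N = 4 * (32 * (5 / (sqrt d * d) + 192 / (sqrt d * d\<^sup>2)) / r)\<^sup>2"
  have r: "r > 0" using d by (simp add: r_def)
  have cC: "c > 0" "C > 0" using r d by (auto simp: c_def C_def)
  define \<Lambda> where "\<Lambda> = (\<lambda>l m. (l * real m ^ 2) powr (1/3))"
  define good where "good = (\<lambda>l m. 0 < H_e (l / real m) \<and>
      c * real m powr (-1/2) * H_e (l / real m) ^ m \<le> cheb_L2_norm (cheb_rem m l) \<and>
      cheb_L2_norm (cheb_rem m l) \<le> C * real m powr (-1/2) * H_e (l / real m) ^ m \<and>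
      c * real m powr (-1/2) * H_e (l / real m) ^ m \<le> best_approx m l \<and>
      best_approx m l \<le> sup_norm (cheb_rem m l) \<and>
      sup_norm (cheb_rem m l) \<le> C * l powr (-1/6) * real m powr (-1/3) * H_e (l / real m) ^ m \<and>
      real m * ln (H_e (l / real m)) \<le> - (d / 4) * \<Lambda> l m)"
  have good: "good l m" if m: "m \<ge> 1" and l: "0 < l" "l / real m \<le> \<alpha>\<^sub>0" and large: "N \<le> \<Lambda> l m" for l m
  proof -
    from param[of "l / real m"] m l obtain x where x: "0 < x" "d * (x + 1)\<^sup>2 \<le> 3 * x\<^sup>2 - 1"
      "l / real m * (2 * x * (4 * x\<^sup>2 - 1)) = 1" by auto
    interpret saddle d x m using d x m by unfold_locales auto
    have g: "2 * x * (4 * x\<^sup>2 - 1) > 0" using x_pos four_sq by simp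
    have "l / real m = 1 / (2 * x * (4 * x\<^sup>2 - 1))"
      using x(3) g by (subst nonzero_eq_divide_eq) linarith+
    then have al: "alpha = l / real m" unfolding alpha_def by (rule sym)
    have lam: "saddle.lam x m = l" using m by (simp add: lam_def al)
    have He: "H_e (l / real m) = H"
      unfolding H_e_eq[OF x_pos x_sq x(3)] H_def al ..
    have gap: "gap = r" by (simp add: gap_def r_def)
    have lg: "(saddle.lam x m * real m ^ 2) powr (1/3) \<ge> 4 * (32 * err_const / gap)\<^sup>2"
      using large by (simp add: lam \<Lambda>_def N_def err_const_def gap)
    obtain p where p: "degree p \<le> m" "cheb_rem m l = (\<lambda>x. F l x - poly p x)"
      by (rule cheb_proj_is_poly)
    have X: "0 \<le> real m powr (-1/2) * H ^ m" using H_pos by simp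
    have "c * (real m powr (-1/2) * H ^ m) \<le> r / 32 * (real m powr (-1/2) * H ^ m)"
      using r X by (intro mult_right_mono) (auto simp: c_def)
    moreover have "r / 32 * real m powr (-1/2) * H ^ m \<le> cheb_L2_norm (cheb_rem m l)"
      unfolding p(2) using L2_norm_minus_poly_lower[OF lg p(1)] by (simp add: lam gap)
    moreover have "4 / d * (l powr (-1/6) * real m powr (-1/3) * H ^ m) \<le> C * (l powr (-1/6) * real m powr (-1/3) * H ^ m)"
      using d H_pos by (intro mult_right_mono) (auto simp: C_def divide_right_mono)
    moreover have "sup_norm (cheb_rem m l) \<le> 4 / d * l powr (-1/6) * real m powr (-1/3) * H ^ m"
      using sup_norm_rem_upper by (simp add: lam)
    moreover have "c * real m powr (-1/2) * H ^ m \<le> best_approx m l"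
      using best_approx_lower[OF lg] by (simp add: lam gap c_def)
    moreover have "cheb_L2_norm (cheb_rem m l) \<le> C * real m powr (-1/2) * H ^ m"
      using L2_norm_rem_upper by (simp add: lam C_def)
    moreover have "best_approx m l \<le> sup_norm (cheb_rem m l)"
      by (rule best_approx_le_sup_norm_rem[OF l(1)])
    moreover have "real m * ln H \<le> - (d / 4) * \<Lambda> l m"
      using ln_H_m_le by (simp add: lam \<Lambda>_def)
    ultimately show "good l m"
      unfolding good_def He using H_pos by (simp only: mult.assoc) (intro conjI TrueI; linarith)
  qed
  show ?thesis
  proof (rule exI[of _ c], intro conjI cC(1), rule exI[of _ C], intro conjI cC(2) allI impI)
    fix lam :: "nat \<Rightarrow> real"
    assume h: "\<forall>m\<ge>1. 0 < lam m \<and> lam m / real m \<le> \<alpha>\<^sub>0"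
      and lim: "filterlim (\<lambda>m. (lam m * real m ^ 2) powr (1/3)) at_top sequentially"
    have "\<forall>\<^sub>F m in sequentially. N \<le> \<Lambda> (lam m) m" "\<forall>\<^sub>F m in sequentially. 1 \<le> \<Lambda> (lam m) m"
      using lim unfolding \<Lambda>_def filterlim_at_top by blast+
    then have ev: "\<forall>\<^sub>F m in sequentially. good (lam m) m \<and> 1 \<le> \<Lambda> (lam m) m \<and> m \<ge> 1 \<and> 0 < lam m"
      using eventually_ge_at_top[of 1] by eventually_elim (use h good in auto)
    then show "\<forall>\<^sub>F m in sequentially.
         c * real m powr (-1/2) * H_e (lam m / real m) ^ m \<le> cheb_L2_norm (cheb_rem m (lam m)) \<and>
         cheb_L2_norm (cheb_rem m (lam m)) \<le> C * real m powr (-1/2) * H_e (lam m / real m) ^ m \<and>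
         c * real m powr (-1/2) * H_e (lam m / real m) ^ m \<le> best_approx m (lam m) \<and>
         best_approx m (lam m) \<le> sup_norm (cheb_rem m (lam m)) \<and>
         sup_norm (cheb_rem m (lam m))
           \<le> C * lam m powr (-1/6) * real m powr (-1/3) * H_e (lam m / real m) ^ m"
      by eventually_elim (simp add: good_def)
    assume lim2: "filterlim (\<lambda>m. (lam m * real m ^ 2) powr (1/3) / ln (real m)) at_top sequentially"
    define L where "L = (\<lambda>m. real m * ln (H_e (lam m / real m)))"
    define K where "K = \<bar>ln c\<bar> + \<bar>ln C\<bar>"
    \<comment> \<open>The prefactors \<open>m powr (-1/2)\<close> and the constants change the logarithm by at most \<open>K + ln m\<close>.\<close>
    have sandwich: "(\<lambda>m. ln (f m) / L m) \<longlonglongrightarrow> 1"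
      if f: "\<And>m. good (lam m) m \<Longrightarrow> 1 \<le> \<Lambda> (lam m) m \<Longrightarrow> m \<ge> 1 \<Longrightarrow> 0 < lam m \<Longrightarrow>
          c * real m powr (-1/2) * H_e (lam m / real m) ^ m \<le> f m \<and> f m \<le> C * H_e (lam m / real m) ^ m" for f
    proof (rule log_quotient_tendsto_1)
      show "\<forall>\<^sub>F m in sequentially. L m \<le> - (d / 4) * \<Lambda> (lam m) m"
        using ev by eventually_elim (simp add: good_def L_def)
      show "d / 4 > 0" using d by simp
      show "filterlim (\<lambda>m. \<Lambda> (lam m) m) at_top sequentially"
        "filterlim (\<lambda>m. \<Lambda> (lam m) m / ln (real m)) at_top sequentially"
        using lim lim2 by (simp_all add: \<Lambda>_def)
      show "\<forall>\<^sub>F m in sequentially. \<bar>ln (f m) - L m\<bar> \<le> K + ln (real m)"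
        using ev
      proof eventually_elim
        case (elim m)
        define h where "h = H_e (lam m / real m) ^ m"
        have H: "0 < H_e (lam m / real m)" using elim by (simp add: good_def)
        then have h: "h > 0" "ln h = L m" by (simp_all add: h_def L_def ln_realpow)
        have fm: "c * real m powr (-1/2) * h \<le> f m" "f m \<le> C * h" using f[of m] elim by (auto simp: h_def)
        have p: "0 < c * real m powr (-1/2) * h" using cC h elim by simp
        then have "ln (c * real m powr (-1/2) * h) \<le> ln (f m)" using fm by (simp add: ln_le_cancel_iff)
        moreover have "ln (c * real m powr (-1/2) * h) = ln c - ln (real m) / 2 + L m"
          using cC h elim by (simp add: ln_mult ln_powr)
        moreover have "ln (f m) \<le> ln (C * h)" using fm p by (simp add: ln_le_cancel_iff)
        moreover have "ln (C * h) = ln C + L m" using cC h by (simp add: ln_mult)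
        moreover have "ln (real m) \<ge> 0" using elim by simp
        ultimately show ?case unfolding K_def by linarith
      qed
    qed
    have upper: "c * real m powr (-1/2) * H_e (lam m / real m) ^ m \<le> cheb_L2_norm (cheb_rem m (lam m)) \<and>
         cheb_L2_norm (cheb_rem m (lam m)) \<le> C * H_e (lam m / real m) ^ m \<and>
         c * real m powr (-1/2) * H_e (lam m / real m) ^ m \<le> best_approx m (lam m) \<and>
         best_approx m (lam m) \<le> sup_norm (cheb_rem m (lam m)) \<and>
         sup_norm (cheb_rem m (lam m)) \<le> C * H_e (lam m / real m) ^ m"
      if g: "good (lam m) m" "1 \<le> \<Lambda> (lam m) m" "m \<ge> 1" "0 < lam m" for m
    proof -
      have H: "0 \<le> C * H_e (lam m / real m) ^ m" using g(1) cC by (simp add: good_def)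
      have "real m powr (-1/2) \<le> real m powr 0" using g(3) by (intro powr_mono) auto
      then have "real m powr (-1/2) * (C * H_e (lam m / real m) ^ m) \<le> 1 * (C * H_e (lam m / real m) ^ m)"
        using g(3) H by (intro mult_right_mono) auto
      then have 1: "C * real m powr (-1/2) * H_e (lam m / real m) ^ m \<le> C * H_e (lam m / real m) ^ m" by (simp add: mult_ac)
      \<comment> \<open>The prefactor of the uniform bound is \<open>\<Lambda> powr (-1/2)\<close>, which is at most \<open>1\<close>.\<close>
      have "lam m powr (-1/6) * real m powr (-1/3) = \<Lambda> (lam m) m powr (-1/2)"
        using g(3,4) by (simp add: \<Lambda>_def powr_powr powr_mult powr_numeral[symmetric] del: powr_numeral)
      also have "\<dots> \<le> \<Lambda> (lam m) m powr 0" using g(2) by (intro powr_mono) auto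
      also have "\<dots> = 1" using g(2) by simp
      finally have "lam m powr (-1/6) * real m powr (-1/3) * (C * H_e (lam m / real m) ^ m) \<le> 1 * (C * H_e (lam m / real m) ^ m)"
        using H by (rule mult_right_mono)
      then have 2: "C * lam m powr (-1/6) * real m powr (-1/3) * H_e (lam m / real m) ^ m \<le> C * H_e (lam m / real m) ^ m" by (simp add: mult_ac)
      show ?thesis using g(1) 1 2 unfolding good_def by linarith
    qed
    have l1: "(\<lambda>m. ln (cheb_L2_norm (cheb_rem m (lam m))) / L m) \<longlonglongrightarrow> 1"
      by (rule sandwich) (use upper in blast)
    have l2: "(\<lambda>m. ln (sup_norm (cheb_rem m (lam m))) / L m) \<longlonglongrightarrow> 1"
      by (rule sandwich) (use upper order.trans in blast)
    have l3: "(\<lambda>m. ln (best_approx m (lam m)) / L m) \<longlonglongrightarrow> 1"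
      by (rule sandwich) (use upper order.trans in blast)
    have Lneg: "\<forall>\<^sub>F m in sequentially. L m \<noteq> 0"
      using ev
    proof eventually_elim
      case (elim m)
      then have "L m \<le> - (d / 4) * \<Lambda> (lam m) m" "0 < d / 4 * \<Lambda> (lam m) m" using d by (auto simp: good_def L_def)
      then show ?case by linarith
    qed
    have quot: "(\<lambda>m. f m / g m) \<longlonglongrightarrow> 1" if "(\<lambda>m. f m / L m) \<longlonglongrightarrow> 1" "(\<lambda>m. g m / L m) \<longlonglongrightarrow> 1" for f g
    proof -
      have "(\<lambda>m. (f m / L m) / (g m / L m)) \<longlonglongrightarrow> 1 / 1" by (intro tendsto_divide that) simp
      moreover have "\<forall>\<^sub>F m in sequentially. (f m / L m) / (g m / L m) = f m / g m"
        using Lneg by eventually_elim simp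
      ultimately show ?thesis by (auto intro: Lim_transform_eventually)
    qed
    show "(\<lambda>m. ln (cheb_L2_norm (cheb_rem m (lam m))) / ln (sup_norm (cheb_rem m (lam m)))) \<longlonglongrightarrow> 1"
      by (rule quot[OF l1 l2])
    show "(\<lambda>m. ln (sup_norm (cheb_rem m (lam m))) / ln (best_approx m (lam m))) \<longlonglongrightarrow> 1"
      by (rule quot[OF l2 l3])
    show "(\<lambda>m. ln (best_approx m (lam m)) / (real m * ln (H_e (lam m / real m)))) \<longlonglongrightarrow> 1"
      using l3 by (simp add: L_def)
  qed
qed

end
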